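(* Let $N\ge 3$, $n\ge 2$, let $a_1,\dots,a_n\in\mathbb{R}^N$ be distinct points, and let $\mu\ge 0$ be a weight function on $\mathbb{R}^N$ such that: (1) $\sqrt{\mu}\in H^1_{loc}(\mathbb{R}^N)$ and $\mu^{-1}\in L^1_{loc}(\mathbb{R}^N)$; (2) there exist constants $C_\mu,K_\mu\in\mathbb{R}$ with $K_\mu>2-N$ such that, with $\beta=\frac{N+K_\mu-2}{n}$, $$W(x):=-\sum_{i=1}^n\frac{\beta}{|x-a_i|^2}\left[(x-a_i)\cdot\frac{\nabla\mu(x)}{\mu(x)}-K_\mu\right]\le C_\mu\qquad\text{for a.e. } x\in\mathbb{R}^N.$$ Let $$V(x)=\frac{1}{2}\sum_{\substack{i,j=1\\ i\ne j}}^{n}\frac{|a_i-a_j|^2}{|x-a_i|^2|x-a_j|^2},\qquad c_{N,\mu}=\frac{(N+K_\mu-2)^2}{n^2}.$$ Then for every $\varphi\in H^1_\mu$, $$c_{N,\mu}\int_{\mathbb{R}^N}V\varphi^2\,d\mu\le\int_{\mathbb{R}^N}|\nabla\varphi|^2\,d\mu+\int_{\mathbb{R}^N}W\varphi^2\,d\mu,$$ and, as a consequence, $$c_{N,\mu}\int_{\mathbb{R}^N}V\varphi^2\,d\mu\le\int_{\mathbb{R}^N}|\nabla\varphi|^2\,d\mu+C_\mu\int_{\mathbb{R}^N}\varphi^2\,d\mu.$$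
   Context: Notation: $d\mu=\mu(x)\,dx$, where $dx$ is Lebesgue measure on $\mathbb{R}^N$. $L^2_\mu=L^2(\mathbb{R}^N,\mu(x)dx)$, and $H^1_\mu=H^1(\mathbb{R}^N,\mu(x)dx)$ is the weighted Sobolev space of (real-valued) functions in $L^2_\mu$ whose weak first-order derivatives belong to $L^2_\mu$, with norm $\|\varphi\|_{H^1_\mu}^2=\|\varphi\|_{L^2_\mu}^2+\|\nabla\varphi\|_{L^2_\mu}^2$. The gradient $\nabla\mu$ is the weak gradient of $\mu$ (so $\nabla\mu=2\sqrt{\mu}\,\nabla\sqrt{\mu}$); the condition $\mu^{-1}\in L^1_{loc}$ forces $\mu>0$ a.e. Since $W\le C_\mu$, the integral $\int W\varphi^2\,d\mu$ is well defined in $[-\infty,\infty)$ for $\varphi\in L^2_\mu$. *)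

theory Defs
  imports "HOL-Analysis.Analysis"
begin

section \<open>Smooth functions of compact support\<close>

fun C_k :: "nat \<Rightarrow> ('a::euclidean_space \<Rightarrow> real) \<Rightarrow> bool" where
  "C_k 0 f \<longleftrightarrow> continuous_on UNIV f"
| "C_k (Suc k) f \<longleftrightarrow>
     (\<forall>x. f differentiable at x) \<and>
     (\<forall>b\<in>Basis. C_k k (\<lambda>x. frechet_derivative f (at x) b))"

definition Cc_infinity :: "('a::euclidean_space \<Rightarrow> real) set" where
  "Cc_infinity = {\<psi>. (\<forall>k. C_k k \<psi>) \<and> compact (closure {x. \<psi> x \<noteq> 0})}"


section \<open>Weak gradients\<close>

definition locally_integrable ::
    "('a::euclidean_space \<Rightarrow> 'b::euclidean_space) \<Rightarrow> bool" where
  "locally_integrable f \<longleftrightarrow> (\<forall>S. compact S \<longrightarrow> f absolutely_integrable_on S)"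

definition has_weak_gradient ::
    "('a::euclidean_space \<Rightarrow> real) \<Rightarrow> ('a \<Rightarrow> 'a) \<Rightarrow> bool" where
  "has_weak_gradient f g \<longleftrightarrow>
     locally_integrable f \<and> locally_integrable g \<and>
     (\<forall>\<psi>\<in>Cc_infinity. \<forall>b\<in>Basis.
        (LINT x|lebesgue. f x * frechet_derivative \<psi> (at x) b) =
        - (LINT x|lebesgue. (g x \<bullet> b) * \<psi> x))"

definition weakly_differentiable :: "('a::euclidean_space \<Rightarrow> real) \<Rightarrow> bool" where
  "weakly_differentiable f \<longleftrightarrow> (\<exists>g. has_weak_gradient f g)"

text \<open>A weak gradient is determined only up to a null set; \<open>weak_grad f\<close> is an arbitrary
  representative, and is meaningful only for weakly differentiable \<open>f\<close>.\<close>

definition weak_grad :: "('a::euclidean_space \<Rightarrow> real) \<Rightarrow> 'a \<Rightarrow> 'a" where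
  "weak_grad f = (SOME g. has_weak_gradient f g)"


section \<open>Function spaces\<close>

definition L2 :: "'a measure \<Rightarrow> ('a \<Rightarrow> 'b::euclidean_space) set" where
  "L2 M = {f \<in> borel_measurable M. integrable M (\<lambda>x. (norm (f x))\<^sup>2)}"

definition L2_loc :: "('a::euclidean_space \<Rightarrow> 'b::euclidean_space) set" where
  "L2_loc = {f \<in> borel_measurable lebesgue. locally_integrable (\<lambda>x. (norm (f x))\<^sup>2)}"

definition H1_loc :: "('a::euclidean_space \<Rightarrow> real) set" where
  "H1_loc = {f \<in> L2_loc. weakly_differentiable f \<and> weak_grad f \<in> L2_loc}"

text \<open>The measure \<open>\<mu>(x) dx\<close>, for a nonnegative weight \<open>\<mu>\<close>.\<close>

definition weighted :: "('a::euclidean_space \<Rightarrow> real) \<Rightarrow> 'a measure" where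
  "weighted \<mu> = density lebesgue (\<lambda>x. ennreal (\<mu> x))"

definition H1 :: "('a::euclidean_space \<Rightarrow> real) \<Rightarrow> ('a \<Rightarrow> real) set" where
  "H1 \<mu> = {\<phi> \<in> L2 (weighted \<mu>). weakly_differentiable \<phi> \<and> weak_grad \<phi> \<in> L2 (weighted \<mu>)}"

text \<open>The reciprocal is taken in \<open>ennreal\<close>, where \<open>inverse 0 = \<infinity>\<close>, so that local integrability of
  \<open>1 / \<mu>\<close> forces \<open>\<mu> > 0\<close> almost everywhere; with the real \<open>inverse 0 = 0\<close> it would not.\<close>

definition reciprocal_L1_loc :: "('a::euclidean_space \<Rightarrow> real) \<Rightarrow> bool" where
  "reciprocal_L1_loc \<mu> \<longleftrightarrow>
     \<mu> \<in> borel_measurable lebesgue \<and>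
     (\<forall>S. compact S \<longrightarrow> (\<integral>\<^sup>+x\<in>S. inverse (ennreal (\<mu> x)) \<partial>lebesgue) < \<infinity>)"


section \<open>Extended-valued integrals\<close>

text \<open>The integral as positive part minus negative part, with values in \<open>[-\<infinity>, \<infinity>]\<close>. It is
  used only for integrands whose positive part or negative part has a finite integral (otherwise
  the difference would be \<open>\<infinity> - \<infinity>\<close>).\<close>

definition ext_integral :: "'a measure \<Rightarrow> ('a \<Rightarrow> real) \<Rightarrow> ereal" where
  "ext_integral M f =
     enn2ereal (\<integral>\<^sup>+x. ennreal (f x) \<partial>M) - enn2ereal (\<integral>\<^sup>+x. ennreal (- f x) \<partial>M)"


section \<open>The potentials\<close>

definition multipole_W ::
    "nat \<Rightarrow> (nat \<Rightarrow> 'a::euclidean_space) \<Rightarrow> ('a \<Rightarrow> real) \<Rightarrow> real \<Rightarrow> 'a \<Rightarrow> real" where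
  "multipole_W n a \<mu> K x =
     (let \<beta> = (real DIM('a) + K - 2) / real n in
      - (\<Sum>i=1..n. \<beta> / (norm (x - a i))\<^sup>2 *
           ((x - a i) \<bullet> (weak_grad \<mu> x /\<^sub>R \<mu> x) - K)))"

definition multipole_V :: "nat \<Rightarrow> (nat \<Rightarrow> 'a::euclidean_space) \<Rightarrow> 'a \<Rightarrow> real" where
  "multipole_V n a x =
     1 / 2 * (\<Sum>i=1..n. \<Sum>j\<in>{1..n} - {i}.
        (norm (a i - a j))\<^sup>2 / ((norm (x - a i))\<^sup>2 * (norm (x - a j))\<^sup>2))"

definition hardy_const :: "'a::euclidean_space itself \<Rightarrow> nat \<Rightarrow> real \<Rightarrow> real" where
  "hardy_const _ n K = (real DIM('a) + K - 2)\<^sup>2 / (real n)\<^sup>2"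

end

theory Submission
  imports Defs "HOL-Computational_Algebra.Polynomial"
begin

text \<open>With \<open>E = \<Sum>\<^sub>i (x - a\<^sub>i) / |x - a\<^sub>i|\<^sup>2\<close> one has \<open>|E|\<^sup>2 = n S - V\<close> and \<open>div E = (N - 2) S\<close>, where
  \<open>S = \<Sum>\<^sub>i 1 / |x - a\<^sub>i|\<^sup>2\<close>; expanding \<open>0 \<le> \<integral> |\<nabla>\<phi> + \<beta> E \<phi>|\<^sup>2 d\<mu>\<close> and integrating the mixed term by parts gives
  the inequality. Smooth functions need not be dense in \<open>H\<^sup>1\<^sub>\<mu>\<close>, so \<open>\<phi>\<close> is truncated instead: for bounded \<open>f\<close>, a
  product rule for \<open>f(\<phi>) (\<surd>\<mu>)\<^sup>2\<close> follows from the fact that difference quotients of a weakly differentiable function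
  converge to its weak derivative in \<open>L\<^sup>1\<^sub>l\<^sub>o\<^sub>c\<close>. The singularities of \<open>E\<close> cost nothing, because the cutoff
  \<open>\<theta> = h(P)\<close> with \<open>P = \<Prod>\<^sub>i |x - a\<^sub>i|\<^sup>2\<close> has gradient \<open>2 h'(P) P E\<close> parallel to \<open>E\<close>, so that \<open>E \<cdot> \<nabla>\<theta> \<ge> 0\<close>
  near the poles. Fatou's lemma then removes the truncation and the cutoff, and shows at the same time that
  \<open>\<integral> W \<phi>\<^sup>2 d\<mu>\<close> is finite.\<close>

text \<open>E is half the gradient of log P, which is why functions of P have gradients parallel to
  E. At the outer end, where the cutoff decreases, E . \<nabla>\<theta> = 2 h'(P) P |E|^2 has the
  wrong sign. There s h'(s) >= -8 whatever the two scales of the cutoff are, and |E|^2 tends to 0 at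
  infinity, so the error is an arbitrarily small multiple of \<integral> \<phi>^2 d\<mu>. The value
  of \<beta> is selected by \<beta> n = (N - 2) + K: in \<beta>^2 V = \<beta>^2 n S - \<beta>^2
  |E|^2 the S term splits into \<beta> div E and the term \<beta> K S of W, so that nothing
  containing S survives. Fatou's lemma needs a sign. Neither W nor -W has one, but \<beta>^2 V - W +
  C >= 0, so it is applied to this combination and the finite number C \<integral> \<phi>^2 d\<mu>
  is removed afterwards. The weight enters as w^2 with w = sqrt \<mu> and \<nabla>\<mu> = 2 w
  \<nabla>w. Both w^2 and w \<nabla>w are locally integrable, which suffices next to a bounded
  f(\<phi>); the remaining term w^2 f'(\<phi>) \<nabla>\<phi> is controlled by the finite weighted
  norm of \<phi>.\<close>

section \<open>Smooth bump functions\<close>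

text \<open>\<open>C_k (Suc k)\<close> asks for \<open>C_k k\<close> only of the partial
  derivatives, so that the classes decrease in k needs its own induction; the Leibniz rule in
  \<open>C_k_mult\<close> relies on it for the undifferentiated factor.\<close>

lemma C_k_SucD: "C_k (Suc k) f \<Longrightarrow> C_k k f"
proof (induction k arbitrary: f)
  case 0
  then show ?case
    by (auto intro!: differentiable_imp_continuous_on simp: differentiable_on_def intro: differentiable_at_withinI)
next
  case (Suc k)
  then show ?case by (metis C_k.simps(2))
qed

lemma C_k_SucI:
  assumes "\<And>x. (f has_derivative f' x) (at x)" and "\<And>b. b \<in> Basis \<Longrightarrow> C_k k (\<lambda>x. f' x b)"
  shows "C_k (Suc k) f"
proof -
  have "frechet_derivative f (at x) = f' x" for x
    using assms(1) frechet_derivative_at by metis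
  then show ?thesis
    using assms by (auto simp: differentiable_def)
qed

lemma C_k_const: "C_k k (\<lambda>x. c)"
proof (induction k arbitrary: c)
  case (Suc k)
  show ?case by (rule C_k_SucI[where f' = "\<lambda>_ _. 0"]) (auto simp: Suc)
qed auto

lemma C_k_SucE:
  assumes "C_k (Suc k) f"
  shows "(f has_derivative frechet_derivative f (at x)) (at x)"
    and "b \<in> Basis \<Longrightarrow> C_k k (\<lambda>x. frechet_derivative f (at x) b)"
  using assms by (auto simp: frechet_derivative_works)

lemma C_k_add: "C_k k f \<Longrightarrow> C_k k g \<Longrightarrow> C_k k (\<lambda>x. f x + g x)"
proof (induction k arbitrary: f g)
  case 0
  then show ?case by (auto intro: continuous_intros)
next
  case (Suc k)
  show ?case
    by (rule C_k_SucI, rule has_derivative_add[OF C_k_SucE(1)[OF Suc(2)] C_k_SucE(1)[OF Suc(3)]])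
       (intro Suc.IH C_k_SucE(2)[OF Suc(2)] C_k_SucE(2)[OF Suc(3)])
qed

lemma C_k_mult: "C_k k f \<Longrightarrow> C_k k g \<Longrightarrow> C_k k (\<lambda>x. f x * g x)"
proof (induction k arbitrary: f g)
  case 0
  then show ?case by (auto intro: continuous_intros)
next
  case (Suc k)
  show ?case
    by (rule C_k_SucI, rule has_derivative_mult[OF C_k_SucE(1)[OF Suc(2)] C_k_SucE(1)[OF Suc(3)]])
       (intro C_k_add Suc.IH C_k_SucE(2)[OF Suc(2)] C_k_SucE(2)[OF Suc(3)] C_k_SucD[OF Suc(2)] C_k_SucD[OF Suc(3)])
qed

lemma C_k_prod: "(\<And>i. i \<in> I \<Longrightarrow> C_k k (f i)) \<Longrightarrow> C_k k (\<lambda>x. \<Prod>i\<in>I. f i x)"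
  by (induction I rule: infinite_finite_induct) (auto intro: C_k_const C_k_mult)

lemma has_derivative_translate:
  fixes f :: "'a::real_normed_vector \<Rightarrow> 'b::real_normed_vector"
  assumes "(f has_derivative f') (at (x + a))"
  shows "((\<lambda>x. f (x + a)) has_derivative f') (at x)"
  by (rule has_derivative_compose[of "\<lambda>x. x + a" "\<lambda>h. h" x UNIV f, simplified])
     (auto intro!: derivative_eq_intros assms)

lemma C_k_translate: "C_k k f \<Longrightarrow> C_k k (\<lambda>x. f (x + a))"
proof (induction k arbitrary: f)
  case 0
  then show ?case by (auto intro!: continuous_on_compose2[of UNIV f] continuous_intros)
next
  case (Suc k)
  show ?case
    by (rule C_k_SucI, rule has_derivative_translate[OF C_k_SucE(1)[OF Suc(2)]])
       (intro Suc.IH C_k_SucE(2)[OF Suc(2)])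
qed

lemma frechet_derivative_translate:
  fixes f :: "'a::real_normed_vector \<Rightarrow> 'b::real_normed_vector"
  assumes "f differentiable at (x + a)"
  shows "frechet_derivative (\<lambda>x. f (x + a)) (at x) = frechet_derivative f (at (x + a))"
  using has_derivative_translate[OF assms[unfolded frechet_derivative_works]] frechet_derivative_at by metis

lemma Cc_infinity_translate:
  assumes "\<psi> \<in> Cc_infinity" shows "(\<lambda>x. \<psi> (x + a)) \<in> Cc_infinity"
proof -
  have "{x. \<psi> (x + a) \<noteq> 0} = (\<lambda>x. - a + x) ` {x. \<psi> x \<noteq> 0}"
    by (auto simp: image_iff) (metis add.commute diff_add_cancel uminus_add_conv_diff)
  then have "closure {x. \<psi> (x + a) \<noteq> 0} = (\<lambda>x. - a + x) ` closure {x. \<psi> x \<noteq> 0}"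
    by (simp only: closure_translation)
  then show ?thesis
    using assms C_k_translate[of _ \<psi> a] compact_translation[of "closure {x. \<psi> x \<noteq> 0}" "-a"]
    by (simp add: Cc_infinity_def del: compact_closure)
qed

section \<open>The flat function exp (-1/x) and smooth approximations of boxes\<close>

text \<open>This family is closed under differentiation, which gives smoothness of \<open>exp (- 1 / x)\<close> at 0.\<close>

definition exp_recip :: "real poly \<Rightarrow> real \<Rightarrow> real" where
  "exp_recip p x = (if x > 0 then poly p (1 / x) * exp (- 1 / x) else 0)"

lemma exp_recip_tendsto_0: "((\<lambda>y. exp_recip p y) \<longlongrightarrow> 0) (at_right 0)"
proof -
  have "((\<lambda>y::real. \<Sum>i\<le>degree p. coeff p i * (y ^ i / exp y)) \<longlongrightarrow> (\<Sum>i\<le>degree p. coeff p i * 0)) at_top"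
    by (intro tendsto_sum tendsto_mult tendsto_const tendsto_power_div_exp_0)
  then have "((\<lambda>y. poly p y * exp (- y)) \<longlongrightarrow> 0) at_top"
    by (simp add: poly_altdef sum_distrib_right exp_minus divide_inverse mult.assoc)
  then have "((\<lambda>x. poly p (inverse x) * exp (- inverse x)) \<longlongrightarrow> 0) (at_right 0)"
    by (rule filterlim_compose[OF _ filterlim_inverse_at_top_right])
  then show ?thesis
    by (rule Lim_transform_eventually)
       (auto simp: eventually_at_right_less exp_recip_def inverse_eq_divide eventually_at_filter)
qed

text \<open>With y = 1/x one has dy/dx = - y^2, so p(y) exp(-y) differentiates to y^2 (p - p')(y)
  exp(-y); \<open>[:0, 0, 1:]\<close> is the polynomial y^2.\<close>

lemma exp_recip_has_derivative:
  "(exp_recip p has_real_derivative exp_recip ((p - pderiv p) * [:0, 0, 1:]) x) (at x)"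
proof -
  consider "x < 0" | "x > 0" | "x = 0" by linarith
  then show ?thesis
  proof cases
    case 1
    have "((\<lambda>x. 0) has_real_derivative 0) (at x)" by simp
    then show ?thesis
      using 1 by (subst DERIV_cong_ev[OF refl _ refl, of _ "\<lambda>_. 0"])
        (auto simp: exp_recip_def intro: eventually_mono[OF eventually_nhds_in_open[of "{..<0}"]])
  next
    case 2
    have "((\<lambda>x. poly p (1 / x) * exp (- 1 / x)) has_real_derivative
      exp_recip ((p - pderiv p) * [:0, 0, 1:]) x) (at x)"
      using 2 by (auto intro!: derivative_eq_intros DERIV_chain2[OF poly_DERIV]
        simp: exp_recip_def power2_eq_square field_simps)
    then show ?thesis
      using 2 by (subst DERIV_cong_ev[OF refl _ refl])
        (auto simp: exp_recip_def intro: eventually_mono[OF eventually_nhds_in_open[of "{0<..}"]])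
  next
    case 3
    have "((\<lambda>y. exp_recip p y / y) \<longlongrightarrow> 0) (at 0)"
    proof (rule filterlim_split_at)
      show "((\<lambda>y. exp_recip p y / y) \<longlongrightarrow> 0) (at_left 0)"
        by (rule Lim_transform_eventually[of "\<lambda>_. 0"])
          (auto simp: eventually_at_filter exp_recip_def)
      \<comment> \<open>Dividing by y multiplies the polynomial in 1/y by its variable, which turns
        p into \<open>pCons 0 p\<close>.\<close>
      show "((\<lambda>y. exp_recip p y / y) \<longlongrightarrow> 0) (at_right 0)"
        by (rule Lim_transform_eventually[OF exp_recip_tendsto_0[of "pCons 0 p"]])
          (auto simp: eventually_at_filter exp_recip_def)
    qed
    then show ?thesis
      using 3 by (simp add: has_field_derivative_iff exp_recip_def)
  qed
qed

lemma C_k_exp_recip: "C_k k (\<lambda>x. exp_recip p (c * (x \<bullet> b) + d))"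
proof (induction k arbitrary: p)
  case 0
  have "continuous_on UNIV (exp_recip p)"
    using exp_recip_has_derivative DERIV_continuous_on by blast
  then show ?case by (auto intro!: continuous_on_compose2[of UNIV "exp_recip p"] continuous_intros)
next
  case (Suc k)
  have "((\<lambda>x. exp_recip p (c * (x \<bullet> b) + d)) has_derivative
      (\<lambda>h. (c * (h \<bullet> b)) * exp_recip ((p - pderiv p) * [:0, 0, 1:]) (c * (x \<bullet> b) + d))) (at x)" for x
    by (rule has_derivative_eq_rhs[OF has_derivative_compose[OF _
        exp_recip_has_derivative[unfolded has_field_derivative_def]]])
       (auto intro!: derivative_eq_intros simp: fun_eq_iff algebra_simps)
  then show ?case
    by (rule C_k_SucI) (intro C_k_mult C_k_const Suc)
qed

text \<open>Every coordinate contributes one factor exp(-1/(k t)) per face, with k = j + 1 and t the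
  signed distance to that face: it is 0 outside and tends to 1 inside as j grows. The approximation
  is from below, so the indicator itself dominates, and boxes are the right sets because they form
  an intersection-stable generator of the Borel sets.\<close>

lemma box_indicator_approx:
  fixes l r :: "'a::euclidean_space"
  obtains \<psi> :: "nat \<Rightarrow> 'a \<Rightarrow> real" where
    "\<And>j. \<psi> j \<in> Cc_infinity" "\<And>j x. 0 \<le> \<psi> j x" "\<And>j x. \<psi> j x \<le> indicator (box l r) x"
    "\<And>x. (\<lambda>j. \<psi> j x) \<longlonglongrightarrow> indicator (box l r) x"
proof -
  \<comment> \<open>The arguments are spelled out as c (x . b) + d, the shape to which
    \<open>C_k_exp_recip\<close> applies.\<close>
  let ?e = "\<lambda>j b x. exp_recip 1 (real (Suc j) * (x \<bullet> b) + (- real (Suc j) * (l \<bullet> b))) *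
      exp_recip 1 ((- real (Suc j)) * (x \<bullet> b) + real (Suc j) * (r \<bullet> b))"
  define \<psi> where "\<psi> j x = (\<Prod>b\<in>Basis. ?e j b x)" for j :: nat and x :: 'a
  have e: "exp_recip 1 (real (Suc j) * t) = (if t > 0 then exp (- 1 / (real (Suc j) * t)) else 0)" for j t
    by (auto simp: exp_recip_def zero_less_mult_iff)
  have \<psi>: "\<psi> j x = (\<Prod>b\<in>Basis. exp_recip 1 (real (Suc j) * (x \<bullet> b - l \<bullet> b)) *
      exp_recip 1 (real (Suc j) * (r \<bullet> b - x \<bullet> b)))" for j x
    unfolding \<psi>_def by (simp add: algebra_simps)
  have e01: "0 \<le> exp_recip 1 y" "exp_recip 1 y \<le> 1" for y
    by (auto simp: exp_recip_def)
  have zero: "\<psi> j x = 0" if x: "x \<notin> box l r" for j x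
  proof -
    obtain b where b: "b \<in> Basis" "\<not> (l \<bullet> b < x \<bullet> b \<and> x \<bullet> b < r \<bullet> b)"
      using x by (auto simp: mem_box)
    then have "exp_recip 1 (real (Suc j) * (x \<bullet> b - l \<bullet> b)) *
      exp_recip 1 (real (Suc j) * (r \<bullet> b - x \<bullet> b)) = 0" unfolding e by auto
    then show ?thesis unfolding \<psi> using b(1) by (intro prod_zero) auto
  qed
  show thesis
  proof
    fix j
    have "{x. \<psi> j x \<noteq> 0} \<subseteq> box l r" using zero by auto
    then have "compact (closure {x. \<psi> j x \<noteq> 0})"
      by (subst compact_closure) (rule bounded_subset[OF bounded_box])
    moreover have "C_k k (\<psi> j)" for k
      unfolding \<psi>_def by (intro C_k_prod C_k_mult C_k_exp_recip)
    ultimately show "\<psi> j \<in> Cc_infinity" by (auto simp: Cc_infinity_def)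
  next
    fix j x
    show "0 \<le> \<psi> j x" unfolding \<psi> by (intro prod_nonneg mult_nonneg_nonneg e01 ballI)
    show "\<psi> j x \<le> indicator (box l r) x"
    proof (cases "x \<in> box l r")
      case True
      then show ?thesis
        unfolding \<psi> by (auto intro!: prod_le_1 mult_le_one mult_nonneg_nonneg e01)
    qed (simp add: zero)
  next
    fix x
    show "(\<lambda>j. \<psi> j x) \<longlonglongrightarrow> indicator (box l r) x"
    proof (cases "x \<in> box l r")
      case True
      have t: "(\<lambda>j. exp_recip 1 (real (Suc j) * t)) \<longlonglongrightarrow> 1" if t: "t > 0" for t
      proof -
        have "(\<lambda>j. exp (- ((1 / t) * inverse (real (Suc j))))) \<longlonglongrightarrow> exp (- ((1 / t) * 0))"
          by (intro tendsto_exp tendsto_minus tendsto_mult tendsto_const LIMSEQ_inverse_real_of_nat)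
        moreover have "exp_recip 1 (real (Suc j) * t) = exp (- ((1 / t) * inverse (real (Suc j))))" for j
          using t by (simp only: e) (simp add: field_simps)
        ultimately show ?thesis by simp
      qed
      have "(\<lambda>j. \<psi> j x) \<longlonglongrightarrow> (\<Prod>b\<in>(Basis::'a set). 1 * 1)"
        unfolding \<psi> using True by (intro tendsto_prod tendsto_mult t) (auto simp: mem_box)
      then show ?thesis using True by simp
    qed (simp add: zero)
  qed
qed

section \<open>Locally integrable functions and the fundamental lemma\<close>

lemma sets_borel_cball [measurable]: "cball c r \<in> sets borel"
  by simp

text \<open>Local integrability for Borel functions: Fubini's theorem is available on \<open>lborel\<close>, not on its
  completion, so all weak derivatives are handled through Borel representatives.\<close>

definition loc_int :: "('a::euclidean_space \<Rightarrow> real) \<Rightarrow> bool" where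
  "loc_int f \<longleftrightarrow> f \<in> borel_measurable borel \<and>
     (\<forall>R. integrable lborel (\<lambda>x. indicator (cball 0 R) x * f x))"

lemma loc_int_measurable [measurable_dest]: "loc_int f \<Longrightarrow> f \<in> borel_measurable borel"
  by (simp add: loc_int_def)

lemma loc_int_mult_integrable:
  assumes f: "loc_int f" and [measurable]: "h \<in> borel_measurable borel"
    and h: "\<And>x. \<bar>h x\<bar> \<le> c" "\<And>x. norm x > R \<Longrightarrow> h x = 0"
  shows "integrable lborel (\<lambda>x. f x * h x)"
proof (rule Bochner_Integration.integrable_bound)
  show "integrable lborel (\<lambda>x. c * (indicator (cball 0 R) x * f x))"
    using f by (simp add: loc_int_def)
  have [measurable]: "f \<in> borel_measurable borel" by (rule loc_int_measurable[OF f])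
  show "(\<lambda>x. f x * h x) \<in> borel_measurable lborel" by measurable
  have "0 \<le> c" using h(1)[of 0] by linarith
  then have "\<bar>f x * h x\<bar> \<le> \<bar>c * (indicator (cball 0 R) x * f x)\<bar>" for x
    using mult_right_mono[OF h(1)[of x], of "\<bar>f x\<bar>"] h(2)[of x]
    by (cases "norm x \<le> R") (auto simp: abs_mult mult_ac)
  then show "AE x in lborel. norm (f x * h x) \<le> norm (c * (indicator (cball 0 R) x * f x))" by simp
qed

lemma loc_int_indicator_integrable:
  assumes "loc_int f" "bounded A" "A \<in> sets borel"
  shows "integrable lborel (\<lambda>x. f x * indicator A x)"
proof -
  obtain R where R: "\<forall>x\<in>A. norm x \<le> R" using assms(2) by (auto simp: bounded_iff)
  have "indicator A x = (0::real)" if "norm x > R" for x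
    using R that by (force simp: indicator_def)
  then show ?thesis
    using assms by (intro loc_int_mult_integrable[where c = 1 and R = R]) (auto simp: indicator_def)
qed

lemma Cc_infinity_support:
  assumes "\<psi> \<in> Cc_infinity"
  obtains R where "\<And>x. norm x > R \<Longrightarrow> \<psi> x = 0"
    "\<And>x v. norm x > R \<Longrightarrow> frechet_derivative \<psi> (at x) v = 0"
proof -
  have "bounded (closure {x. \<psi> x \<noteq> 0})"
    using assms by (auto simp: Cc_infinity_def)
  then obtain R where "\<And>x. x \<in> closure {x. \<psi> x \<noteq> 0} \<Longrightarrow> norm x \<le> R" by (auto simp: bounded_iff)
  then have R: "\<psi> x = 0" if "norm x > R" for x
    using that closure_subset[of "{x. \<psi> x \<noteq> 0}"] by (metis (mono_tags) linorder_not_le mem_Collect_eq subsetD)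
  have "frechet_derivative \<psi> (at x) v = 0" if x: "norm x > R" for x v
  proof -
    have "(\<psi> has_derivative (\<lambda>_. 0)) (at x)"
    proof (rule has_derivative_transform_within_open)
      show "open (- cball 0 R)" by auto
    qed (use x R in auto)
    then show ?thesis by (metis frechet_derivative_at)
  qed
  with R show thesis by (rule that)
qed

lemma continuous_bounded_support_bounded:
  fixes f :: "'a::euclidean_space \<Rightarrow> real"
  assumes "continuous_on UNIV f" "\<And>x. norm x > R \<Longrightarrow> f x = 0"
  obtains c where "\<And>x. \<bar>f x\<bar> \<le> c"
proof -
  have "compact (f ` cball 0 R)"
    using assms(1) by (intro compact_continuous_image) (auto intro: continuous_on_subset)
  then obtain c where c: "\<forall>x\<in>cball 0 R. \<bar>f x\<bar> \<le> c"
    using compact_imp_bounded[of "f ` cball 0 R"] by (auto simp: bounded_iff)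
  have "\<bar>f x\<bar> \<le> max c 0" for x
    using bspec[OF c, of x] assms(2)[of x] by (cases "norm x \<le> R") auto
  then show thesis by (rule that)
qed

lemma Cc_infinity_continuous:
  assumes "\<psi> \<in> Cc_infinity"
  shows "continuous_on UNIV \<psi>" "\<psi> differentiable at x"
    "b \<in> Basis \<Longrightarrow> continuous_on UNIV (\<lambda>x. frechet_derivative \<psi> (at x) b)"
proof -
  have *: "C_k 0 \<psi>" "C_k (Suc 0) \<psi>" using assms unfolding Cc_infinity_def by blast+
  show "continuous_on UNIV \<psi>" using *(1) by simp
  show "\<psi> differentiable at x" "b \<in> Basis \<Longrightarrow> continuous_on UNIV (\<lambda>x. frechet_derivative \<psi> (at x) b)"
    using *(2) by simp_all
qed

lemma Cc_infinity_bounds: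
  assumes "\<psi> \<in> Cc_infinity" "b \<in> Basis"
  obtains c R where "\<And>x. \<bar>\<psi> x\<bar> \<le> c" "\<And>x. \<bar>frechet_derivative \<psi> (at x) b\<bar> \<le> c"
    "\<And>x. norm x > R \<Longrightarrow> \<psi> x = 0" "\<And>x. norm x > R \<Longrightarrow> frechet_derivative \<psi> (at x) b = 0"
proof -
  obtain R where R: "\<And>x. norm x > R \<Longrightarrow> \<psi> x = 0"
    "\<And>x v. norm x > R \<Longrightarrow> frechet_derivative \<psi> (at x) v = 0"
    using Cc_infinity_support[OF assms(1)] by blast
  obtain c1 where c1: "\<And>x. \<bar>\<psi> x\<bar> \<le> c1"
    using continuous_bounded_support_bounded[OF Cc_infinity_continuous(1)[OF assms(1)] R(1)] by blast
  obtain c2 where c2: "\<And>x. \<bar>frechet_derivative \<psi> (at x) b\<bar> \<le> c2"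
    using continuous_bounded_support_bounded[OF Cc_infinity_continuous(3)[OF assms] R(2)] by blast
  show thesis
    by (rule that[of "max c1 c2" R]) (use c1 c2 R in \<open>auto simp: le_max_iff_disj\<close>)
qed

lemma loc_int_test_integrable:
  assumes "loc_int f" "\<psi> \<in> Cc_infinity"
  shows "integrable lborel (\<lambda>x. f x * \<psi> x)"
proof -
  obtain c R where cR: "\<And>x. \<bar>\<psi> x\<bar> \<le> c" "\<And>x. norm x > R \<Longrightarrow> \<psi> x = 0"
    using Cc_infinity_bounds[OF assms(2) SOME_Basis] by metis
  have "\<psi> \<in> borel_measurable borel"
    by (rule borel_measurable_continuous_onI[OF Cc_infinity_continuous(1)[OF assms(2)]])
  from loc_int_mult_integrable[OF assms(1) this cR] show ?thesis .
qed

text \<open>The approximations of boxes carry the hypothesis over to indicators of boxes, Dynkin's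
  argument extends it to Borel sets, and testing with the sets where f is positive or negative
  finishes the proof.\<close>

lemma fundamental_lemma_variations:
  fixes f :: "'a::euclidean_space \<Rightarrow> real"
  assumes f: "loc_int f" and zero: "\<And>\<psi>. \<psi> \<in> Cc_infinity \<Longrightarrow> (LBINT x. f x * \<psi> x) = 0"
  shows "AE x in lborel. f x = 0"
proof -
  have [measurable]: "f \<in> borel_measurable borel" by (rule loc_int_measurable[OF f])
  have box0: "(LBINT x. f x * indicator (box l r) x) = 0" for l r :: 'a
  proof -
    obtain \<psi> :: "nat \<Rightarrow> 'a \<Rightarrow> real" where \<psi>: "\<And>j. \<psi> j \<in> Cc_infinity" "\<And>j x. 0 \<le> \<psi> j x"
      "\<And>j x. \<psi> j x \<le> indicator (box l r) x" "\<And>x. (\<lambda>j. \<psi> j x) \<longlonglongrightarrow> indicator (box l r) x"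
      using box_indicator_approx[of l r] by blast
    have [measurable]: "\<psi> j \<in> borel_measurable borel" for j
      by (intro borel_measurable_continuous_onI Cc_infinity_continuous \<psi>)
    have "(\<lambda>j. LBINT x. f x * \<psi> j x) \<longlonglongrightarrow> (LBINT x. f x * indicator (box l r) x)"
    proof (rule integral_dominated_convergence[where w = "\<lambda>x. \<bar>f x * indicator (box l r) x\<bar>"])
      show "integrable lborel (\<lambda>x. \<bar>f x * indicator (box l r) x\<bar>)"
        by (intro integrable_abs loc_int_indicator_integrable f) auto
      show "AE x in lborel. (\<lambda>j. f x * \<psi> j x) \<longlonglongrightarrow> f x * indicator (box l r) x"
        by (intro AE_I2 tendsto_mult tendsto_const \<psi>)
      show "AE x in lborel. norm (f x * \<psi> j x) \<le> \<bar>f x * indicator (box l r) x\<bar>" for j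
        using \<psi>(2,3) by (auto simp: abs_mult intro!: mult_left_mono)
    qed auto
    then have "(\<lambda>j::nat. 0) \<longlonglongrightarrow> (LBINT x. f x * indicator (box l r) x)"
      by (simp only: zero[OF \<psi>(1)])
    then show ?thesis using LIMSEQ_const_iff by metis
  qed
  have "AE x in lborel. x \<in> box (- (real n *\<^sub>R One)) (real n *\<^sub>R One) \<longrightarrow> f x = 0" for n
  proof -
    \<comment> \<open>Inside a bounded window f is integrable, without which neither complements nor
      countable disjoint unions could be treated in the Dynkin induction.\<close>
    let ?B = "box (- (real n *\<^sub>R One)) (real n *\<^sub>R One) :: 'a set"
    have int: "integrable lborel (\<lambda>x. f x * indicator (A \<inter> ?B) x)" if "A \<in> sets borel" for A
      using that by (intro loc_int_indicator_integrable f) auto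
    have sets: "(LBINT x. f x * indicator (A \<inter> ?B) x) = 0" if A: "A \<in> sets borel" for A
    proof -
      let ?G = "range (\<lambda>(a, b). box a b :: 'a set)"
      have ss: "sigma_sets UNIV ?G = sets (borel :: 'a measure)" by (simp add: borel_eq_box)
      have "Int_stable ?G"
        by (auto simp: Int_stable_def box_Int_box)
      moreover have "?G \<subseteq> Pow UNIV" by simp
      moreover have "A \<in> sigma_sets UNIV ?G" using A by (simp add: borel_eq_box)
      ultimately show ?thesis
      proof (induction rule: sigma_sets_induct_disjoint)
        case (basic A)
        then show ?case using box0 by (auto simp: box_Int_box)
      next
        case (compl A)
        have "(LBINT x. f x * indicator ((UNIV - A) \<inter> ?B) x) =
            (LBINT x. f x * indicator ?B x - f x * indicator (A \<inter> ?B) x)"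
          by (intro Bochner_Integration.integral_cong) (auto simp: indicator_def)
        also have "\<dots> = 0"
          using box0[of "- (real n *\<^sub>R One)" "real n *\<^sub>R One"] compl int[of UNIV] int[of A] ss
          by (subst Bochner_Integration.integral_diff) auto
        finally show ?case .
      next
        case (union A)
        then have A: "A i \<in> sets borel" for i using ss by auto
        have "(LBINT x. f x * indicator ((\<Union>i. A i) \<inter> ?B) x) = (LINT x:(\<Union>i. A i \<inter> ?B)|lborel. f x)"
          unfolding set_lebesgue_integral_def by (intro Bochner_Integration.integral_cong) (auto simp: indicator_def)
        also have "\<dots> = (\<Sum>i. LINT x:(A i \<inter> ?B)|lborel. f x)"
        proof (rule lebesgue_integral_countable_add)
          show "set_integrable lborel (\<Union>i. A i \<inter> ?B) f"
            using int[of "\<Union>i. A i"] A unfolding set_integrable_def by (auto simp: mult.commute)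
          show "A i \<inter> ?B \<inter> (A j \<inter> ?B) = {}" if "i \<noteq> j" for i j
            using that union(1) by (auto simp: disjoint_family_on_def)
        qed (use A in auto)
        also have "\<dots> = 0"
          using union(3) unfolding set_lebesgue_integral_def by (simp add: mult.commute)
        finally show ?case .
      qed auto
    qed
    have "AE x in lborel. f x * indicator ({x. f x > 0} \<inter> ?B) x = 0"
      using sets[of "{x. f x > 0}"] int[of "{x. f x > 0}"]
      by (subst integral_nonneg_eq_0_iff_AE[symmetric]) (auto simp: indicator_def)
    moreover have "AE x in lborel. - (f x * indicator ({x. f x < 0} \<inter> ?B) x) = 0"
      using sets[of "{x. f x < 0}"] int[of "{x. f x < 0}"]
      by (subst integral_nonneg_eq_0_iff_AE[symmetric]) (auto simp: indicator_def)
    ultimately show ?thesis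
      by eventually_elim (auto simp: indicator_def split: if_splits)
  qed
  then have "AE x in lborel. \<forall>n::nat. x \<in> box (- (real n *\<^sub>R One)) (real n *\<^sub>R One) \<longrightarrow> f x = 0"
    unfolding AE_all_countable by blast
  then show ?thesis
  proof eventually_elim
    case (elim x)
    have "x \<in> (\<Union>n::nat. box (- (real n *\<^sub>R One)) (real n *\<^sub>R One))"
      by (simp only: UN_box_eq_UNIV UNIV_I)
    then show ?case using elim by blast
  qed
qed

section \<open>Translations and their continuity in L^1\<close>

lemma lborel_distr_translate: "distr lborel borel (\<lambda>x. x + c) = (lborel :: 'a::euclidean_space measure)"
  using lborel_distr_plus[of c] by (simp add: add.commute[of _ c] cong: distr_cong)

lemma integrable_lborel_translate:
  fixes f :: "'a::euclidean_space \<Rightarrow> real"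
  assumes "integrable lborel f" shows "integrable lborel (\<lambda>x. f (x + c))"
proof -
  have "integrable (distr lborel borel (\<lambda>x. x + c)) f" using assms by (simp add: lborel_distr_translate)
  then show ?thesis by (rule integrable_distr[rotated]) simp
qed

lemma integral_lborel_translate:
  fixes f :: "'a::euclidean_space \<Rightarrow> real"
  assumes "f \<in> borel_measurable borel"
  shows "(LBINT x. f (x + c)) = (LBINT x. f x)"
  by (subst (2) lborel_distr_translate[of c, symmetric], subst integral_distr) (use assms in auto)

text \<open>Continuity of translations in \<open>L\<^sup>1\<close> is closed under \<open>L\<^sup>1\<close> limits, so it suffices to treat open sets; there
  \<open>1\<^sub>U(x) \<le> lim inf 1\<^sub>U(x + h)\<close> and the integrals agree.\<close>

definition translation_continuous :: "('a::euclidean_space \<Rightarrow> real) \<Rightarrow> bool" where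
  "translation_continuous f \<longleftrightarrow> ((\<lambda>h. LBINT x. \<bar>f (x + h) - f x\<bar>) \<longlongrightarrow> 0) (at 0)"

text \<open>By translation invariance the approximation error of the shifted functions equals that
  of the unshifted ones, hence the three thirds of e.\<close>

lemma translation_continuous_approx:
  fixes f :: "'a::euclidean_space \<Rightarrow> real"
  assumes f: "integrable lborel f"
    and approx: "\<And>e. e > 0 \<Longrightarrow> \<exists>g. integrable lborel g \<and> translation_continuous g \<and> (LBINT x. \<bar>f x - g x\<bar>) < e"
  shows "translation_continuous f"
  unfolding translation_continuous_def tendsto_iff
proof (intro allI impI)
  fix e :: real assume e: "e > 0"
  obtain g where g: "integrable lborel g" "translation_continuous g" and d: "(LBINT x. \<bar>f x - g x\<bar>) < e / 3"
    using approx[of "e / 3"] e by auto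
  have "\<forall>\<^sub>F h in at 0. dist (LBINT x. \<bar>g (x + h) - g x\<bar>) 0 < e / 3"
    using g(2) divide_pos_pos[OF e, of 3] unfolding translation_continuous_def tendsto_iff by fastforce
  then show "\<forall>\<^sub>F h in at 0. dist (LBINT x. \<bar>f (x + h) - f x\<bar>) 0 < e"
  proof eventually_elim
    case (elim h)
    have [measurable]: "f \<in> borel_measurable borel" "g \<in> borel_measurable borel"
      using f g(1) by (auto dest: borel_measurable_integrable)
    note int = f g(1) integrable_lborel_translate[OF f, of h] integrable_lborel_translate[OF g(1), of h]
    have "(LBINT x. \<bar>f (x + h) - f x\<bar>)
        \<le> (LBINT x. \<bar>f (x + h) - g (x + h)\<bar> + \<bar>g (x + h) - g x\<bar> + \<bar>f x - g x\<bar>)"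
      by (intro integral_mono integrable_abs Bochner_Integration.integrable_add Bochner_Integration.integrable_diff int) auto
    also have "\<dots> = (LBINT x. \<bar>f (x + h) - g (x + h)\<bar>) + (LBINT x. \<bar>g (x + h) - g x\<bar>)
        + (LBINT x. \<bar>f x - g x\<bar>)"
      using int by simp
    also have "(LBINT x. \<bar>f (x + h) - g (x + h)\<bar>) = (LBINT x. \<bar>f x - g x\<bar>)"
      by (rule integral_lborel_translate[of "\<lambda>x. \<bar>f x - g x\<bar>"]) measurable
    finally have "(LBINT x. \<bar>f (x + h) - f x\<bar>) < e" using d elim by simp
    then show ?case by simp
  qed
qed

lemma translation_continuous_open:
  fixes U :: "'a::euclidean_space set"
  assumes U: "open U" "emeasure lborel U < \<infinity>"
  shows "translation_continuous (indicator U)"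
  unfolding translation_continuous_def tendsto_at_iff_sequentially comp_def
proof (intro allI impI)
  fix X :: "nat \<Rightarrow> 'a" assume X: "X \<longlonglongrightarrow> 0"
  have [measurable]: "U \<in> sets borel" using U by simp
  have iU: "integrable lborel (indicator U :: 'a \<Rightarrow> real)" using U by (simp add: integrable_indicator_iff)
  \<comment> \<open>Only the part where the indicator drops has to be controlled: it is dominated by
    the indicator of \<open>U\<close>, and since the two indicators have equal integrals its double
    is the whole L^1 distance.\<close>
  have "(\<lambda>j. LBINT x. 2 * max 0 (indicator U x - indicator U (x + X j))) \<longlonglongrightarrow> (0::real)"
  proof (rule integral_dominated_convergence[where w = "\<lambda>x. 2 * indicator U x" and f = "\<lambda>_. 0::real", simplified Bochner_Integration.integral_zero])
    show "AE x in lborel. (\<lambda>j. 2 * max 0 (indicator U x - indicator U (x + X j))) \<longlonglongrightarrow> (0::real)"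
    proof (rule AE_I2)
      fix x
      show "(\<lambda>j. 2 * max 0 (indicator U x - indicator U (x + X j))) \<longlonglongrightarrow> (0::real)"
      proof (cases "x \<in> U")
        case True
        have "(\<lambda>j. x + X j) \<longlonglongrightarrow> x + 0" by (intro tendsto_intros X)
        then have "\<forall>\<^sub>F j in sequentially. x + X j \<in> U"
          using U(1) True by (simp add: topological_tendstoD)
        then have "\<forall>\<^sub>F j in sequentially. 2 * max 0 (indicator U x - indicator U (x + X j)) = (0::real)"
          by eventually_elim (simp add: True)
        then show ?thesis by (rule tendsto_eventually)
      qed simp
    qed
  qed (use iU in \<open>auto split: split_indicator\<close>)
  moreover have "(LBINT x. \<bar>indicator U (x + h) - indicator U x\<bar>)
      = (\<integral>x. 2 * max 0 (indicator U x - indicator U (x + h)) \<partial>lborel :: real)" for h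
  proof -
    have ih: "integrable lborel (\<lambda>x. indicator U (x + h) :: real)"
      by (rule integrable_lborel_translate[OF iU])
    have "(LBINT x. \<bar>indicator U (x + h) - indicator U x\<bar>) =
        (\<integral>x. (indicator U (x + h) - indicator U x) + 2 * max 0 (indicator U x - indicator U (x + h)) \<partial>lborel :: real)"
      by (intro Bochner_Integration.integral_cong) (auto simp: indicator_def)
    also have "\<dots> = (LBINT x. indicator U (x + h)) - (LBINT x. indicator U x)
        + (LBINT x. 2 * max 0 (indicator U x - indicator U (x + h)))"
      by (subst Bochner_Integration.integral_add Bochner_Integration.integral_diff; (intro Bochner_Integration.integrable_diff integrable_max integrable_mult_right integrable_zero iU ih)?)+ (rule refl)
    also have "(LBINT x. indicator U (x + h)) = (\<integral>x. indicator U x \<partial>lborel :: real)"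
      by (rule integral_lborel_translate) simp
    finally show ?thesis by simp
  qed
  ultimately show "(\<lambda>j. LBINT x. \<bar>indicator U (x + X j) - indicator U x\<bar>) \<longlonglongrightarrow> (0::real)" by simp
qed

lemma translation_continuous_integrable:
  fixes f :: "'a::euclidean_space \<Rightarrow> real"
  assumes "integrable lborel f"
  shows "translation_continuous f"
  using assms
proof (induction rule: integrable_induct)
  case (base A c)
  have iA: "integrable lborel (indicator A :: 'a \<Rightarrow> real)"
    using base by (simp add: integrable_indicator_iff)
  have "translation_continuous (indicator A :: 'a \<Rightarrow> real)"
  proof (rule translation_continuous_approx[OF iA])
    fix e :: real assume e: "e > 0"
    \<comment> \<open>Outer regularity reduces a Borel set of finite measure to an open one.\<close>
    obtain U where U: "open U" "A \<subseteq> U" "emeasure lborel (U - A) < ennreal e"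
      using outer_regular_lborel[of A e] base(1) e by auto
    have [measurable]: "U \<in> sets borel" "A \<in> sets borel" using U base by auto
    have "emeasure lborel U = emeasure lborel (U - A) + emeasure lborel A"
      using U(2) by (subst plus_emeasure) (auto intro!: arg_cong[where f = "emeasure lborel"])
    also have "\<dots> < \<infinity>" using base(2) U(3) by (auto simp: less_top intro: order.strict_trans)
    finally have fin: "emeasure lborel U < \<infinity>" .
    have "(LBINT x. \<bar>indicator A x - indicator U x\<bar>) = (\<integral>x. indicator (U - A) x \<partial>lborel :: real)"
      using U(2) by (intro Bochner_Integration.integral_cong) (auto simp: indicator_def)
    also have "\<dots> = measure lborel (U - A)" by simp
    also have "\<dots> < e"
    proof -
      have "emeasure lborel (U - A) = ennreal (measure lborel (U - A))"
        using U(3) by (intro emeasure_eq_ennreal_measure) auto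
      then show ?thesis using U(3) by (simp add: ennreal_less_iff)
    qed
    finally show "\<exists>g. integrable lborel g \<and> translation_continuous g \<and> (LBINT x. \<bar>indicator A x - g x\<bar>) < e"
      using translation_continuous_open[OF U(1) fin] U(1) fin
      by (intro exI[of _ "indicator U"]) (auto simp: integrable_indicator_iff)
  qed
  then have "((\<lambda>h. (LBINT x. \<bar>indicator A (x + h) - indicator A x\<bar>) * \<bar>c\<bar>) \<longlongrightarrow> 0 * \<bar>c\<bar>) (at 0)"
    unfolding translation_continuous_def by (intro tendsto_intros)
  then show ?case
    unfolding translation_continuous_def
    by (simp flip: integral_mult_left_zero abs_mult left_diff_distrib)
next
  case (add f g)
  have "((\<lambda>h. (LBINT x. \<bar>f (x + h) - f x\<bar>) + (LBINT x. \<bar>g (x + h) - g x\<bar>)) \<longlongrightarrow> 0 + 0) (at 0)"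
    using add unfolding translation_continuous_def by (intro tendsto_intros)
  then have lim: "((\<lambda>h. (LBINT x. \<bar>f (x + h) - f x\<bar>) + (LBINT x. \<bar>g (x + h) - g x\<bar>)) \<longlongrightarrow> 0) (at 0)"
    by simp
  show ?case unfolding translation_continuous_def
  proof (rule Lim_null_comparison[OF _ lim], unfold real_norm_def)
    show "\<forall>\<^sub>F h in at 0. \<bar>\<integral>x. \<bar>f (x + h) + g (x + h) - (f x + g x)\<bar> \<partial>lborel\<bar>
        \<le> (LBINT x. \<bar>f (x + h) - f x\<bar>) + (LBINT x. \<bar>g (x + h) - g x\<bar>)"
    proof (rule always_eventually, rule allI)
      fix h
      note int = add.hyps integrable_lborel_translate[OF add.hyps(1), of h] integrable_lborel_translate[OF add.hyps(2), of h]
      have "(LBINT x. \<bar>f (x + h) + g (x + h) - (f x + g x)\<bar>) \<le> (LBINT x. \<bar>f (x + h) - f x\<bar> + \<bar>g (x + h) - g x\<bar>)"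
        by (intro integral_mono integrable_abs Bochner_Integration.integrable_add Bochner_Integration.integrable_diff int) auto
      also have "\<dots> = (LBINT x. \<bar>f (x + h) - f x\<bar>) + (LBINT x. \<bar>g (x + h) - g x\<bar>)"
        using int by simp
      finally show "\<bar>\<integral>x. \<bar>f (x + h) + g (x + h) - (f x + g x)\<bar> \<partial>lborel\<bar>
        \<le> (LBINT x. \<bar>f (x + h) - f x\<bar>) + (LBINT x. \<bar>g (x + h) - g x\<bar>)" by simp
    qed
  qed
next
  case (lim f s)
  show ?case
  proof (rule translation_continuous_approx[OF lim.hyps(4)])
    fix e :: real assume e: "e > 0"
    \<comment> \<open>The approximants of \<open>integrable_induct\<close> satisfy |s i| <= 2 |f|,
      hence the dominating function 3 |f|.\<close>
    have "(\<lambda>i. LBINT x. \<bar>f x - s i x\<bar>) \<longlonglongrightarrow> (\<integral>x. 0 \<partial>(lborel :: 'a measure))"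
    proof (rule integral_dominated_convergence[where w = "\<lambda>x. 3 * \<bar>f x\<bar>"])
      show "AE x in lborel. (\<lambda>i. \<bar>f x - s i x\<bar>) \<longlonglongrightarrow> 0"
      proof (rule AE_I2)
        fix x
        have "(\<lambda>i. \<bar>f x - s i x\<bar>) \<longlonglongrightarrow> \<bar>f x - f x\<bar>"
          by (intro tendsto_intros lim.hyps(2)) simp
        then show "(\<lambda>i. \<bar>f x - s i x\<bar>) \<longlonglongrightarrow> 0" by simp
      qed
      show "AE x in lborel. norm \<bar>f x - s i x\<bar> \<le> 3 * \<bar>f x\<bar>" for i
      proof (rule AE_I2)
        fix x
        have "norm (s i x) \<le> 2 * norm (f x)" by (rule lim.hyps(3)) simp
        then show "norm \<bar>f x - s i x\<bar> \<le> 3 * \<bar>f x\<bar>" unfolding real_norm_def by linarith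
      qed
      show "(\<lambda>x. \<bar>f x - s i x\<bar>) \<in> borel_measurable lborel" for i
        by (intro borel_measurable_abs borel_measurable_diff borel_measurable_integrable lim.hyps)
    qed (use lim.hyps(4) in auto)
    then have "\<forall>\<^sub>F i in sequentially. (LBINT x. \<bar>f x - s i x\<bar>) < e"
      using e by (intro order_tendstoD) auto
    then obtain i where i: "(LBINT x. \<bar>f x - s i x\<bar>) < e"
      using eventually_happens'[OF sequentially_bot] by blast
    show "\<exists>g. integrable lborel g \<and> translation_continuous g \<and> (LBINT x. \<bar>f x - g x\<bar>) < e"
      by (intro exI[of _ "s i"] conjI lim.hyps lim.IH i)
  qed
qed

text \<open>The nonnegative integral is used because this bound is later integrated over the points
  of a segment by Tonelli's theorem.\<close>

lemma loc_int_translation_continuous: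
  fixes g :: "'a::euclidean_space \<Rightarrow> real"
  assumes g: "loc_int g" and e: "e > 0"
  obtains d where "d > 0" "\<And>h. norm h < d \<Longrightarrow>
    (\<integral>\<^sup>+x. ennreal (indicator (cball 0 R) x * \<bar>g (x + h) - g x\<bar>) \<partial>lborel) < ennreal e"
proof -
  \<comment> \<open>The additional radius 1 keeps x + h inside the cut-off ball when norm x <= R and
    norm h < 1.\<close>
  define f where "f x = indicator (cball 0 (R + 1)) x * g x" for x
  have f: "integrable lborel f" unfolding f_def using g by (simp add: loc_int_def)
  have "\<forall>\<^sub>F h in at 0. dist (LBINT x. \<bar>f (x + h) - f x\<bar>) 0 < e"
    using translation_continuous_integrable[OF f] e unfolding translation_continuous_def tendsto_iff by blast
  then obtain d where d: "d > 0" "\<And>h. h \<noteq> 0 \<Longrightarrow> norm h < d \<Longrightarrow> (LBINT x. \<bar>f (x + h) - f x\<bar>) < e"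
    by (auto simp: eventually_at dist_norm)
  show thesis
  proof
    show "min d 1 > 0" using d by simp
  next
    fix h :: 'a assume h: "norm h < min d 1"
    show "(\<integral>\<^sup>+x. ennreal (indicator (cball 0 R) x * \<bar>g (x + h) - g x\<bar>) \<partial>lborel) < ennreal e"
    proof (cases "h = 0")
      case True
      then show ?thesis using e by simp
    next
      case False
      have "(\<integral>\<^sup>+x. ennreal (indicator (cball 0 R) x * \<bar>g (x + h) - g x\<bar>) \<partial>lborel)
         \<le> (\<integral>\<^sup>+x. ennreal \<bar>f (x + h) - f x\<bar> \<partial>lborel)"
      proof (intro nn_integral_mono ennreal_leI)
        fix x
        show "indicator (cball 0 R) x * \<bar>g (x + h) - g x\<bar> \<le> \<bar>f (x + h) - f x\<bar>"
          using h norm_triangle_ineq[of x h] by (auto simp: f_def indicator_def)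
      qed
      also have "\<dots> = ennreal (LBINT x. \<bar>f (x + h) - f x\<bar>)"
        using f integrable_lborel_translate[OF f, of h] by (intro nn_integral_eq_integral) auto
      also have "\<dots> < ennreal e"
        using d(2)[OF False] h e by (intro ennreal_lessI) auto
      finally show ?thesis .
    qed
  qed
qed

lemma loc_int_mult_bounded:
  fixes f k :: "'a::euclidean_space \<Rightarrow> real"
  assumes f: "loc_int f" and k[measurable]: "k \<in> borel_measurable borel" and bd: "\<And>x. \<bar>k x\<bar> \<le> c"
  shows "loc_int (\<lambda>x. k x * f x)"
  unfolding loc_int_def
proof (intro conjI allI)
  have [measurable]: "f \<in> borel_measurable borel" by (rule loc_int_measurable[OF f])
  show "(\<lambda>x. k x * f x) \<in> borel_measurable borel" by measurable
  fix R
  have c: "0 \<le> c" using bd[of 0] by linarith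
  have "integrable lborel (\<lambda>x. f x * (indicator (cball 0 R) x * k x))"
    by (rule loc_int_mult_integrable[OF f, where c = c and R = R])
       (use k bd c in \<open>auto simp: indicator_def\<close>)
  then show "integrable lborel (\<lambda>x. indicator (cball 0 R) x * (k x * f x))"
    by (simp only: mult_ac)
qed

lemma loc_int_translation_tendsto:
  fixes u :: "'a::euclidean_space \<Rightarrow> real"
  assumes u: "loc_int u" and h: "h \<longlonglongrightarrow> 0"
  shows "(\<lambda>j. LBINT x. indicator (cball 0 R) x * \<bar>u (x + h j) - u x\<bar>) \<longlonglongrightarrow> 0"
  unfolding tendsto_iff
proof (intro allI impI)
  fix e :: real assume e: "e > 0"
  have [measurable]: "u \<in> borel_measurable borel" by (rule loc_int_measurable[OF u])
  let ?F = "\<lambda>j x. indicator (cball 0 R) x * \<bar>u (x + h j) - u x\<bar>"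
  obtain d where d: "d > 0" "\<And>h. norm h < d \<Longrightarrow>
      (\<integral>\<^sup>+x. ennreal (indicator (cball 0 R) x * \<bar>u (x + h) - u x\<bar>) \<partial>lborel) < ennreal e"
    using loc_int_translation_continuous[OF u e, of R] by blast
  have "\<forall>\<^sub>F j in sequentially. dist (h j) 0 < d" using h d(1) by (simp add: tendsto_iff)
  then show "\<forall>\<^sub>F j in sequentially. dist (LBINT x. ?F j x) 0 < e"
  proof eventually_elim
    case (elim j)
    have lt: "(\<integral>\<^sup>+x. ennreal (?F j x) \<partial>lborel) < ennreal e" by (rule d(2)) (use elim in simp)
    have "(LBINT x. ?F j x) = enn2real (\<integral>\<^sup>+x. ennreal (?F j x) \<partial>lborel)"
    proof (rule integral_eq_nn_integral)
      show "?F j \<in> borel_measurable lborel" by measurable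
    qed simp
    also have "\<dots> < e" using lt e by (cases "\<integral>\<^sup>+x. ennreal (?F j x) \<partial>lborel" rule: ennreal_cases) (simp_all add: ennreal_less_iff)
    finally show ?case by (simp add: Bochner_Integration.integral_nonneg)
  qed
qed

section \<open>Weak derivatives as limits of difference quotients\<close>

lemma nn_integral_lborel_translate:
  fixes f :: "'a::euclidean_space \<Rightarrow> ennreal"
  assumes "f \<in> borel_measurable borel"
  shows "(\<integral>\<^sup>+x. f (x + c) \<partial>lborel) = (\<integral>\<^sup>+x. f x \<partial>lborel)"
  by (subst (2) lborel_distr_translate[of c, symmetric], subst nn_integral_distr) (use assms in auto)

lemma loc_int_add: "loc_int f \<Longrightarrow> loc_int g \<Longrightarrow> loc_int (\<lambda>x. f x + g x)"
  by (auto simp: loc_int_def distrib_left)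

lemma loc_int_diff: "loc_int f \<Longrightarrow> loc_int g \<Longrightarrow> loc_int (\<lambda>x. f x - g x)"
  by (auto simp: loc_int_def right_diff_distrib)

lemma loc_int_cmult: "loc_int f \<Longrightarrow> loc_int (\<lambda>x. c * f x)"
  by (auto simp: loc_int_def mult.left_commute)

lemma loc_int_translate:
  fixes f :: "'a::euclidean_space \<Rightarrow> real"
  assumes f: "loc_int f" shows "loc_int (\<lambda>x. f (x + h))"
  unfolding loc_int_def
proof (intro conjI allI)
  have [measurable]: "f \<in> borel_measurable borel" by (rule loc_int_measurable[OF f])
  show "(\<lambda>x. f (x + h)) \<in> borel_measurable borel" by measurable
  fix R
  have "integrable lborel (\<lambda>x. f x * indicator (cball h R) x)"
    by (intro loc_int_indicator_integrable f) auto
  then have "integrable lborel (\<lambda>x. f (x + h) * indicator (cball h R) (x + h))"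
    by (rule integrable_lborel_translate)
  then show "integrable lborel (\<lambda>x. indicator (cball 0 R) x * f (x + h))"
    by (rule Bochner_Integration.integrable_cong[THEN iffD1, rotated 2])
       (auto simp: indicator_def dist_norm mult.commute)
qed

text \<open>Tonelli with x innermost: for fixed s, translation invariance removes the shift s v and
  the bound no longer depends on s. This justifies the exchanges of integrals along
  segments.\<close>

lemma integrable_segment_product:
  fixes g h :: "'a::euclidean_space \<Rightarrow> real"
  assumes g: "loc_int g" and [measurable]: "h \<in> borel_measurable borel"
    and h: "\<And>x. \<bar>h x\<bar> \<le> c" "\<And>x. norm x > R \<Longrightarrow> h x = 0"
  shows "integrable (lborel \<Otimes>\<^sub>M lborel) (\<lambda>(x, s). h x * (indicator {0..1} s * g (x + s *\<^sub>R v)))"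
proof (rule integrableI_bounded)
  have [measurable]: "g \<in> borel_measurable borel" by (rule loc_int_measurable[OF g])
  show "(\<lambda>(x, s). h x * (indicator {0..1} s * g (x + s *\<^sub>R v))) \<in> borel_measurable (lborel \<Otimes>\<^sub>M lborel)"
    by measurable
  \<comment> \<open>For norm x <= R and s in [0, 1] the point x + s v stays in the ball of radius R
    + norm v.\<close>
  define g1 where "g1 x = indicator (cball 0 (R + norm v)) x * g x" for x
  have [measurable]: "g1 \<in> borel_measurable borel" unfolding g1_def by measurable
  have c: "0 \<le> c" using h(1)[of 0] by linarith
  have le: "norm (h x * (indicator {0..1} s * g (x + s *\<^sub>R v))) \<le> indicator {0..1} s * (c * \<bar>g1 (x + s *\<^sub>R v)\<bar>)" for x s
  proof (cases "s \<in> {0..1} \<and> norm x \<le> R")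
    case True
    then have "norm (s *\<^sub>R v) \<le> norm v" by (auto simp: mult_left_le_one_le)
    then have "norm (x + s *\<^sub>R v) \<le> R + norm v" using True norm_triangle_ineq[of x "s *\<^sub>R v"] by linarith
    then show ?thesis
      using True mult_right_mono[OF h(1)[of x], of "\<bar>g (x + s *\<^sub>R v)\<bar>"] by (auto simp: g1_def abs_mult)
  next
    case False
    then show ?thesis using h(2)[of x] c by (auto simp: indicator_def not_le)
  qed
  have "(\<integral>\<^sup>+ z. ennreal (norm (case z of (x, s) \<Rightarrow> h x * (indicator {0..1} s * g (x + s *\<^sub>R v)))) \<partial>(lborel \<Otimes>\<^sub>M lborel))
      = (\<integral>\<^sup>+ s. \<integral>\<^sup>+ x. ennreal (norm (h x * (indicator {0..1} s * g (x + s *\<^sub>R v)))) \<partial>lborel \<partial>lborel)"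
  proof -
    have "(\<lambda>(x, s). ennreal (norm (h x * (indicator {0..1} s * g (x + s *\<^sub>R v))))) \<in> borel_measurable (lborel \<Otimes>\<^sub>M lborel)"
      by measurable
    from lborel_pair.nn_integral_snd[OF this] show ?thesis by (simp add: split_beta')
  qed
  also have "\<dots> \<le> (\<integral>\<^sup>+ s. \<integral>\<^sup>+ x. ennreal (indicator {0..1} s * (c * \<bar>g1 (x + s *\<^sub>R v)\<bar>)) \<partial>lborel \<partial>lborel)"
    by (intro nn_integral_mono ennreal_leI le)
  also have "\<dots> = (\<integral>\<^sup>+ s. indicator {0..1::real} s * (\<integral>\<^sup>+ x. ennreal (c * \<bar>g1 x\<bar>) \<partial>lborel) \<partial>lborel)"
  proof (intro nn_integral_cong)
    fix s :: real
    have "(\<integral>\<^sup>+ x. ennreal (indicator {0..1} s * (c * \<bar>g1 (x + s *\<^sub>R v)\<bar>)) \<partial>lborel)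
      = (\<integral>\<^sup>+ x. indicator {0..1} s * ennreal (c * \<bar>g1 (x + s *\<^sub>R v)\<bar>) \<partial>lborel)"
      by (intro nn_integral_cong) (auto simp: indicator_def)
    also have "\<dots> = indicator {0..1} s * (\<integral>\<^sup>+ x. ennreal (c * \<bar>g1 (x + s *\<^sub>R v)\<bar>) \<partial>lborel)"
      by (rule nn_integral_cmult) measurable
    also have "(\<integral>\<^sup>+ x. ennreal (c * \<bar>g1 (x + s *\<^sub>R v)\<bar>) \<partial>lborel) = (\<integral>\<^sup>+ x. ennreal (c * \<bar>g1 x\<bar>) \<partial>lborel)"
      by (rule nn_integral_lborel_translate[of "\<lambda>x. ennreal (c * \<bar>g1 x\<bar>)"]) measurable
    finally show "(\<integral>\<^sup>+ x. ennreal (indicator {0..1} s * (c * \<bar>g1 (x + s *\<^sub>R v)\<bar>)) \<partial>lborel)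
      = indicator {0..1} s * (\<integral>\<^sup>+ x. ennreal (c * \<bar>g1 x\<bar>) \<partial>lborel)" .
  qed
  also have "\<dots> = (\<integral>\<^sup>+ x. ennreal (c * \<bar>g1 x\<bar>) \<partial>lborel)"
    by (subst nn_integral_multc) (auto simp: nn_integral_indicator)
  also have "\<dots> < \<infinity>"
  proof -
    have "integrable lborel (\<lambda>x. c * \<bar>g1 x\<bar>)"
      using g by (intro integrable_mult_right integrable_abs) (auto simp: g1_def loc_int_def)
    then have "(\<integral>\<^sup>+ x. ennreal (norm (c * \<bar>g1 x\<bar>)) \<partial>lborel) < \<infinity>" by (simp only: integrable_iff_bounded)
    then show ?thesis using c by (simp add: abs_mult)
  qed
  finally show "(\<integral>\<^sup>+ z. ennreal (norm (case z of (x, s) \<Rightarrow> h x * (indicator {0..1} s * g (x + s *\<^sub>R v)))) \<partial>(lborel \<Otimes>\<^sub>M lborel)) < \<infinity>" .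
qed

lemma loc_int_segment_average:
  assumes g: "loc_int g"
  shows "loc_int (\<lambda>x. LBINT s. indicator {0..1} s * g (x + s *\<^sub>R v))"
  unfolding loc_int_def
proof (intro conjI allI)
  have [measurable]: "g \<in> borel_measurable borel" by (rule loc_int_measurable[OF g])
  show "(\<lambda>x. LBINT s. indicator {0..1} s * g (x + s *\<^sub>R v)) \<in> borel_measurable borel"
    by measurable
  fix R
  have "integrable (lborel \<Otimes>\<^sub>M lborel) (\<lambda>(x, s). indicator (cball 0 R) x * (indicator {0..1} s * g (x + s *\<^sub>R v)))"
    by (rule integrable_segment_product[OF g, where c = 1 and R = R]) (auto simp: indicator_def)
  then have "integrable lborel (\<lambda>x. LBINT s. indicator (cball 0 R) x * (indicator {0..1} s * g (x + s *\<^sub>R v)))"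
    by (rule lborel_pair.integrable_fst)
  then show "integrable lborel (\<lambda>x. indicator (cball 0 R) x * (LBINT s. indicator {0..1} s * g (x + s *\<^sub>R v)))"
    by simp
qed

lemma AE_segment_integrable:
  fixes g :: "'a::euclidean_space \<Rightarrow> real"
  assumes g: "loc_int g"
  shows "AE x in lborel. integrable lborel (\<lambda>s. indicator {0..1} s * g (x + s *\<^sub>R v))"
proof -
  have "AE x in lborel. x \<in> cball 0 (real n) \<longrightarrow> integrable lborel (\<lambda>s. indicator {0..1} s * g (x + s *\<^sub>R v))" for n
  proof -
    have "integrable (lborel \<Otimes>\<^sub>M lborel) (\<lambda>(x, s). indicator (cball 0 (real n)) x * (indicator {0..1} s * g (x + s *\<^sub>R v)))"
      by (rule integrable_segment_product[OF g, where c = 1 and R = n]) (auto simp: indicator_def)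
    then have "AE x in lborel. integrable lborel (\<lambda>s. indicator (cball 0 (real n)) x * (indicator {0..1} s * g (x + s *\<^sub>R v)))"
      by (rule lborel_pair.AE_integrable_fst)
    then show ?thesis by eventually_elim auto
  qed
  then have "AE x in lborel. \<forall>n::nat. x \<in> cball 0 (real n) \<longrightarrow> integrable lborel (\<lambda>s. indicator {0..1} s * g (x + s *\<^sub>R v))"
    unfolding AE_all_countable by blast
  then show ?thesis
    by eventually_elim (metis mem_cball_0 real_arch_simple)
qed

text \<open>One direction at a time, since every argument below takes place on lines parallel to b;
  the calculus is done on \<open>lborel\<close> and tied to \<open>has_weak_gradient\<close> by
  \<open>has_weak_gradient_iff_partials\<close>.\<close>

definition has_weak_partial :: "('a::euclidean_space \<Rightarrow> real) \<Rightarrow> ('a \<Rightarrow> real) \<Rightarrow> 'a \<Rightarrow> bool" where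
  "has_weak_partial u g b \<longleftrightarrow> loc_int u \<and> loc_int g \<and>
     (\<forall>\<psi>\<in>Cc_infinity. (LBINT x. u x * frechet_derivative \<psi> (at x) b) = - (LBINT x. g x * \<psi> x))"

lemma has_derivative_line:
  fixes \<psi> :: "'a::real_normed_vector \<Rightarrow> real"
  assumes "\<And>x. \<psi> differentiable at x"
  shows "((\<lambda>s. \<psi> (x + s *\<^sub>R v)) has_real_derivative frechet_derivative \<psi> (at (x + s *\<^sub>R v)) v) (at s)"
proof -
  let ?D = "frechet_derivative \<psi> (at (x + s *\<^sub>R v))"
  have D: "(\<psi> has_derivative ?D) (at (x + s *\<^sub>R v))"
    using assms frechet_derivative_works by blast
  have "((\<lambda>s. \<psi> (x + s *\<^sub>R v)) has_derivative (\<lambda>h. ?D (h *\<^sub>R v))) (at s)"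
    by (rule has_derivative_compose[where f = "\<lambda>s. x + s *\<^sub>R v" and f' = "\<lambda>h. h *\<^sub>R v" and g = \<psi> and g' = ?D])
       (auto intro!: derivative_eq_intros D)
  moreover have "?D (h *\<^sub>R v) = ?D v * h" for h
    using linear_cmul[OF has_derivative_linear[OF D]] by simp
  ultimately show ?thesis by (simp add: has_field_derivative_def)
qed

text \<open>The fundamental theorem of calculus in weak form. Tested against \<psi>, the shift moves
  from u to \<psi>; the classical theorem for \<psi> along the segment, the definition of the weak
  derivative for translated test functions, and two exchanges of integrals bring the derivative onto
  u. The fundamental lemma removes \<psi>.\<close>

lemma weak_partial_difference:
  fixes u g :: "'a::euclidean_space \<Rightarrow> real"
  assumes ug: "has_weak_partial u g b" and b: "b \<in> Basis"
  shows "AE x in lborel. u (x + t *\<^sub>R b) - u x = t * (LBINT s. indicator {0..1} s * g (x + s *\<^sub>R t *\<^sub>R b))"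
proof -
  have u: "loc_int u" and g: "loc_int g" using ug by (auto simp: has_weak_partial_def)
  have [measurable]: "u \<in> borel_measurable borel" "g \<in> borel_measurable borel"
    by (auto intro: loc_int_measurable u g)
  let ?G = "\<lambda>x. \<integral>s. indicator {0..1} s * g (x + s *\<^sub>R t *\<^sub>R b) \<partial>lborel"
  let ?f = "\<lambda>x. u (x + t *\<^sub>R b) - u x - t * ?G x"
  have f: "loc_int ?f"
    by (intro loc_int_diff loc_int_cmult loc_int_segment_average loc_int_translate u g)
  have "AE x in lborel. ?f x = 0"
  proof (rule fundamental_lemma_variations[OF f])
    fix \<psi> :: "'a \<Rightarrow> real" assume \<psi>: "\<psi> \<in> Cc_infinity"
    define D where "D x = frechet_derivative \<psi> (at x) b" for x
    obtain c R where cR: "\<And>x. \<bar>\<psi> x\<bar> \<le> c" "\<And>x. \<bar>D x\<bar> \<le> c" "\<And>x. norm x > R \<Longrightarrow> \<psi> x = 0" "\<And>x. norm x > R \<Longrightarrow> D x = 0"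
      using Cc_infinity_bounds[OF \<psi> b] unfolding D_def by blast
    have cont: "continuous_on UNIV \<psi>" "continuous_on UNIV D"
      unfolding D_def by (intro Cc_infinity_continuous \<psi> b)+
    have [measurable]: "\<psi> \<in> borel_measurable borel" "D \<in> borel_measurable borel"
      by (intro borel_measurable_continuous_onI cont)+
    \<comment> \<open>A translate of a test function is a test function, so the weak derivative may
      be used at every point of the segment.\<close>
    have weak: "(LBINT x. u x * D (x + y)) = - (LBINT x. g (x - y) * \<psi> x)" for y
    proof -
      have "(LBINT x. u x * D (x + y)) = - (LBINT x. g x * \<psi> (x + y))"
        using ug Cc_infinity_translate[OF \<psi>, of y] Cc_infinity_continuous(2)[OF \<psi>]
        unfolding has_weak_partial_def D_def by (auto simp: frechet_derivative_translate dest!: bspec)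
      also have "(LBINT x. g x * \<psi> (x + y)) = (LBINT x. g (x - y) * \<psi> x)"
        using integral_lborel_translate[of "\<lambda>x. g (x - y) * \<psi> x" y] by simp
      finally show ?thesis .
    qed
    have ftc: "\<psi> (x - t *\<^sub>R b) - \<psi> x = (LBINT s. indicator {0..1} s * (- t * D (x - s *\<^sub>R t *\<^sub>R b)))" for x
    proof -
      have "((\<lambda>s. \<psi> (x + s *\<^sub>R (- t *\<^sub>R b))) has_real_derivative (- t * D (x - s *\<^sub>R t *\<^sub>R b))) (at s)" for s
      proof -
        have "frechet_derivative \<psi> (at y) (- t *\<^sub>R b) = - t * D y" for y
          using linear_cmul[OF linear_frechet_derivative[OF Cc_infinity_continuous(2)[OF \<psi>]], of y "- t" b]
          by (simp add: D_def)
        then show ?thesis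
          using has_derivative_line[OF Cc_infinity_continuous(2)[OF \<psi>], of x "- t *\<^sub>R b" s] by simp
      qed
      moreover have "isCont (\<lambda>s. - t * D (x - s *\<^sub>R t *\<^sub>R b)) s" for s
      proof -
        have "continuous_on UNIV (\<lambda>s. - t * D (x - s *\<^sub>R t *\<^sub>R b))"
          by (intro continuous_intros continuous_on_compose2[OF cont(2)]) auto
        then show ?thesis by (simp only: continuous_on_eq_continuous_at[OF open_UNIV]) blast
      qed
      ultimately have "(LBINT s. - t * D (x - s *\<^sub>R t *\<^sub>R b) * indicator {0..1} s)
          = \<psi> (x + 1 *\<^sub>R (- t *\<^sub>R b)) - \<psi> (x + 0 *\<^sub>R (- t *\<^sub>R b))"
        by (intro integral_FTC_Icc_real) auto
      then show ?thesis by (simp add: mult.commute)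
    qed
    have int\<psi>: "integrable lborel (\<lambda>x. k x * \<psi> x)" if "loc_int k" for k
      by (rule loc_int_test_integrable[OF that \<psi>])
    \<comment> \<open>Joint integrability for the first exchange. As b is a unit vector, the segment
      has length |t|, so x ranges over the ball of radius R + |t|.\<close>
    have uDi: "integrable (lborel \<Otimes>\<^sub>M lborel) (\<lambda>(x, s). u x * (indicator {0..1} s * (- t * D (x - s *\<^sub>R t *\<^sub>R b))))"
    proof (rule Bochner_Integration.integrable_bound)
      let ?B = "cball 0 (R + \<bar>t\<bar>) :: 'a set"
      show "integrable (lborel \<Otimes>\<^sub>M lborel) (\<lambda>(x, s::real). (indicator ?B x * u x) * (indicator {0..1} s * (\<bar>t\<bar> * c)))"
      proof (rule lborel_pair.Fubini_integrable)
        have *: "integrable lborel (\<lambda>x. indicator ?B x * u x)" using u by (simp add: loc_int_def)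
        have [simp]: "integrable lborel (indicator {0..1::real} :: real \<Rightarrow> real)"
          by (simp add: integrable_indicator_iff)
        show "integrable lborel (\<lambda>x. LINT y|lborel. norm (case (x, y) of (x, s::real) \<Rightarrow> (indicator ?B x * u x) * (indicator {0..1} s * (\<bar>t\<bar> * c))))"
          using integrable_abs[OF *] by (simp add: abs_mult)
        show "(\<lambda>(x, s::real). (indicator ?B x * u x) * (indicator {0..1} s * (\<bar>t\<bar> * c))) \<in> borel_measurable (lborel \<Otimes>\<^sub>M lborel)"
          by measurable
        show "AE x in lborel. integrable lborel (\<lambda>y. case (x, y) of (x, s::real) \<Rightarrow> (indicator ?B x * u x) * (indicator {0..1} s * (\<bar>t\<bar> * c)))"
          unfolding prod.case by (intro AE_I2 integrable_mult_right integrable_mult_left) simp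
      qed
      have "\<bar>u x * (indicator {0..1} s * (- t * D (x - s *\<^sub>R t *\<^sub>R b)))\<bar>
         \<le> \<bar>(indicator ?B x * u x) * (indicator {0..1} s * (\<bar>t\<bar> * c))\<bar>" for x s
      proof (cases "s \<in> {0..1} \<and> norm (x - s *\<^sub>R t *\<^sub>R b) \<le> R")
        case True
        then have "norm (s *\<^sub>R t *\<^sub>R b) \<le> \<bar>t\<bar>" using b by (auto simp: mult_left_le_one_le abs_mult)
        then have "norm x \<le> R + \<bar>t\<bar>"
          using True norm_triangle_ineq[of "x - s *\<^sub>R t *\<^sub>R b" "s *\<^sub>R t *\<^sub>R b"] by simp
        moreover have "\<bar>u x\<bar> * (\<bar>t\<bar> * \<bar>D (x - s *\<^sub>R t *\<^sub>R b)\<bar>) \<le> \<bar>u x\<bar> * (\<bar>t\<bar> * c)"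
          by (intro mult_left_mono cR) auto
        moreover have "0 \<le> c" using cR(1)[of 0] by linarith
        ultimately show ?thesis using True by (simp add: abs_mult)
      next
        case False
        then show ?thesis using cR(4)[of "x - s *\<^sub>R t *\<^sub>R b"] by (auto simp: indicator_def)
      qed
      then show "AE z in lborel \<Otimes>\<^sub>M lborel. norm (case z of (x, s) \<Rightarrow> u x * (indicator {0..1} s * (- t * D (x - s *\<^sub>R t *\<^sub>R b))))
         \<le> norm (case z of (x, s::real) \<Rightarrow> (indicator ?B x * u x) * (indicator {0..1} s * (\<bar>t\<bar> * c)))"
        by (intro AE_I2) (simp add: split_beta)
    qed measurable
    have "(LBINT x. (u (x + t *\<^sub>R b) - u x) * \<psi> x)
        = (LBINT x. u (x + t *\<^sub>R b) * \<psi> x) - (LBINT x. u x * \<psi> x)"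
      by (simp add: left_diff_distrib int\<psi> u loc_int_translate)
    also have "(LBINT x. u (x + t *\<^sub>R b) * \<psi> x) = (LBINT x. u x * \<psi> (x - t *\<^sub>R b))"
      using integral_lborel_translate[of "\<lambda>x. u (x + t *\<^sub>R b) * \<psi> x" "- t *\<^sub>R b"] by simp
    also have "\<dots> - (LBINT x. u x * \<psi> x) = (LBINT x. u x * (\<psi> (x - t *\<^sub>R b) - \<psi> x))"
      using loc_int_test_integrable[OF u Cc_infinity_translate[OF \<psi>, of "- t *\<^sub>R b"]] int\<psi>[OF u]
      by (simp add: right_diff_distrib)
    also have "\<dots> = (LBINT x. \<integral>s. u x * (indicator {0..1} s * (- t * D (x - s *\<^sub>R t *\<^sub>R b))) \<partial>lborel)"
      unfolding ftc by simp
    also have "\<dots> = (LBINT s. \<integral>x. u x * (indicator {0..1} s * (- t * D (x - s *\<^sub>R t *\<^sub>R b))) \<partial>lborel)"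
      by (rule lborel_pair.Fubini_integral[symmetric]) (rule uDi)
    also have "\<dots> = (LBINT s. \<integral>x. t * (\<psi> x * (indicator {0..1} s * g (x + s *\<^sub>R t *\<^sub>R b))) \<partial>lborel)"
    proof (rule Bochner_Integration.integral_cong[OF refl])
      fix s
      have "(LBINT x. u x * (indicator {0..1} s * (- t * D (x - s *\<^sub>R t *\<^sub>R b))))
        = (LBINT x. (indicator {0..1} s * - t) * (u x * D (x - s *\<^sub>R t *\<^sub>R b)))"
        by (intro Bochner_Integration.integral_cong) auto
      also have "\<dots> = (indicator {0..1} s * t) * (LBINT x. g (x + s *\<^sub>R t *\<^sub>R b) * \<psi> x)"
        using weak[of "- (s *\<^sub>R t *\<^sub>R b)"] by simp
      also have "\<dots> = (LBINT x. t * (\<psi> x * (indicator {0..1} s * g (x + s *\<^sub>R t *\<^sub>R b))))"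
        by (subst integral_mult_right_zero[symmetric], intro Bochner_Integration.integral_cong) auto
      finally show "(LBINT x. u x * (indicator {0..1} s * (- t * D (x - s *\<^sub>R t *\<^sub>R b))))
        = (LBINT x. t * (\<psi> x * (indicator {0..1} s * g (x + s *\<^sub>R t *\<^sub>R b))))"
        by simp
    qed
    also have "\<dots> = t * (LBINT s. \<integral>x. \<psi> x * (indicator {0..1} s * g (x + s *\<^sub>R t *\<^sub>R b)) \<partial>lborel)"
      by simp
    also have "\<dots> = t * (LBINT x. \<integral>s. \<psi> x * (indicator {0..1} s * g (x + s *\<^sub>R t *\<^sub>R b)) \<partial>lborel)"
      by (subst lborel_pair.Fubini_integral[OF integrable_segment_product[OF g]]) (use cR in auto)
    also have "\<dots> = (LBINT x. t * ?G x * \<psi> x)"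
      by (simp add: ac_simps)
    finally have *: "(LBINT x. (u (x + t *\<^sub>R b) - u x) * \<psi> x) = (LBINT x. t * ?G x * \<psi> x)" .
    have i1: "integrable lborel (\<lambda>x. (u (x + t *\<^sub>R b) - u x) * \<psi> x)"
      by (intro int\<psi> loc_int_diff loc_int_translate u)
    have i2: "integrable lborel (\<lambda>x. (t * ?G x) * \<psi> x)"
      by (intro int\<psi> loc_int_cmult loc_int_segment_average g)
    have "(LBINT x. ?f x * \<psi> x) =
        (LBINT x. (u (x + t *\<^sub>R b) - u x) * \<psi> x) - (LBINT x. t * ?G x * \<psi> x)"
      unfolding left_diff_distrib[of _ "t * ?G _"] by (rule Bochner_Integration.integral_diff[OF i1 i2])
    then show "(LBINT x. ?f x * \<psi> x) = 0"
      using * by simp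
  qed
  then show ?thesis by eventually_elim simp
qed

text \<open>The quotient is the average of g over the segment from x to x + t b, and averaging does
  not increase the L^1 distance to g beyond the worst translate, which is small by continuity of
  translations.\<close>

lemma difference_quotient_tendsto_L1:
  fixes u g :: "'a::euclidean_space \<Rightarrow> real"
  assumes ug: "has_weak_partial u g b" and b: "b \<in> Basis"
    and t: "t \<longlonglongrightarrow> 0" "\<And>j. t j \<noteq> 0"
  shows "(\<lambda>j. LBINT x. indicator (cball 0 R) x * \<bar>(u (x + t j *\<^sub>R b) - u x) / t j - g x\<bar>) \<longlonglongrightarrow> 0"
  unfolding tendsto_iff
proof (intro allI impI)
  fix e :: real assume e: "e > 0"
  have u: "loc_int u" and g: "loc_int g" using ug by (auto simp: has_weak_partial_def)
  have [measurable]: "u \<in> borel_measurable borel" "g \<in> borel_measurable borel"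
    by (auto intro: loc_int_measurable u g)
  \<comment> \<open>Half of e leaves room for a strict inequality, as averaging over the segment
    only gives a weak one.\<close>
  obtain d where d: "d > 0" "\<And>h. norm h < d \<Longrightarrow>
      (\<integral>\<^sup>+x. ennreal (indicator (cball 0 R) x * \<bar>g (x + h) - g x\<bar>) \<partial>lborel) < ennreal (e / 2)"
    using loc_int_translation_continuous[OF g, of "e / 2" R] e by auto
  have "\<forall>\<^sub>F j in sequentially. dist (t j) 0 < d" using t(1) d(1) by (simp add: tendsto_iff)
  then show "\<forall>\<^sub>F j in sequentially. dist (LBINT x. indicator (cball 0 R) x * \<bar>(u (x + t j *\<^sub>R b) - u x) / t j - g x\<bar>) 0 < e"
  proof eventually_elim
    case (elim j)
    let ?F = "\<lambda>x. indicator (cball 0 R) x * \<bar>(u (x + t j *\<^sub>R b) - u x) / t j - g x\<bar>"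
    \<comment> \<open>Since g x is its own average over [0, 1], the quotient minus g x is the
      integral of g(x + s t b) - g x over s.\<close>
    have F: "AE x in lborel. ennreal (?F x) \<le> (\<integral>\<^sup>+s. ennreal (indicator {0..1} s * (indicator (cball 0 R) x * \<bar>g (x + s *\<^sub>R t j *\<^sub>R b) - g x\<bar>)) \<partial>lborel)"
      using weak_partial_difference[OF ug b, of "t j"] AE_segment_integrable[OF g, of "t j *\<^sub>R b"]
    proof eventually_elim
      case (elim x)
      let ?k = "\<lambda>s. indicator {0..1} s * (g (x + s *\<^sub>R t j *\<^sub>R b) - g x)"
      have ind: "integrable lborel (\<lambda>s::real. indicator {0..1} s * g x)"
        by (simp add: integrable_indicator_iff)
      have "(u (x + t j *\<^sub>R b) - u x) / t j - g x = (LBINT s. ?k s)"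
        using t(2)[of j] ind elim by (simp add: right_diff_distrib)
      moreover have "ennreal \<bar>\<integral>s. ?k s \<partial>lborel\<bar> \<le> (\<integral>\<^sup>+s. ennreal (norm (?k s)) \<partial>lborel)"
        using integral_norm_bound_ennreal[of lborel ?k] ind elim by (simp add: right_diff_distrib)
      ultimately show ?case
        by (cases "x \<in> cball 0 R") (auto simp: abs_mult)
    qed
    have iF: "integrable lborel ?F"
    proof -
      have "loc_int (\<lambda>x. (1 / t j) * (u (x + t j *\<^sub>R b) - u x) - g x)"
        by (intro loc_int_diff loc_int_cmult loc_int_translate u g)
      then have "integrable lborel (\<lambda>x. \<bar>indicator (cball 0 R) x * ((1 / t j) * (u (x + t j *\<^sub>R b) - u x) - g x)\<bar>)"
        by (intro integrable_abs) (simp add: loc_int_def)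
      then show ?thesis by (simp add: abs_mult)
    qed
    have "(\<integral>\<^sup>+x. ennreal (?F x) \<partial>lborel) \<le>
      (\<integral>\<^sup>+x. \<integral>\<^sup>+s. ennreal (indicator {0..1} s * (indicator (cball 0 R) x * \<bar>g (x + s *\<^sub>R t j *\<^sub>R b) - g x\<bar>)) \<partial>lborel \<partial>lborel)"
      by (rule nn_integral_mono_AE[OF F])
    also have "\<dots> = (\<integral>\<^sup>+s. \<integral>\<^sup>+x. ennreal (indicator {0..1} s * (indicator (cball 0 R) x * \<bar>g (x + s *\<^sub>R t j *\<^sub>R b) - g x\<bar>)) \<partial>lborel \<partial>lborel)"
      by (rule lborel_pair.Fubini'[symmetric]) measurable
    also have "\<dots> \<le> (\<integral>\<^sup>+s. ennreal (e / 2) * indicator {0..1::real} s \<partial>lborel)"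
    proof (rule nn_integral_mono)
      fix s :: real
      have "(\<integral>\<^sup>+x. ennreal (indicator (cball 0 R) x * \<bar>g (x + s *\<^sub>R t j *\<^sub>R b) - g x\<bar>) \<partial>lborel) < ennreal (e / 2)" if "s \<in> {0..1}"
      proof (rule d(2))
        have "norm (s *\<^sub>R t j *\<^sub>R b) \<le> \<bar>t j\<bar>" using that b by (auto simp: mult_left_le_one_le abs_mult)
        then show "norm (s *\<^sub>R t j *\<^sub>R b) < d" using elim by simp
      qed
      then show "(\<integral>\<^sup>+x. ennreal (indicator {0..1} s * (indicator (cball 0 R) x * \<bar>g (x + s *\<^sub>R t j *\<^sub>R b) - g x\<bar>)) \<partial>lborel)
          \<le> ennreal (e / 2) * indicator {0..1} s"
        by (cases "s \<in> {0..1}") auto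
    qed
    also have "\<dots> = ennreal (e / 2)" by (subst nn_integral_cmult_indicator) auto
    finally have "ennreal (LBINT x. ?F x) \<le> ennreal (e / 2)"
      by (subst nn_integral_eq_integral[symmetric]) (auto intro: iF)
    then have "(LBINT x. ?F x) \<le> e / 2" using e by (simp add: ennreal_le_iff)
    moreover have "0 \<le> (LBINT x. ?F x)" by (intro Bochner_Integration.integral_nonneg) auto
    ultimately show ?case using e by simp
  qed
qed

section \<open>Product and chain rule for weak derivatives\<close>

lemma loc_int_bounded:
  fixes F :: "'a::euclidean_space \<Rightarrow> real"
  assumes [measurable]: "F \<in> borel_measurable borel" and "\<And>x. \<bar>F x\<bar> \<le> c"
  shows "loc_int F"
  unfolding loc_int_def
proof (intro conjI allI)
  fix R
  show "integrable lborel (\<lambda>x. indicator (cball 0 R) x * F x)"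
  proof (rule Bochner_Integration.integrable_bound)
    have "integrable lborel (indicator (cball 0 R) :: 'a \<Rightarrow> real)"
      using emeasure_bounded_finite[OF bounded_cball, of "0 :: 'a" R] by (simp add: integrable_indicator_iff)
    then show "integrable lborel (\<lambda>x::'a. c * indicator (cball 0 R) x)"
      by (rule integrable_mult_right)
    show "AE x in lborel. norm (indicator (cball 0 R) x * F x) \<le> norm (c * indicator (cball 0 R) x)"
      using assms(2) by (auto simp: abs_mult split: split_indicator intro: order_trans[OF _ abs_ge_self])
  qed measurable
qed (rule assms(1))

text \<open>The diagonal value f' t makes f s - f t = q (s - t) hold without exception while keeping
  q continuous in s at t, so no case distinction is needed where u(x + t b) = u(x).\<close>

definition diff_quot :: "(real \<Rightarrow> real) \<Rightarrow> (real \<Rightarrow> real) \<Rightarrow> real \<Rightarrow> real \<Rightarrow> real" where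
  "diff_quot f f' s t = (if s = t then f' t else (f s - f t) / (s - t))"

lemma diff_quot_mult: "f s - f t = diff_quot f f' s t * (s - t)"
  by (simp add: diff_quot_def)

lemma diff_quot_bound:
  assumes "\<And>s. (f has_real_derivative f' s) (at s)" "\<And>s. \<bar>f' s\<bar> \<le> L"
  shows "\<bar>diff_quot f f' s t\<bar> \<le> L"
proof (cases "s = t")
  case False
  have "norm (f s - f t) \<le> L * norm (s - t)"
    by (rule field_differentiable_bound[of UNIV f f']) (use assms in \<open>auto intro: DERIV_subset\<close>)
  then show ?thesis using False by (simp add: diff_quot_def divide_le_eq)
qed (use assms in \<open>simp add: diff_quot_def\<close>)

lemma diff_quot_tendsto:
  assumes "(f has_real_derivative f' t) (at t)" "X \<longlonglongrightarrow> t"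
  shows "(\<lambda>j. diff_quot f f' (X j) t) \<longlonglongrightarrow> f' t"
proof -
  have "isCont (\<lambda>s. diff_quot f f' s t) t"
    unfolding isCont_def
  proof (rule Lim_transform_eventually)
    show "((\<lambda>s. (f s - f t) / (s - t)) \<longlongrightarrow> diff_quot f f' t t) (at t)"
      using assms(1) by (simp add: has_field_derivative_iff diff_quot_def)
    show "\<forall>\<^sub>F s in at t. (f s - f t) / (s - t) = diff_quot f f' s t"
      by (auto simp: eventually_at_filter diff_quot_def)
  qed
  then have "(\<lambda>j. diff_quot f f' (X j) t) \<longlonglongrightarrow> diff_quot f f' t t"
    using assms(2) by (rule isCont_tendsto_compose)
  then show ?thesis by (simp add: diff_quot_def)
qed

lemma measurable_diff_quot [measurable]:
  assumes [measurable]: "f \<in> borel_measurable borel" "f' \<in> borel_measurable borel"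
    "X \<in> borel_measurable M" "Y \<in> borel_measurable M"
  shows "(\<lambda>x. diff_quot f f' (X x) (Y x)) \<in> borel_measurable M"
  unfolding diff_quot_def by measurable

text \<open>The test functions admitted once weak derivatives are known to be limits of difference quotients: only
  bounded derivatives along the direction \<open>b\<close> are required, no smoothness.\<close>

definition line_test :: "'a::euclidean_space \<Rightarrow> ('a \<Rightarrow> real) \<Rightarrow> ('a \<Rightarrow> real) \<Rightarrow> real \<Rightarrow> real \<Rightarrow> bool" where
  "line_test b \<psi> \<psi>' c R \<longleftrightarrow> \<psi> \<in> borel_measurable borel \<and> (\<forall>x. \<bar>\<psi> x\<bar> \<le> c) \<and> (\<forall>x. norm x > R \<longrightarrow> \<psi> x = 0)
     \<and> (\<forall>x. ((\<lambda>s. \<psi> (x + s *\<^sub>R b)) has_real_derivative \<psi>' x) (at 0)) \<and> (\<forall>x. \<bar>\<psi>' x\<bar> \<le> c)"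

lemma line_testD:
  assumes "line_test b \<psi> \<psi>' c R"
  shows "\<psi> \<in> borel_measurable borel" "\<bar>\<psi> x\<bar> \<le> c" "norm x > R \<Longrightarrow> \<psi> x = 0"
    "((\<lambda>s. \<psi> (x + s *\<^sub>R b)) has_real_derivative \<psi>' x) (at 0)" "\<bar>\<psi>' x\<bar> \<le> c"
  using assms by (simp_all add: line_test_def)

lemma line_test_derivative:
  assumes "line_test b \<psi> \<psi>' c R"
  shows "((\<lambda>s. \<psi> (x + s *\<^sub>R b)) has_real_derivative \<psi>' (x + t *\<^sub>R b)) (at t)"
proof -
  have "((\<lambda>s. \<psi> ((x + t *\<^sub>R b) + s *\<^sub>R b)) has_real_derivative \<psi>' (x + t *\<^sub>R b)) (at (t + (- t)))"
    using line_testD(4)[OF assms] by simp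
  then show ?thesis
    by (subst (asm) DERIV_shift) (simp add: algebra_simps)
qed

lemma line_test_lipschitz:
  assumes "line_test b \<psi> \<psi>' c R"
  shows "\<bar>\<psi> (x + t *\<^sub>R b) - \<psi> x\<bar> \<le> c * \<bar>t\<bar>"
proof -
  have "norm (\<psi> (x + t *\<^sub>R b) - \<psi> (x + 0 *\<^sub>R b)) \<le> c * norm (t - 0)"
    by (rule field_differentiable_bound[of UNIV "\<lambda>s. \<psi> (x + s *\<^sub>R b)" "\<lambda>s. \<psi>' (x + s *\<^sub>R b)"])
       (use assms in \<open>auto intro: line_test_derivative line_testD\<close>)
  then show ?thesis by simp
qed

lemma line_test_quotient_tendsto:
  assumes "line_test b \<psi> \<psi>' c R" "t \<longlonglongrightarrow> 0" "\<And>j. t j \<noteq> 0"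
  shows "(\<lambda>j. (\<psi> (x + t j *\<^sub>R b) - \<psi> x) / t j) \<longlonglongrightarrow> \<psi>' x"
proof -
  have "((\<lambda>s. (\<psi> (x + s *\<^sub>R b) - \<psi> x) / s) \<longlongrightarrow> \<psi>' x) (at 0)"
    using line_testD(4)[OF assms(1), of x] by (simp add: has_field_derivative_iff)
  moreover have "filterlim t (at 0) sequentially"
    using assms(2,3) by (simp add: filterlim_at)
  ultimately show ?thesis by (rule filterlim_compose)
qed

text \<open>A pointwise limit of difference quotients; measurability of \<psi>' therefore need not
  be part of \<open>line_test\<close>.\<close>

lemma line_test_derivative_measurable:
  assumes t: "line_test b \<psi> \<psi>' c R"
  shows "\<psi>' \<in> borel_measurable borel"
proof (rule borel_measurable_LIMSEQ_real)
  show "(\<lambda>j. (\<psi> (x + inverse (real (Suc j)) *\<^sub>R b) - \<psi> x) / inverse (real (Suc j))) \<longlonglongrightarrow> \<psi>' x" for x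
    by (rule line_test_quotient_tendsto[OF t LIMSEQ_inverse_real_of_nat]) simp
  have [measurable]: "\<psi> \<in> borel_measurable borel" by (rule line_testD(1)[OF t])
  show "(\<lambda>x. (\<psi> (x + inverse (real (Suc j)) *\<^sub>R b) - \<psi> x) / inverse (real (Suc j))) \<in> borel_measurable borel" for j
    by measurable
qed

lemma line_test_derivative_support:
  assumes t: "line_test b \<psi> \<psi>' c R" and x: "norm x > R"
  shows "\<psi>' x = 0"
proof -
  have "((\<lambda>s. x + s *\<^sub>R b) \<longlongrightarrow> x + 0 *\<^sub>R b) (nhds 0)"
    by (intro tendsto_intros filterlim_ident)
  then have "\<forall>\<^sub>F s in nhds 0. x + s *\<^sub>R b \<in> - cball 0 R"
    by (rule topological_tendstoD) (use x in auto)
  then have "\<forall>\<^sub>F s in nhds 0. \<psi> (x + s *\<^sub>R b) = 0"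
    by eventually_elim (auto intro: line_testD(3)[OF t])
  then have "((\<lambda>s. 0) has_real_derivative \<psi>' x) (at 0)"
    using line_testD(4)[OF t, of x] by (subst (asm) DERIV_cong_ev[OF refl _ refl, of _ "\<lambda>_. 0"])
  then show ?thesis by (simp add: DERIV_unique[OF _ DERIV_const])
qed

text \<open>Splitting w_j q_j = w_j g + w_j (q_j - g), the first part converges by dominated
  convergence and the second is at most M times the L^1 distance. Thus the weights need only be
  bounded and converge almost everywhere.\<close>

lemma integral_mult_tendsto:
  fixes w :: "nat \<Rightarrow> 'a::euclidean_space \<Rightarrow> real"
  assumes q: "\<And>j. loc_int (q j)" and g: "loc_int g"
    and qg: "(\<lambda>j. LBINT x. indicator (cball 0 R) x * \<bar>q j x - g x\<bar>) \<longlonglongrightarrow> 0"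
    and [measurable]: "\<And>j. w j \<in> borel_measurable borel" "w' \<in> borel_measurable borel"
    and w: "\<And>j x. \<bar>w j x\<bar> \<le> M" "\<And>j x. norm x > R \<Longrightarrow> w j x = 0"
    and lim: "AE x in lborel. (\<lambda>j. w j x) \<longlonglongrightarrow> w' x"
  shows "(\<lambda>j. LBINT x. w j x * q j x) \<longlonglongrightarrow> (LBINT x. w' x * g x)"
proof -
  have [measurable]: "g \<in> borel_measurable borel" by (rule loc_int_measurable[OF g])
  have wi: "integrable lborel (\<lambda>x. h x * w j x)" if "loc_int h" for h j
    by (rule loc_int_mult_integrable[OF that _ w]) auto
  have M: "0 \<le> M" using w(1)[of 0 0] by linarith
  have "(\<lambda>j. LBINT x. w j x * g x) \<longlonglongrightarrow> (LBINT x. w' x * g x)"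
  proof (rule integral_dominated_convergence[where w = "\<lambda>x. M * \<bar>indicator (cball 0 R) x * g x\<bar>"])
    show "integrable lborel (\<lambda>x. M * \<bar>indicator (cball 0 R) x * g x\<bar>)"
      using g by (intro integrable_mult_right integrable_abs) (simp add: loc_int_def)
    show "AE x in lborel. (\<lambda>j. w j x * g x) \<longlonglongrightarrow> w' x * g x"
      using lim by eventually_elim (intro tendsto_intros)
    show "AE x in lborel. norm (w j x * g x) \<le> M * \<bar>indicator (cball 0 R) x * g x\<bar>" for j
    proof (rule AE_I2)
      fix x
      show "norm (w j x * g x) \<le> M * \<bar>indicator (cball 0 R) x * g x\<bar>"
        using mult_right_mono[OF w(1)[of j x], of "\<bar>g x\<bar>"] w(2)[of x j]
        by (cases "norm x \<le> R") (auto simp: abs_mult)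
    qed
  qed measurable
  moreover have "(\<lambda>j. LBINT x. w j x * (q j x - g x)) \<longlonglongrightarrow> 0"
  proof (rule Lim_null_comparison)
    show "(\<lambda>j. M * (LBINT x. indicator (cball 0 R) x * \<bar>q j x - g x\<bar>)) \<longlonglongrightarrow> 0"
      using tendsto_mult_right_zero[OF qg] by simp
    show "\<forall>\<^sub>F j in sequentially. norm (LBINT x. w j x * (q j x - g x))
        \<le> M * (LBINT x. indicator (cball 0 R) x * \<bar>q j x - g x\<bar>)"
    proof (rule always_eventually, rule allI)
      fix j
      have d: "loc_int (\<lambda>x. q j x - g x)" by (intro loc_int_diff q g)
      have "integrable lborel (\<lambda>x. \<bar>indicator (cball 0 R) x * (q j x - g x)\<bar>)"
        using d by (intro integrable_abs) (simp add: loc_int_def)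
      then have di: "integrable lborel (\<lambda>x. indicator (cball 0 R) x * \<bar>q j x - g x\<bar>)"
        by (simp add: abs_mult)
      have "norm (LBINT x. w j x * (q j x - g x)) \<le> (LBINT x. norm (w j x * (q j x - g x)))"
        by (rule integral_norm_bound)
      also have "\<dots> \<le> (LBINT x. M * (indicator (cball 0 R) x * \<bar>q j x - g x\<bar>))"
      proof (rule integral_mono)
        show "integrable lborel (\<lambda>x. norm (w j x * (q j x - g x)))"
          using wi[OF d, of j] by (intro integrable_norm) (simp add: mult.commute)
        show "integrable lborel (\<lambda>x. M * (indicator (cball 0 R) x * \<bar>q j x - g x\<bar>))"
          by (intro integrable_mult_right di)
        show "norm (w j x * (q j x - g x)) \<le> M * (indicator (cball 0 R) x * \<bar>q j x - g x\<bar>)" for x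
          using mult_right_mono[OF w(1)[of j x], of "\<bar>q j x - g x\<bar>"] w(2)[of x j]
          by (cases "norm x \<le> R") (auto simp: abs_mult)
      qed
      finally show "norm (LBINT x. w j x * (q j x - g x))
        \<le> M * (LBINT x. indicator (cball 0 R) x * \<bar>q j x - g x\<bar>)" by simp
    qed
  qed
  ultimately have "(\<lambda>j. (LBINT x. w j x * g x) + (LBINT x. w j x * (q j x - g x))) \<longlonglongrightarrow> (LBINT x. w' x * g x) + 0"
    by (rule tendsto_add)
  moreover have "(LBINT x. w j x * g x) + (LBINT x. w j x * (q j x - g x)) = (LBINT x. w j x * q j x)" for j
    using wi[OF g, of j] wi[OF q[of j], of j]
    by (simp add: right_diff_distrib mult.commute)
  ultimately show ?thesis by simp
qed

text \<open>L^1 convergence gives almost everywhere convergence along a subsequence; the two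
  distances are added so that one subsequence serves both u and v.\<close>

lemma loc_int_shift_tendsto_AE:
  fixes u v :: "'a::euclidean_space \<Rightarrow> real"
  assumes u: "loc_int u" and v: "loc_int v" and t: "t \<longlonglongrightarrow> 0"
  obtains r where "strict_mono r" "AE x in lborel. norm x \<le> R \<longrightarrow>
     (\<lambda>j. u (x + t (r j) *\<^sub>R b)) \<longlonglongrightarrow> u x \<and> (\<lambda>j. v (x + t (r j) *\<^sub>R b)) \<longlonglongrightarrow> v x"
proof -
  let ?I = "indicator (cball 0 R) :: 'a \<Rightarrow> real"
  have h: "(\<lambda>j. t j *\<^sub>R b) \<longlonglongrightarrow> 0" using tendsto_scaleR[OF t tendsto_const[of b]] by simp
  have int: "integrable lborel (\<lambda>x. ?I x * \<bar>u (x + h) - u x\<bar>)" if "loc_int u" for u h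
  proof -
    have "loc_int (\<lambda>x. u (x + h) - u x)" by (intro loc_int_diff loc_int_translate that)
    then have "integrable lborel (\<lambda>x. \<bar>?I x * (u (x + h) - u x)\<bar>)"
      by (intro integrable_abs) (simp add: loc_int_def)
    then show ?thesis by (simp add: abs_mult)
  qed
  let ?H = "\<lambda>j x. ?I x * \<bar>u (x + t j *\<^sub>R b) - u x\<bar> + ?I x * \<bar>v (x + t j *\<^sub>R b) - v x\<bar>"
  have "(\<lambda>j. (LBINT x. ?I x * \<bar>u (x + t j *\<^sub>R b) - u x\<bar>) + (LBINT x. ?I x * \<bar>v (x + t j *\<^sub>R b) - v x\<bar>)) \<longlonglongrightarrow> 0 + 0"
    by (intro tendsto_add loc_int_translation_tendsto u v h)
  moreover have "(LBINT x. norm (?H j x)) = (LBINT x. ?I x * \<bar>u (x + t j *\<^sub>R b) - u x\<bar>) + (LBINT x. ?I x * \<bar>v (x + t j *\<^sub>R b) - v x\<bar>)" for j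
  proof -
    have "norm (?H j x) = ?H j x" for x by simp
    then show ?thesis by (simp only: Bochner_Integration.integral_add[OF int[OF u] int[OF v]])
  qed
  ultimately have "(\<lambda>j. LBINT x. norm (?H j x)) \<longlonglongrightarrow> 0" by simp
  from tendsto_L1_AE_subseq[OF Bochner_Integration.integrable_add[OF int[OF u] int[OF v]] this]
  obtain r where r: "strict_mono r" "AE x in lborel. (\<lambda>j. ?H (r j) x) \<longlonglongrightarrow> 0" by blast
  show thesis
  proof (rule that[OF r(1)])
    show "AE x in lborel. norm x \<le> R \<longrightarrow>
     (\<lambda>j. u (x + t (r j) *\<^sub>R b)) \<longlonglongrightarrow> u x \<and> (\<lambda>j. v (x + t (r j) *\<^sub>R b)) \<longlonglongrightarrow> v x"
      using r(2)
    proof eventually_elim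
      case (elim x)
      show ?case
      proof (intro impI conjI)
        assume "norm x \<le> R"
        then have *: "(\<lambda>j. \<bar>u (x + t (r j) *\<^sub>R b) - u x\<bar> + \<bar>v (x + t (r j) *\<^sub>R b) - v x\<bar>) \<longlonglongrightarrow> 0"
          using elim by simp
        have "(\<lambda>j. u (x + t (r j) *\<^sub>R b) - u x) \<longlonglongrightarrow> 0" "(\<lambda>j. v (x + t (r j) *\<^sub>R b) - v x) \<longlonglongrightarrow> 0"
          by (rule Lim_null_comparison[OF _ *], simp)+
        then show "(\<lambda>j. u (x + t (r j) *\<^sub>R b)) \<longlonglongrightarrow> u x" "(\<lambda>j. v (x + t (r j) *\<^sub>R b)) \<longlonglongrightarrow> v x"
          by (simp_all only: LIM_zero_iff)
      qed
    qed
  qed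
qed

text \<open>No smooth approximation of u or v is made: the discrete Leibniz rule for f(u) p(v),
  tested against \<psi>, passes to the limit because the difference quotients of u and v converge in
  L^1 on balls while all their coefficients stay bounded.\<close>

theorem weak_partial_product_chain:
  fixes u v :: "'a::euclidean_space \<Rightarrow> real"
  assumes u: "has_weak_partial u gu b" and v: "has_weak_partial v gv b" and b: "b \<in> Basis"
    and f: "\<And>s. (f has_real_derivative f' s) (at s)" "continuous_on UNIV f'" "\<And>s. \<bar>f s\<bar> \<le> L" "\<And>s. \<bar>f' s\<bar> \<le> L"
    and p: "\<And>s. (p has_real_derivative p' s) (at s)" "continuous_on UNIV p'" "\<And>s. \<bar>p s\<bar> \<le> M" "\<And>s. \<bar>p' s\<bar> \<le> M"
    and \<psi>: "line_test b \<psi> \<psi>' c R"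
  shows "(LBINT x. f (u x) * p (v x) * \<psi>' x) =
    - (LBINT x. \<psi> x * (p (v x) * f' (u x) * gu x + f (u x) * p' (v x) * gv x))"
proof -
  have li: "loc_int u" "loc_int gu" "loc_int v" "loc_int gv" using u v by (auto simp: has_weak_partial_def)
  have [measurable]: "u \<in> borel_measurable borel" "gu \<in> borel_measurable borel"
    "v \<in> borel_measurable borel" "gv \<in> borel_measurable borel"
    by (auto intro: loc_int_measurable li)
  have fc: "continuous_on UNIV f" and pc: "continuous_on UNIV p"
    using f(1) p(1) by (auto intro: DERIV_continuous_on)
  have [measurable]: "f \<in> borel_measurable borel" "f' \<in> borel_measurable borel"
    "p \<in> borel_measurable borel" "p' \<in> borel_measurable borel"
    by (intro borel_measurable_continuous_onI fc pc f p)+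
  have [measurable]: "\<psi> \<in> borel_measurable borel" "\<psi>' \<in> borel_measurable borel"
    by (rule line_testD(1)[OF \<psi>], rule line_test_derivative_measurable[OF \<psi>])
  note \<psi>D = line_testD[OF \<psi>]
  have c: "0 \<le> c" using \<psi>D(2)[of 0] by linarith
  have L: "0 \<le> L" using f(3)[of 0] by linarith
  have M: "0 \<le> M" using p(3)[of 0] by linarith
  let ?t0 = "\<lambda>j. inverse (real (Suc j))"
  obtain r where r: "strict_mono r" "AE x in lborel. norm x \<le> R \<longrightarrow>
     (\<lambda>j. u (x + ?t0 (r j) *\<^sub>R b)) \<longlonglongrightarrow> u x \<and> (\<lambda>j. v (x + ?t0 (r j) *\<^sub>R b)) \<longlonglongrightarrow> v x"
    using loc_int_shift_tendsto_AE[OF li(1,3) LIMSEQ_inverse_real_of_nat, of R b] by blast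
  define t where "t j = ?t0 (r j)" for j
  have t: "t \<longlonglongrightarrow> 0" "\<And>j. t j \<noteq> 0" "\<And>j. t j > 0"
    using LIMSEQ_subseq_LIMSEQ[OF LIMSEQ_inverse_real_of_nat r(1)] by (auto simp: t_def[abs_def] comp_def)
  have AEuv: "AE x in lborel. norm x \<le> R \<longrightarrow>
     (\<lambda>j. u (x + t j *\<^sub>R b)) \<longlonglongrightarrow> u x \<and> (\<lambda>j. v (x + t j *\<^sub>R b)) \<longlonglongrightarrow> v x"
    using r(2) by (simp add: t_def)
  define F where "F x = f (u x) * p (v x)" for x
  have [measurable]: "F \<in> borel_measurable borel" unfolding F_def by measurable
  have Fb: "\<bar>F x\<bar> \<le> L * M" for x unfolding F_def abs_mult by (intro mult_mono f p L) auto
  have F: "loc_int F" by (rule loc_int_bounded[OF _ Fb]) measurable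
  define A where "A j x = diff_quot f f' (u (x + t j *\<^sub>R b)) (u x)" for j x
  define B where "B j x = diff_quot p p' (v (x + t j *\<^sub>R b)) (v x)" for j x
  have [measurable]: "A j \<in> borel_measurable borel" "B j \<in> borel_measurable borel" for j
    unfolding A_def B_def by measurable
  have Ab: "\<bar>A j x\<bar> \<le> L" and Bb: "\<bar>B j x\<bar> \<le> M" for j x
    unfolding A_def B_def by (rule diff_quot_bound[OF f(1,4)], rule diff_quot_bound[OF p(1,4)])
  define qu where "qu j x = (u (x + t j *\<^sub>R b) - u x) / t j" for j x
  define qv where "qv j x = (v (x + t j *\<^sub>R b) - v x) / t j" for j x
  have q: "loc_int (qu j)" "loc_int (qv j)" for j
  proof -
    have "loc_int (\<lambda>x. (1 / t j) * (u (x + t j *\<^sub>R b) - u x))" "loc_int (\<lambda>x. (1 / t j) * (v (x + t j *\<^sub>R b) - v x))"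
      by (intro loc_int_diff loc_int_cmult loc_int_translate li)+
    then show "loc_int (qu j)" "loc_int (qv j)" by (simp_all add: qu_def[abs_def] qv_def[abs_def])
  qed
  define wu where "wu j x = \<psi> x * (p (v (x + t j *\<^sub>R b)) * A j x)" for j x
  define wv where "wv j x = \<psi> x * (f (u x) * B j x)" for j x
  have [measurable]: "wu j \<in> borel_measurable borel" "wv j \<in> borel_measurable borel" for j
    unfolding wu_def wv_def by measurable
  have wb: "\<bar>wu j x\<bar> \<le> c * (M * L)" "\<bar>wv j x\<bar> \<le> c * (L * M)" for j x
    unfolding wu_def wv_def abs_mult by (intro mult_mono \<psi>D f p Ab Bb c L M mult_nonneg_nonneg abs_ge_zero)+
  have w0: "wu j x = 0" "wv j x = 0" if "norm x > R" for j x
    using \<psi>D(3)[OF that] by (auto simp: wu_def wv_def)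
  \<comment> \<open>Discrete Leibniz rule. The factor p is evaluated at the shifted point, so the
    shifts of v must converge almost everywhere as well.\<close>
  have ident: "\<psi> x * ((F (x + t j *\<^sub>R b) - F x) / t j) = wu j x * qu j x + wv j x * qv j x" for j x
  proof -
    have "F (x + t j *\<^sub>R b) - F x = p (v (x + t j *\<^sub>R b)) * (f (u (x + t j *\<^sub>R b)) - f (u x))
        + f (u x) * (p (v (x + t j *\<^sub>R b)) - p (v x))"
      by (simp add: F_def algebra_simps)
    also have "\<dots> = p (v (x + t j *\<^sub>R b)) * (A j x * (u (x + t j *\<^sub>R b) - u x))
        + f (u x) * (B j x * (v (x + t j *\<^sub>R b) - v x))"
      unfolding A_def B_def diff_quot_mult[of f _ _ f'] diff_quot_mult[of p _ _ p'] ..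
    finally show ?thesis
      by (simp add: wu_def wv_def qu_def qv_def add_divide_distrib distrib_left)
  qed
  have lim_u: "(\<lambda>j. LBINT x. wu j x * qu j x) \<longlonglongrightarrow> (LBINT x. (\<psi> x * (p (v x) * f' (u x))) * gu x)"
  proof (rule integral_mult_tendsto[where R = R and M = "c * (M * L)"])
    show "(\<lambda>j. LBINT x. indicator (cball 0 R) x * \<bar>qu j x - gu x\<bar>) \<longlonglongrightarrow> 0"
      unfolding qu_def by (rule difference_quotient_tendsto_L1[OF u b t(1,2)])
    show "AE x in lborel. (\<lambda>j. wu j x) \<longlonglongrightarrow> \<psi> x * (p (v x) * f' (u x))"
      using AEuv
    proof eventually_elim
      case (elim x)
      show ?case
      proof (cases "norm x \<le> R")
        case True
        have "isCont p (v x)" using p(1) DERIV_isCont by blast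
        then show ?thesis unfolding wu_def A_def
          using elim True by (intro tendsto_mult tendsto_const diff_quot_tendsto f isCont_tendsto_compose[of _ p]) auto
      qed (simp add: wu_def \<psi>D(3))
    qed
  qed (use li q wb w0 in \<open>auto\<close>)
  have lim_v: "(\<lambda>j. LBINT x. wv j x * qv j x) \<longlonglongrightarrow> (LBINT x. (\<psi> x * (f (u x) * p' (v x))) * gv x)"
  proof (rule integral_mult_tendsto[where R = R and M = "c * (L * M)"])
    show "(\<lambda>j. LBINT x. indicator (cball 0 R) x * \<bar>qv j x - gv x\<bar>) \<longlonglongrightarrow> 0"
      unfolding qv_def by (rule difference_quotient_tendsto_L1[OF v b t(1,2)])
    show "AE x in lborel. (\<lambda>j. wv j x) \<longlonglongrightarrow> \<psi> x * (f (u x) * p' (v x))"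
      using AEuv
    proof eventually_elim
      case (elim x)
      show ?case
      proof (cases "norm x \<le> R")
        case True
        then show ?thesis unfolding wv_def B_def
          using elim by (intro tendsto_mult tendsto_const diff_quot_tendsto p) auto
      qed (simp add: wv_def \<psi>D(3))
    qed
  qed (use li q wb w0 in \<open>auto\<close>)
  have \<psi>int: "integrable lborel (\<lambda>x. k x * \<psi> x)" if "loc_int k" for k
    by (rule loc_int_mult_integrable[OF that _ \<psi>D(2,3)]) measurable
  have wint: "integrable lborel (\<lambda>x. wu j x * qu j x)" "integrable lborel (\<lambda>x. wv j x * qv j x)" for j
    using loc_int_mult_integrable[OF q(1)[of j] _ wb(1)[of j] w0(1)[of _ j]]
      loc_int_mult_integrable[OF q(2)[of j] _ wb(2)[of j] w0(2)[of _ j]] by (simp_all add: mult.commute)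
  \<comment> \<open>Discrete integration by parts: translation invariance moves the forward
    difference of F to a backward difference of \<psi>.\<close>
  have eq: "(LBINT x. F x * ((\<psi> (x + (- t j) *\<^sub>R b) - \<psi> x) / t j))
      = (LBINT x. wu j x * qu j x) + (LBINT x. wv j x * qv j x)" for j
  proof -
    have Fs: "loc_int (\<lambda>x. F (x + h))" for h by (rule loc_int_translate[OF F])
    have i1: "integrable lborel (\<lambda>x. F (x + t j *\<^sub>R b) * \<psi> x)" by (rule \<psi>int[OF Fs])
    have i2: "integrable lborel (\<lambda>x. F x * \<psi> (x + (- t j) *\<^sub>R b))"
      using integrable_lborel_translate[OF i1, of "(- t j) *\<^sub>R b"] by simp
    have "(LBINT x. F x * ((\<psi> (x + (- t j) *\<^sub>R b) - \<psi> x) / t j))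
      = ((LBINT x. F x * \<psi> (x + (- t j) *\<^sub>R b)) - (LBINT x. F x * \<psi> x)) / t j"
      using i2 \<psi>int[OF F] by (simp add: right_diff_distrib)
    also have "(LBINT x. F x * \<psi> (x + (- t j) *\<^sub>R b)) = (LBINT x. F (x + t j *\<^sub>R b) * \<psi> x)"
      using integral_lborel_translate[of "\<lambda>x. F x * \<psi> (x + (- t j) *\<^sub>R b)" "t j *\<^sub>R b"] by simp
    also have "(\<dots> - (LBINT x. F x * \<psi> x)) / t j = (LBINT x. \<psi> x * ((F (x + t j *\<^sub>R b) - F x) / t j))"
    proof -
      have eq: "\<psi> x * ((F (x + t j *\<^sub>R b) - F x) / t j) = (F (x + t j *\<^sub>R b) * \<psi> x - F x * \<psi> x) / t j" for x
        by (simp add: algebra_simps)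
      show ?thesis unfolding eq using i1 \<psi>int[OF F] by simp
    qed
    also have "\<dots> = (LBINT x. wu j x * qu j x) + (LBINT x. wv j x * qv j x)"
      unfolding ident by (rule Bochner_Integration.integral_add[OF wint])
    finally show ?thesis .
  qed
  \<comment> \<open>The backward difference divided by t tends to - \<psi>', the source of the minus
    sign. Steps are at most 1 and b is a unit vector, so everything vanishes outside the ball of
    radius R + 1.\<close>
  have "(\<lambda>j. LBINT x. F x * ((\<psi> (x + (- t j) *\<^sub>R b) - \<psi> x) / t j)) \<longlonglongrightarrow> (LBINT x. F x * (- \<psi>' x))"
  proof (rule integral_dominated_convergence[where w = "\<lambda>x. c * \<bar>indicator (cball 0 (R + 1)) x * F x\<bar>"])
    show "integrable lborel (\<lambda>x. c * \<bar>indicator (cball 0 (R + 1)) x * F x\<bar>)"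
      using F by (intro integrable_mult_right integrable_abs) (simp add: loc_int_def)
    show "AE x in lborel. (\<lambda>j. F x * ((\<psi> (x + (- t j) *\<^sub>R b) - \<psi> x) / t j)) \<longlonglongrightarrow> F x * (- \<psi>' x)"
    proof (rule AE_I2)
      fix x
      have "(\<lambda>j. - ((\<psi> (x + (- t j) *\<^sub>R b) - \<psi> x) / (- t j))) \<longlonglongrightarrow> - \<psi>' x"
        by (intro tendsto_minus line_test_quotient_tendsto[OF \<psi>]) (use t tendsto_minus[OF t(1)] in auto)
      then show "(\<lambda>j. F x * ((\<psi> (x + (- t j) *\<^sub>R b) - \<psi> x) / t j)) \<longlonglongrightarrow> F x * (- \<psi>' x)"
        by (intro tendsto_mult tendsto_const) simp
    qed
    show "AE x in lborel. norm (F x * ((\<psi> (x + (- t j) *\<^sub>R b) - \<psi> x) / t j))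
        \<le> c * \<bar>indicator (cball 0 (R + 1)) x * F x\<bar>" for j
    proof (rule AE_I2)
      fix x
      have t1: "t j \<le> 1" by (simp add: t_def divide_simps)
      have "\<bar>(\<psi> (x + (- t j) *\<^sub>R b) - \<psi> x) / t j\<bar> \<le> c"
        using line_test_lipschitz[OF \<psi>, of x "- t j"] t(3)[of j] by (simp add: divide_le_eq)
      moreover have "\<psi> (x + (- t j) *\<^sub>R b) = 0 \<and> \<psi> x = 0" if "norm x > R + 1"
      proof -
        have "norm x \<le> norm (x + (- t j) *\<^sub>R b) + norm (t j *\<^sub>R b)"
          using norm_triangle_ineq[of "x + (- t j) *\<^sub>R b" "t j *\<^sub>R b"] by simp
        then have "norm (x + (- t j) *\<^sub>R b) > R" using that t1 t(3)[of j] b by simp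
        then show ?thesis using \<psi>D(3) that by simp
      qed
      ultimately show "norm (F x * ((\<psi> (x + (- t j) *\<^sub>R b) - \<psi> x) / t j))
        \<le> c * \<bar>indicator (cball 0 (R + 1)) x * F x\<bar>"
        using b mult_left_mono[of "\<bar>(\<psi> (x + (- t j) *\<^sub>R b) - \<psi> x) / t j\<bar>" c "\<bar>F x\<bar>"]
        by (cases "norm x \<le> R + 1") (auto simp: abs_mult mult.commute)
    qed
  qed measurable
  moreover have "(\<lambda>j. LBINT x. F x * ((\<psi> (x + (- t j) *\<^sub>R b) - \<psi> x) / t j)) \<longlonglongrightarrow>
     (LBINT x. (\<psi> x * (p (v x) * f' (u x))) * gu x) + (LBINT x. (\<psi> x * (f (u x) * p' (v x))) * gv x)"
    unfolding eq by (intro tendsto_add lim_u lim_v)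
  ultimately have "(LBINT x. F x * (- \<psi>' x)) =
     (LBINT x. (\<psi> x * (p (v x) * f' (u x))) * gu x) + (LBINT x. (\<psi> x * (f (u x) * p' (v x))) * gv x)"
    by (rule LIMSEQ_unique)
  also have "\<dots> = (LBINT x. \<psi> x * (p (v x) * f' (u x) * gu x + f (u x) * p' (v x) * gv x))"
  proof -
    have "integrable lborel (\<lambda>x. gu x * (\<psi> x * (p (v x) * f' (u x))))"
      by (rule loc_int_mult_integrable[OF li(2), where c = "c * (M * L)" and R = R])
        (auto simp: abs_mult \<psi>D(3) intro!: mult_mono \<psi>D(2) f p c L M mult_nonneg_nonneg)
    moreover have "integrable lborel (\<lambda>x. gv x * (\<psi> x * (f (u x) * p' (v x))))"
      by (rule loc_int_mult_integrable[OF li(4), where c = "c * (L * M)" and R = R])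
        (auto simp: abs_mult \<psi>D(3) intro!: mult_mono \<psi>D(2) f p c L M mult_nonneg_nonneg)
    ultimately show ?thesis
      by (subst Bochner_Integration.integral_add[symmetric]) (auto simp: algebra_simps)
  qed
  finally show ?thesis by (simp add: F_def)
qed

section \<open>Weak derivatives with respect to a weight\<close>

text \<open>The arctangent gives a bounded C^1 truncation with derivative in (0, 1]: truncating
  neither enlarges |\<phi>| nor |\<nabla>\<phi>|, and the chain rule for C^1 functions
  applies.\<close>

definition trunc :: "real \<Rightarrow> real \<Rightarrow> real" where
  "trunc k t = k * arctan (t / k)"

definition trunc' :: "real \<Rightarrow> real \<Rightarrow> real" where
  "trunc' k t = inverse (1 + (t / k)\<^sup>2)"

lemma trunc_has_derivative:
  assumes "k > 0" shows "(trunc k has_real_derivative trunc' k t) (at t)"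
proof -
  have "((\<lambda>t. t / k) has_real_derivative 1 / k) (at t)"
    using assms by (auto intro!: derivative_eq_intros)
  from DERIV_cmult[OF DERIV_chain2[OF DERIV_arctan this], of k] show ?thesis
    using assms by (simp add: trunc_def[abs_def] trunc'_def)
qed

lemma trunc'_bounds: "0 < trunc' k t" "trunc' k t \<le> 1"
proof -
  have "1 \<le> 1 + (t / k)\<^sup>2" by simp
  then show "0 < trunc' k t" "trunc' k t \<le> 1"
    unfolding trunc'_def by (simp_all add: inverse_le_1_iff add_pos_nonneg)
qed

lemma abs_trunc_le: assumes "k > 0" shows "\<bar>trunc k t\<bar> \<le> \<bar>t\<bar>"
proof -
  have "norm (trunc k t - trunc k 0) \<le> 1 * norm (t - 0)"
    by (rule field_differentiable_bound[of UNIV "trunc k" "trunc' k"])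
       (use trunc_has_derivative[OF assms] trunc'_bounds[of k] in \<open>auto simp: abs_of_pos\<close>)
  then show ?thesis by (simp add: trunc_def)
qed

lemma abs_trunc_bounded: assumes "k > 0" shows "\<bar>trunc k t\<bar> \<le> 2 * k"
proof -
  have "\<bar>arctan (t / k)\<bar> \<le> 2"
    using arctan_bounded[of "t / k"] pi_less_4 by (simp add: abs_le_iff)
  then show ?thesis using assms by (simp add: trunc_def abs_mult mult.commute)
qed

lemma trunc_tendsto: "(\<lambda>j. trunc (real (Suc j)) t) \<longlonglongrightarrow> t"
proof -
  have X: "(\<lambda>j. t / real (Suc j)) \<longlonglongrightarrow> 0"
    using tendsto_mult_right_zero[OF LIMSEQ_inverse_real_of_nat, of t] by (simp only: divide_inverse)
  \<comment> \<open>k arctan (t/k) is t times the difference quotient of arctan between t/k and 0;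
    the diagonal value 1 covers t = 0.\<close>
  have "(\<lambda>j. diff_quot arctan (\<lambda>x. inverse (1 + x\<^sup>2)) (t / real (Suc j)) 0 * t) \<longlonglongrightarrow> inverse (1 + 0\<^sup>2) * t"
    by (intro tendsto_mult tendsto_const diff_quot_tendsto DERIV_arctan X)
  moreover have "diff_quot arctan (\<lambda>x. inverse (1 + x\<^sup>2)) (t / real (Suc j)) 0 * t = trunc (real (Suc j)) t" for j
  proof -
    let ?d = "diff_quot arctan (\<lambda>x. inverse (1 + x\<^sup>2)) (t / real (Suc j)) 0"
    have "arctan (t / real (Suc j)) - arctan 0 = ?d * (t / real (Suc j) - 0)"
      by (rule diff_quot_mult)
    then have "real (Suc j) * arctan (t / real (Suc j)) = real (Suc j) * (?d * (t / real (Suc j)))" by simp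
    then show ?thesis by (simp add: trunc_def del: of_nat_Suc)
  qed
  ultimately show ?thesis by simp
qed

text \<open>Serves twice: applied to w it replaces the unbounded weight w^2 until a limit is taken,
  applied to \<phi> it replaces \<phi>^2 in the divergence identity.\<close>

definition sq_trunc :: "real \<Rightarrow> real \<Rightarrow> real" where
  "sq_trunc k t = (trunc k t)\<^sup>2"

definition sq_trunc' :: "real \<Rightarrow> real \<Rightarrow> real" where
  "sq_trunc' k t = 2 * trunc k t * trunc' k t"

lemma sq_trunc_has_derivative:
  "k > 0 \<Longrightarrow> (sq_trunc k has_real_derivative sq_trunc' k t) (at t)"
  unfolding sq_trunc_def[abs_def] sq_trunc'_def
  by (auto intro!: derivative_eq_intros trunc_has_derivative)

lemma continuous_on_trunc:
  "k > 0 \<Longrightarrow> continuous_on UNIV (trunc k)" "k > 0 \<Longrightarrow> continuous_on UNIV (trunc' k)"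
proof -
  show "k > 0 \<Longrightarrow> continuous_on UNIV (trunc k)"
    using trunc_has_derivative DERIV_continuous_on by blast
  have "1 + (t / k)\<^sup>2 \<noteq> 0" for t :: real
    using add_pos_nonneg[of 1 "(t / k)\<^sup>2"] by simp
  then show "k > 0 \<Longrightarrow> continuous_on UNIV (trunc' k)"
    unfolding trunc'_def[abs_def] by (intro continuous_intros) auto
qed

lemma continuous_on_sq_trunc:
  "k > 0 \<Longrightarrow> continuous_on UNIV (sq_trunc k)" "k > 0 \<Longrightarrow> continuous_on UNIV (sq_trunc' k)"
  unfolding sq_trunc_def[abs_def] sq_trunc'_def[abs_def]
  by (intro continuous_intros continuous_on_trunc; assumption)+

text \<open>The bounds by t^2 and 2 |t| dominate the passage to the limit in k; those by 4 k^2 and 4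
  k meet the boundedness demanded by the chain rule. The 4 comes from rounding pi/2 up to 2.\<close>

lemma sq_trunc_bounds:
  assumes "k > 0"
  shows "0 \<le> sq_trunc k t" "sq_trunc k t \<le> t\<^sup>2" "sq_trunc k t \<le> 4 * k\<^sup>2"
    "\<bar>sq_trunc' k t\<bar> \<le> 2 * \<bar>t\<bar>" "\<bar>sq_trunc' k t\<bar> \<le> 4 * k"
proof -
  show "0 \<le> sq_trunc k t" by (simp add: sq_trunc_def)
  show "sq_trunc k t \<le> t\<^sup>2" unfolding sq_trunc_def
    using abs_trunc_le[OF assms, of t] by (simp add: abs_le_square_iff)
  show "sq_trunc k t \<le> 4 * k\<^sup>2" unfolding sq_trunc_def
    using abs_trunc_bounded[OF assms, of t] abs_le_square_iff[of "trunc k t" "2 * k"] assms by (simp add: power_mult_distrib)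
  have *: "\<bar>sq_trunc' k t\<bar> \<le> 2 * \<bar>trunc k t\<bar>"
    using mult_left_mono[OF trunc'_bounds(2)[of k t], of "2 * \<bar>trunc k t\<bar>"] trunc'_bounds(1)[of k t]
    by (simp add: sq_trunc'_def abs_mult)
  show "\<bar>sq_trunc' k t\<bar> \<le> 2 * \<bar>t\<bar>" "\<bar>sq_trunc' k t\<bar> \<le> 4 * k"
    using * abs_trunc_le[OF assms, of t] abs_trunc_bounded[OF assms, of t] by linarith+
qed

lemma sq_trunc_tendsto: "(\<lambda>j. sq_trunc (real (Suc j)) t) \<longlonglongrightarrow> t\<^sup>2"
  unfolding sq_trunc_def by (intro tendsto_intros trunc_tendsto)

lemma trunc'_tendsto: "(\<lambda>j. trunc' (real (Suc j)) t) \<longlonglongrightarrow> 1"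
proof -
  have X: "(\<lambda>j. t / real (Suc j)) \<longlonglongrightarrow> 0"
    using tendsto_mult_right_zero[OF LIMSEQ_inverse_real_of_nat, of t] by (simp only: divide_inverse)
  have "(\<lambda>j. inverse (1 + (t / real (Suc j))\<^sup>2)) \<longlonglongrightarrow> inverse (1 + 0\<^sup>2)"
    by (intro tendsto_inverse tendsto_add tendsto_power tendsto_const X) simp
  then show ?thesis by (simp add: trunc'_def)
qed

lemma sq_trunc'_tendsto: "(\<lambda>j. sq_trunc' (real (Suc j)) t) \<longlonglongrightarrow> 2 * t"
proof -
  have "(\<lambda>j. 2 * trunc (real (Suc j)) t * trunc' (real (Suc j)) t) \<longlonglongrightarrow> 2 * t * 1"
    by (intro tendsto_mult tendsto_const trunc_tendsto trunc'_tendsto)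
  then show ?thesis by (simp add: sq_trunc'_def)
qed

section \<open>Integration by parts against the weight w^2\<close>

lemma loc_int_mono:
  assumes f: "loc_int f" and [measurable]: "g \<in> borel_measurable borel" and le: "\<And>x. \<bar>g x\<bar> \<le> \<bar>f x\<bar>"
  shows "loc_int g"
  unfolding loc_int_def
proof (intro conjI allI)
  fix R
  show "integrable lborel (\<lambda>x. indicator (cball 0 R) x * g x)"
  proof (rule Bochner_Integration.integrable_bound)
    show "integrable lborel (\<lambda>x. indicator (cball 0 R) x * f x)" using f by (simp add: loc_int_def)
    show "AE x in lborel. norm (indicator (cball 0 R) x * g x) \<le> norm (indicator (cball 0 R) x * f x)"
      using le by (auto simp: abs_mult intro!: mult_left_mono)
  qed measurable
qed (rule assms(2))

lemma abs_mult_le_sum_squares: "\<bar>2 * (x * y)\<bar> \<le> x\<^sup>2 + (y :: real)\<^sup>2"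
  using sum_squares_bound[of "\<bar>x\<bar>" "\<bar>y\<bar>"] by (simp add: abs_mult)

lemma loc_int_mult_L2:
  assumes f: "loc_int (\<lambda>x. (f x)\<^sup>2)" and g: "loc_int (\<lambda>x. (g x)\<^sup>2)"
    and [measurable]: "f \<in> borel_measurable borel" "g \<in> borel_measurable borel"
  shows "loc_int (\<lambda>x. 2 * f x * g x)"
  by (rule loc_int_mono[OF loc_int_add[OF f g]])
     (use abs_mult_le_sum_squares in \<open>auto simp: mult.assoc\<close>)

text \<open>The bounded product rule is used with p = \<open>sq_trunc k\<close> and k tends to
  infinity. The limit integrands dominate the truncated ones. Bounded f' alone would not make w^2
  f'(u) g locally integrable, which is why \<open>wg\<close> is assumed; in the application it
  follows from the finite weighted energy.\<close>

theorem weighted_weak_partial_chain: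
  fixes u w :: "'a::euclidean_space \<Rightarrow> real"
  assumes u: "has_weak_partial u g b" and w: "has_weak_partial w \<gamma> b" and b: "b \<in> Basis"
    and f: "\<And>s. (f has_real_derivative f' s) (at s)" "continuous_on UNIV f'" "\<And>s. \<bar>f s\<bar> \<le> L" "\<And>s. \<bar>f' s\<bar> \<le> L"
    and w2: "loc_int (\<lambda>x. (w x)\<^sup>2)" and \<gamma>2: "loc_int (\<lambda>x. (\<gamma> x)\<^sup>2)"
    and wg: "loc_int (\<lambda>x. (w x)\<^sup>2 * (f' (u x) * g x))"
    and \<psi>: "line_test b \<psi> \<psi>' c R"
  shows "(LBINT x. f (u x) * (w x)\<^sup>2 * \<psi>' x) =
    - (LBINT x. \<psi> x * ((w x)\<^sup>2 * (f' (u x) * g x) + f (u x) * (2 * w x * \<gamma> x)))"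
proof -
  have li: "loc_int u" "loc_int g" "loc_int w" "loc_int \<gamma>" using u w by (auto simp: has_weak_partial_def)
  have [measurable]: "u \<in> borel_measurable borel" "g \<in> borel_measurable borel"
    "w \<in> borel_measurable borel" "\<gamma> \<in> borel_measurable borel"
    by (auto intro: loc_int_measurable li)
  have fc: "continuous_on UNIV f"
    using f(1) by (auto intro: DERIV_continuous_on)
  have [measurable]: "f \<in> borel_measurable borel" "f' \<in> borel_measurable borel"
    by (intro borel_measurable_continuous_onI fc f)+
  have [measurable]: "\<psi> \<in> borel_measurable borel" "\<psi>' \<in> borel_measurable borel"
    by (rule line_testD(1)[OF \<psi>], rule line_test_derivative_measurable[OF \<psi>])
  let ?k = "\<lambda>j. real (Suc j)"
  have [measurable]: "sq_trunc (?k j) \<in> borel_measurable borel" "sq_trunc' (?k j) \<in> borel_measurable borel" for j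
    by (intro borel_measurable_continuous_onI continuous_on_sq_trunc; simp)+
  note \<psi>D = line_testD[OF \<psi>]
  have kpos: "?k j > 0" for j by simp
  note bd = sq_trunc_bounds[OF kpos]
  have bd_abs: "\<bar>sq_trunc (?k j) t\<bar> \<le> \<bar>t\<^sup>2\<bar>" for j t
    using bd(1,2)[of j t] by (simp only: abs_of_nonneg zero_le_power2)
  have w\<gamma>: "loc_int (\<lambda>x. 2 * w x * \<gamma> x)" by (rule loc_int_mult_L2[OF w2 \<gamma>2]) measurable
  have fwc: "loc_int (\<lambda>x. f (u x) * (2 * w x * \<gamma> x))"
    by (rule loc_int_mult_bounded[OF w\<gamma> _ f(3)]) measurable
  have fw: "loc_int (\<lambda>x. f (u x) * (w x)\<^sup>2)"
    by (rule loc_int_mult_bounded[OF w2 _ f(3)]) measurable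
  have \<psi>'0: "norm x > R \<Longrightarrow> \<psi>' x = 0" for x by (rule line_test_derivative_support[OF \<psi>])
  have \<psi>int: "integrable lborel (\<lambda>x. h x * \<psi> x)" "integrable lborel (\<lambda>x. h x * \<psi>' x)" if "loc_int h" for h
    by (rule loc_int_mult_integrable[OF that _ \<psi>D(2,3)], measurable)
       (rule loc_int_mult_integrable[OF that _ \<psi>D(5) \<psi>'0], measurable)
  have "(\<lambda>j. LBINT x. f (u x) * sq_trunc (?k j) (w x) * \<psi>' x) \<longlonglongrightarrow> (LBINT x. f (u x) * (w x)\<^sup>2 * \<psi>' x)"
  proof (rule integral_dominated_convergence[where w = "\<lambda>x. \<bar>f (u x) * (w x)\<^sup>2 * \<psi>' x\<bar>"])
    show "integrable lborel (\<lambda>x. \<bar>f (u x) * (w x)\<^sup>2 * \<psi>' x\<bar>)" by (intro integrable_abs \<psi>int fw)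
    show "AE x in lborel. (\<lambda>j. f (u x) * sq_trunc (?k j) (w x) * \<psi>' x) \<longlonglongrightarrow> f (u x) * (w x)\<^sup>2 * \<psi>' x"
      by (intro AE_I2 tendsto_mult tendsto_const sq_trunc_tendsto)
    show "AE x in lborel. norm (f (u x) * sq_trunc (?k j) (w x) * \<psi>' x) \<le> \<bar>f (u x) * (w x)\<^sup>2 * \<psi>' x\<bar>" for j
      unfolding real_norm_def abs_mult
      by (intro AE_I2 mult_right_mono mult_left_mono bd_abs abs_ge_zero)
  qed measurable
  moreover have "(\<lambda>j. LBINT x. \<psi> x * (sq_trunc (?k j) (w x) * f' (u x) * g x + f (u x) * sq_trunc' (?k j) (w x) * \<gamma> x))
     \<longlonglongrightarrow> (LBINT x. \<psi> x * ((w x)\<^sup>2 * (f' (u x) * g x) + f (u x) * (2 * w x * \<gamma> x)))"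
  proof (rule integral_dominated_convergence[where
      w = "\<lambda>x. \<bar>(w x)\<^sup>2 * (f' (u x) * g x) * \<psi> x\<bar> + \<bar>f (u x) * (2 * w x * \<gamma> x) * \<psi> x\<bar>"])
    show "integrable lborel (\<lambda>x. \<bar>(w x)\<^sup>2 * (f' (u x) * g x) * \<psi> x\<bar> + \<bar>f (u x) * (2 * w x * \<gamma> x) * \<psi> x\<bar>)"
      by (intro Bochner_Integration.integrable_add integrable_abs \<psi>int wg fwc)
    show "AE x in lborel. (\<lambda>j. \<psi> x * (sq_trunc (?k j) (w x) * f' (u x) * g x + f (u x) * sq_trunc' (?k j) (w x) * \<gamma> x))
       \<longlonglongrightarrow> \<psi> x * ((w x)\<^sup>2 * (f' (u x) * g x) + f (u x) * (2 * w x * \<gamma> x))"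
      unfolding mult.assoc[of _ "f' _"] mult.assoc[of "f _"]
      by (intro AE_I2 tendsto_mult tendsto_add tendsto_const sq_trunc_tendsto sq_trunc'_tendsto)
    show "AE x in lborel. norm (\<psi> x * (sq_trunc (?k j) (w x) * f' (u x) * g x + f (u x) * sq_trunc' (?k j) (w x) * \<gamma> x))
       \<le> \<bar>(w x)\<^sup>2 * (f' (u x) * g x) * \<psi> x\<bar> + \<bar>f (u x) * (2 * w x * \<gamma> x) * \<psi> x\<bar>" for j
    proof (rule AE_I2)
      fix x
      have "\<bar>sq_trunc (?k j) (w x) * f' (u x) * g x\<bar> \<le> \<bar>(w x)\<^sup>2 * (f' (u x) * g x)\<bar>"
        unfolding abs_mult mult.assoc by (intro mult_right_mono bd_abs mult_nonneg_nonneg abs_ge_zero)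
      moreover have "\<bar>f (u x) * sq_trunc' (?k j) (w x) * \<gamma> x\<bar> \<le> \<bar>f (u x) * (2 * w x * \<gamma> x)\<bar>"
        unfolding abs_mult mult.assoc[of "\<bar>f _\<bar>"] using bd(4)[of j "w x"] by (intro mult_left_mono mult_right_mono) (auto simp del: of_nat_Suc)
      ultimately have "\<bar>sq_trunc (?k j) (w x) * f' (u x) * g x + f (u x) * sq_trunc' (?k j) (w x) * \<gamma> x\<bar>
          \<le> \<bar>(w x)\<^sup>2 * (f' (u x) * g x)\<bar> + \<bar>f (u x) * (2 * w x * \<gamma> x)\<bar>"
        by linarith
      from mult_right_mono[OF this abs_ge_zero[of "\<psi> x"]]
      show "norm (\<psi> x * (sq_trunc (?k j) (w x) * f' (u x) * g x + f (u x) * sq_trunc' (?k j) (w x) * \<gamma> x))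
       \<le> \<bar>(w x)\<^sup>2 * (f' (u x) * g x) * \<psi> x\<bar> + \<bar>f (u x) * (2 * w x * \<gamma> x) * \<psi> x\<bar>"
        by (simp only: real_norm_def abs_mult[of "\<psi> x"] abs_mult[of _ "\<psi> x"] distrib_right mult.commute[of "\<bar>\<psi> x\<bar>"])
    qed
  qed measurable
  moreover have "(LBINT x. f (u x) * sq_trunc (?k j) (w x) * \<psi>' x)
      = - (LBINT x. \<psi> x * (sq_trunc (?k j) (w x) * f' (u x) * g x + f (u x) * sq_trunc' (?k j) (w x) * \<gamma> x))" for j
  proof (rule weak_partial_product_chain[OF u w b f _ _ _ _ \<psi>])
    let ?M = "max (4 * (?k j)\<^sup>2) (4 * ?k j)"
    show "(sq_trunc (?k j) has_real_derivative sq_trunc' (?k j) s) (at s)" for s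
      by (rule sq_trunc_has_derivative) simp
    show "continuous_on UNIV (sq_trunc' (?k j))" by (rule continuous_on_sq_trunc) simp
    show "\<bar>sq_trunc (?k j) s\<bar> \<le> ?M" "\<bar>sq_trunc' (?k j) s\<bar> \<le> ?M" for s
      using sq_trunc_bounds[of "?k j" s] by (auto simp: le_max_iff_disj)
  qed
  ultimately show ?thesis
    using LIMSEQ_unique[OF _ tendsto_minus] by simp
qed

lemma Cc_infinity_line_test:
  assumes "\<psi> \<in> Cc_infinity" "b \<in> Basis"
  obtains c R where "line_test b \<psi> (\<lambda>x. frechet_derivative \<psi> (at x) b) c R"
proof -
  obtain c R where cR: "\<And>x. \<bar>\<psi> x\<bar> \<le> c" "\<And>x. \<bar>frechet_derivative \<psi> (at x) b\<bar> \<le> c"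
    "\<And>x. norm x > R \<Longrightarrow> \<psi> x = 0" "\<And>x. norm x > R \<Longrightarrow> frechet_derivative \<psi> (at x) b = 0"
    using Cc_infinity_bounds[OF assms] by blast
  have "\<psi> \<in> borel_measurable borel"
    by (rule borel_measurable_continuous_onI[OF Cc_infinity_continuous(1)[OF assms(1)]])
  moreover have "((\<lambda>s. \<psi> (x + s *\<^sub>R b)) has_real_derivative frechet_derivative \<psi> (at x) b) (at 0)" for x
    using has_derivative_line[OF Cc_infinity_continuous(2)[OF assms(1)], of x b 0] by simp
  ultimately have "line_test b \<psi> (\<lambda>x. frechet_derivative \<psi> (at x) b) c R"
    using cR by (simp add: line_test_def)
  then show thesis by (rule that)
qed

lemma has_weak_partial_square:
  fixes w :: "'a::euclidean_space \<Rightarrow> real"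
  assumes w: "has_weak_partial w \<gamma> b" and b: "b \<in> Basis"
    and w2: "loc_int (\<lambda>x. (w x)\<^sup>2)" and \<gamma>2: "loc_int (\<lambda>x. (\<gamma> x)\<^sup>2)"
  shows "has_weak_partial (\<lambda>x. (w x)\<^sup>2) (\<lambda>x. 2 * w x * \<gamma> x) b"
  unfolding has_weak_partial_def
proof (intro conjI ballI)
  have [measurable]: "w \<in> borel_measurable borel" "\<gamma> \<in> borel_measurable borel"
    using w by (auto simp: has_weak_partial_def loc_int_def)
  show "loc_int (\<lambda>x. (w x)\<^sup>2)" by fact
  show "loc_int (\<lambda>x. 2 * w x * \<gamma> x)" by (rule loc_int_mult_L2[OF w2 \<gamma>2]) measurable
  fix \<psi> :: "'a \<Rightarrow> real" assume "\<psi> \<in> Cc_infinity"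
  then obtain c R where \<psi>: "line_test b \<psi> (\<lambda>x. frechet_derivative \<psi> (at x) b) c R"
    using Cc_infinity_line_test[OF _ b] by blast
  \<comment> \<open>The constant 1 is taken for f, and w itself fills the slot of u.\<close>
  have "loc_int (\<lambda>x. (w x)\<^sup>2 * (0 * \<gamma> x))" by (simp add: loc_int_def)
  then have "(LBINT x. 1 * (w x)\<^sup>2 * frechet_derivative \<psi> (at x) b) =
    - (LBINT x. \<psi> x * ((w x)\<^sup>2 * (0 * \<gamma> x) + 1 * (2 * w x * \<gamma> x)))"
    by (intro weighted_weak_partial_chain[OF w w b _ _ _ _ w2 \<gamma>2 _ \<psi>, where f = "\<lambda>_. 1" and f' = "\<lambda>_. 0" and L = 1]) auto
  then show "(LBINT x. (w x)\<^sup>2 * frechet_derivative \<psi> (at x) b) = - (LBINT x. 2 * w x * \<gamma> x * \<psi> x)"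
    by (simp add: mult_ac)
qed

lemma has_weak_partial_unique:
  assumes g: "has_weak_partial u g b" and h: "has_weak_partial u h b"
  shows "AE x in lborel. g x = h x"
proof -
  have li: "loc_int g" "loc_int h" using g h by (auto simp: has_weak_partial_def)
  have "AE x in lborel. g x - h x = 0"
  proof (rule fundamental_lemma_variations)
    show "loc_int (\<lambda>x. g x - h x)" by (intro loc_int_diff li)
    fix \<psi> :: "'a \<Rightarrow> real" assume \<psi>: "\<psi> \<in> Cc_infinity"
    have "(LBINT x. g x * \<psi> x) = (LBINT x. h x * \<psi> x)"
    proof -
      have "- (LBINT x. g x * \<psi> x) = - (LBINT x. h x * \<psi> x)"
        using bspec[OF conjunct2[OF conjunct2[OF g[unfolded has_weak_partial_def]]] \<psi>]
          bspec[OF conjunct2[OF conjunct2[OF h[unfolded has_weak_partial_def]]] \<psi>] by (rule trans[OF sym])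
      then show ?thesis by simp
    qed
    then show "(LBINT x. (g x - h x) * \<psi> x) = 0"
      using loc_int_test_integrable[OF li(1) \<psi>] loc_int_test_integrable[OF li(2) \<psi>]
      by (simp add: left_diff_distrib)
  qed
  then show ?thesis by eventually_elim simp
qed

section \<open>Borel representatives of Lebesgue measurable functions\<close>

lemma lebesgue_borel_representative:
  fixes f :: "'a::euclidean_space \<Rightarrow> 'b::euclidean_space"
  assumes "f \<in> borel_measurable lebesgue"
  obtains f' where "f' \<in> borel_measurable borel" "AE x in lborel. f x = f' x"
proof -
  have "\<forall>b\<in>Basis. \<exists>h. h \<in> borel_measurable lborel \<and> (AE x in lborel. f x \<bullet> b = h x)"
  proof
    fix b :: 'b assume b: "b \<in> Basis"
    have "(\<lambda>x. f x \<bullet> b) \<in> borel_measurable lebesgue"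
      by (intro borel_measurable_inner assms borel_measurable_const)
    from completion_ex_borel_measurable_real[OF this]
    show "\<exists>h. h \<in> borel_measurable lborel \<and> (AE x in lborel. f x \<bullet> b = h x)" by (simp only: Bex_def)
  qed
  from bchoice[OF this] obtain h where
    h: "\<And>b. b \<in> Basis \<Longrightarrow> h b \<in> borel_measurable borel" "\<And>b. b \<in> Basis \<Longrightarrow> AE x in lborel. f x \<bullet> b = h b x"
    by auto
  show thesis
  proof
    show "(\<lambda>x. \<Sum>b\<in>Basis. h b x *\<^sub>R b) \<in> borel_measurable borel"
      using h(1) by (intro borel_measurable_sum borel_measurable_scaleR borel_measurable_const) auto
    have "AE x in lborel. \<forall>b\<in>Basis. f x \<bullet> b = h b x"
      using h(2) by (intro AE_finite_allI) auto
    then show "AE x in lborel. f x = (\<Sum>b\<in>Basis. h b x *\<^sub>R b)"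
    proof eventually_elim
      case (elim x)
      then have "(\<Sum>b\<in>Basis. h b x *\<^sub>R b) = (\<Sum>b\<in>Basis. (f x \<bullet> b) *\<^sub>R b)" by (intro sum.cong) auto
      then show ?case by (simp add: euclidean_representation)
    qed
  qed
qed

lemma locally_integrable_measurable:
  fixes f :: "'a::euclidean_space \<Rightarrow> 'b::euclidean_space"
  assumes "locally_integrable f"
  shows "f \<in> borel_measurable lebesgue"
proof (rule borel_measurable_LIMSEQ_metric)
  show "(\<lambda>x. indicator (cball 0 (real n)) x *\<^sub>R f x) \<in> borel_measurable lebesgue" for n
    using assms by (intro borel_measurable_integrable) (simp add: locally_integrable_def set_integrable_def)
  fix x :: 'a
  obtain n0 where n0: "norm x \<le> real n0" using real_arch_simple by blast
  have "\<forall>\<^sub>F n in sequentially. indicator (cball 0 (real n)) x *\<^sub>R f x = f x"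
    using eventually_ge_at_top[of n0]
  proof eventually_elim
    case (elim n)
    then have "norm x \<le> real n" using n0 by linarith
    then show ?case by simp
  qed
  then show "(\<lambda>n. indicator (cball 0 (real n)) x *\<^sub>R f x) \<longlonglongrightarrow> f x" by (rule tendsto_eventually)
qed

lemma integrable_lebesgue_iff_lborel:
  fixes f f' :: "'a::euclidean_space \<Rightarrow> real"
  assumes "f \<in> borel_measurable lebesgue" "f' \<in> borel_measurable borel" "AE x in lborel. f x = f' x"
  shows "integrable lebesgue f \<longleftrightarrow> integrable lborel f'"
    and "integral\<^sup>L lebesgue f = integral\<^sup>L lborel f'"
proof -
  have f': "f' \<in> borel_measurable lborel" using assms(2) by simp
  then have f'l: "f' \<in> borel_measurable lebesgue" by (rule measurable_completion)
  have "integrable lebesgue f \<longleftrightarrow> integrable lebesgue f'"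
    using assms f'l by (intro integrable_cong_AE) (auto simp: AE_completion_iff)
  then show "integrable lebesgue f \<longleftrightarrow> integrable lborel f'"
    using integrable_completion[OF f'] by simp
  have "integral\<^sup>L lebesgue f = integral\<^sup>L lebesgue f'"
    using assms f'l by (intro integral_cong_AE) (auto simp: AE_completion_iff)
  then show "integral\<^sup>L lebesgue f = integral\<^sup>L lborel f'"
    using integral_completion[OF f'] by simp
qed

lemma locally_integrable_imp_loc_int:
  fixes f f' :: "'a::euclidean_space \<Rightarrow> real"
  assumes f: "locally_integrable f" and f': "f' \<in> borel_measurable borel" "AE x in lborel. f x = f' x"
  shows "loc_int f'"
  unfolding loc_int_def
proof (intro conjI allI f')
  fix R
  have i: "integrable lebesgue (\<lambda>x. indicator (cball 0 R) x * f x)"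
    using f by (simp add: locally_integrable_def set_integrable_def)
  moreover have "(\<lambda>x. indicator (cball 0 R) x * f' x) \<in> borel_measurable borel" using f'(1) by measurable
  moreover have "AE x in lborel. indicator (cball 0 R) x * f x = indicator (cball 0 R) x * f' x"
    using f'(2) by eventually_elim simp
  ultimately show "integrable lborel (\<lambda>x. indicator (cball 0 R) x * f' x)"
    using integrable_lebesgue_iff_lborel(1) borel_measurable_integrable by blast
qed

lemma loc_int_imp_locally_integrable:
  fixes f f' :: "'a::euclidean_space \<Rightarrow> real"
  assumes f': "loc_int f'" and f: "f \<in> borel_measurable lebesgue" "AE x in lborel. f x = f' x"
  shows "locally_integrable f"
  unfolding locally_integrable_def
proof (intro allI impI)
  fix S :: "'a set" assume S: "compact S"
  have Sb: "S \<in> sets borel" "S \<in> sets lebesgue" using S by (auto simp: compact_imp_closed)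
  have [measurable]: "f' \<in> borel_measurable borel" by (rule loc_int_measurable[OF f'])
  have "integrable lborel (\<lambda>x. f' x * indicator S x)"
    by (rule loc_int_indicator_integrable[OF f' compact_imp_bounded[OF S] Sb(1)])
  moreover have "(\<lambda>x. f x * indicator S x) \<in> borel_measurable lebesgue" using f(1) Sb(2) by measurable
  moreover have "(\<lambda>x. f' x * indicator S x) \<in> borel_measurable borel" using Sb(1) by measurable
  moreover have "AE x in lborel. f x * indicator S x = f' x * indicator S x"
    using f(2) by eventually_elim simp
  ultimately have "integrable lebesgue (\<lambda>x. f x * indicator S x)"
    using integrable_lebesgue_iff_lborel(1) by blast
  then show "f absolutely_integrable_on S" by (simp add: set_integrable_def mult.commute)
qed

text \<open>Passing to almost everywhere equal Borel functions changes neither local integrability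
  nor the test integrals, so results on \<open>lborel\<close> can be read off and fed back through
  this equivalence.\<close>

lemma has_weak_gradient_iff_partials:
  fixes f f' :: "'a::euclidean_space \<Rightarrow> real" and g g' :: "'a \<Rightarrow> 'a"
  assumes f: "f \<in> borel_measurable lebesgue" "f' \<in> borel_measurable borel" "AE x in lborel. f x = f' x"
    and g: "g \<in> borel_measurable lebesgue" "g' \<in> borel_measurable borel" "AE x in lborel. g x = g' x"
  shows "has_weak_gradient f g \<longleftrightarrow> (\<forall>b\<in>Basis. has_weak_partial f' (\<lambda>x. g' x \<bullet> b) b)"
proof -
  have f_iff: "locally_integrable f \<longleftrightarrow> loc_int f'"
    using locally_integrable_imp_loc_int[OF _ f(2,3)] loc_int_imp_locally_integrable[OF _ f(1,3)] by blast
  have gb: "(\<lambda>x. g x \<bullet> b) \<in> borel_measurable lebesgue" "(\<lambda>x. g' x \<bullet> b) \<in> borel_measurable borel"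
    "AE x in lborel. g x \<bullet> b = g' x \<bullet> b" for b
    using g by (auto elim: eventually_mono)
  have "locally_integrable g \<longleftrightarrow> (\<forall>b\<in>Basis. locally_integrable (\<lambda>x. g x \<bullet> b))"
    unfolding locally_integrable_def by (subst absolutely_integrable_componentwise_iff) blast
  moreover have "locally_integrable (\<lambda>x. g x \<bullet> b) \<longleftrightarrow> loc_int (\<lambda>x. g' x \<bullet> b)" for b
    using locally_integrable_imp_loc_int[OF _ gb(2,3)] loc_int_imp_locally_integrable[OF _ gb(1,3)] by blast
  ultimately have g_iff: "locally_integrable g \<longleftrightarrow> (\<forall>b\<in>Basis. loc_int (\<lambda>x. g' x \<bullet> b))" by simp
  have eq: "(LINT x|lebesgue. f x * frechet_derivative \<psi> (at x) b) = (LBINT x. f' x * frechet_derivative \<psi> (at x) b)"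
    "(LINT x|lebesgue. (g x \<bullet> b) * \<psi> x) = (LBINT x. (g' x \<bullet> b) * \<psi> x)"
    if \<psi>: "\<psi> \<in> Cc_infinity" and b: "b \<in> Basis" for \<psi> b
  proof -
    have m: "\<psi> \<in> borel_measurable borel" "(\<lambda>x. frechet_derivative \<psi> (at x) b) \<in> borel_measurable borel"
      by (intro borel_measurable_continuous_onI Cc_infinity_continuous \<psi> b)+
    then have ml: "\<psi> \<in> borel_measurable lebesgue" "(\<lambda>x. frechet_derivative \<psi> (at x) b) \<in> borel_measurable lebesgue"
      using measurable_completion[of _ lborel borel] by auto
    show "(LINT x|lebesgue. f x * frechet_derivative \<psi> (at x) b) = (LBINT x. f' x * frechet_derivative \<psi> (at x) b)"
      by (rule integrable_lebesgue_iff_lborel(2)) (use f m ml in \<open>auto elim: eventually_mono\<close>)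
    show "(LINT x|lebesgue. (g x \<bullet> b) * \<psi> x) = (LBINT x. (g' x \<bullet> b) * \<psi> x)"
      by (rule integrable_lebesgue_iff_lborel(2)) (use gb[of b] m ml in \<open>auto elim: eventually_mono\<close>)
  qed
  show ?thesis
    unfolding has_weak_gradient_def has_weak_partial_def f_iff g_iff
    \<comment> \<open>Local integrability of f stands outside the quantifier over b on the left but
      inside it on the right, so some b must exist.\<close>
    using eq nonempty_Basis by (auto simp: ball_conj_distrib)
qed

section \<open>The multipolar vector field and its cutoffs\<close>

definition inv_sq_sum :: "nat \<Rightarrow> (nat \<Rightarrow> 'a::euclidean_space) \<Rightarrow> 'a \<Rightarrow> real" where
  "inv_sq_sum n a x = (\<Sum>i=1..n. 1 / (norm (x - a i))\<^sup>2)"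

definition pole_field :: "nat \<Rightarrow> (nat \<Rightarrow> 'a::euclidean_space) \<Rightarrow> 'a \<Rightarrow> 'a" where
  "pole_field n a x = (\<Sum>i=1..n. (1 / (norm (x - a i))\<^sup>2) *\<^sub>R (x - a i))"

definition pole_prod :: "nat \<Rightarrow> (nat \<Rightarrow> 'a::euclidean_space) \<Rightarrow> 'a \<Rightarrow> real" where
  "pole_prod n a x = (\<Prod>i=1..n. (norm (x - a i))\<^sup>2)"

lemma inner_via_norms: "x \<bullet> y = ((norm x)\<^sup>2 + (norm y)\<^sup>2 - (norm (x - y))\<^sup>2) / (2::real)"
  by (simp add: power2_norm_eq_inner inner_diff inner_commute algebra_simps)

text \<open>Polarisation: with r_i = |x - a_i|^2, the product (x - a_i) . (x - a_j) is (r_i + r_j -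
  |a_i - a_j|^2) / 2. After division by r_i r_j the first two terms sum to n S and the last to
  V.\<close>

lemma norm_pole_field_sq:
  assumes x: "x \<notin> a ` {1..n}"
  shows "(norm (pole_field n a x))\<^sup>2 = real n * inv_sq_sum n a x - multipole_V n a x"
proof -
  let ?r = "\<lambda>i. (norm (x - a i))\<^sup>2"
  have r: "?r i \<noteq> 0" if "i \<in> {1..n}" for i using x that by auto
  let ?T = "\<lambda>i j. (norm (a i - a j))\<^sup>2 / (?r i * ?r j)"
  have term_eq: "((1 / ?r i) *\<^sub>R (x - a i)) \<bullet> ((1 / ?r j) *\<^sub>R (x - a j)) = 1 / 2 * (1 / ?r j + 1 / ?r i - ?T i j)"
    if "i \<in> {1..n}" "j \<in> {1..n}" for i j
  proof -
    have "(x - a i) \<bullet> (x - a j) = (?r i + ?r j - (norm (a i - a j))\<^sup>2) / 2"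
      using inner_via_norms[of "x - a i" "x - a j"] by (simp add: norm_minus_commute)
    then show ?thesis using r[OF that(1)] r[OF that(2)]
      by (simp add: divide_simps)
  qed
  have "(norm (pole_field n a x))\<^sup>2 = (\<Sum>i=1..n. \<Sum>j=1..n. ((1 / ?r i) *\<^sub>R (x - a i)) \<bullet> ((1 / ?r j) *\<^sub>R (x - a j)))"
    unfolding power2_norm_eq_inner pole_field_def inner_sum_left inner_sum_right by (rule sum.swap)
  also have "\<dots> = (\<Sum>i=1..n. \<Sum>j=1..n. 1 / 2 * (1 / ?r j + 1 / ?r i - ?T i j))"
    by (intro sum.cong refl term_eq)
  also have "\<dots> = 1 / 2 * (\<Sum>i=1..n. \<Sum>j=1..n. 1 / ?r j) + 1 / 2 * (\<Sum>i=1..n. \<Sum>j=1..n. 1 / ?r i)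
      - 1 / 2 * (\<Sum>i=1..n. \<Sum>j=1..n. ?T i j)"
    by (simp add: sum.distrib sum_subtractf sum_distrib_left distrib_left right_diff_distrib)
  \<comment> \<open>The diagonal terms contain |a_i - a_i|^2 = 0 and may be dropped.\<close>
  also have "(\<Sum>i=1..n. \<Sum>j=1..n. ?T i j) = (\<Sum>i=1..n. \<Sum>j\<in>{1..n} - {i}. ?T i j)"
    by (intro sum.cong refl sum.mono_neutral_right) auto
  also have "(\<Sum>i=1..n. \<Sum>j=1..n. 1 / ?r j) = real n * inv_sq_sum n a x"
    by (simp add: inv_sq_sum_def)
  also have "(\<Sum>i=1..n. \<Sum>j=1..n. 1 / ?r i) = real n * inv_sq_sum n a x"
    by (simp add: inv_sq_sum_def sum_distrib_left)
  finally show ?thesis by (simp add: multipole_V_def)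
qed

lemma norm_sq_line_has_derivative:
  fixes x c b :: "'a::real_inner"
  shows "((\<lambda>s. (norm (x + s *\<^sub>R b - c))\<^sup>2) has_real_derivative 2 * ((x - c) \<bullet> b)) (at 0)"
  unfolding power2_norm_eq_inner
  by (auto intro!: derivative_eq_intros simp: has_field_derivative_def inner_commute algebra_simps fun_eq_iff)

text \<open>Logarithmic differentiation: each factor adds 2 (x - a_i) / |x - a_i|^2 to the gradient
  of log P, that is, \<nabla>P = 2 P E.\<close>

lemma pole_prod_line_has_derivative:
  assumes x: "x \<notin> a ` {1..n}"
  shows "((\<lambda>s. pole_prod n a (x + s *\<^sub>R b)) has_real_derivative 2 * pole_prod n a x * (pole_field n a x \<bullet> b)) (at 0)"
proof -
  have "((\<lambda>s. \<Prod>i=1..n. (norm (x + s *\<^sub>R b - a i))\<^sup>2) has_real_derivative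
     (\<Prod>i=1..n. (norm (x + 0 *\<^sub>R b - a i))\<^sup>2) * (\<Sum>i=1..n. 2 * ((x - a i) \<bullet> b) / (norm (x + 0 *\<^sub>R b - a i))\<^sup>2)) (at 0)"
    by (rule has_field_derivative_prod') (use x in \<open>auto intro: norm_sq_line_has_derivative\<close>)
  moreover have "(\<Sum>i=1..n. 2 * ((x - a i) \<bullet> b) / (norm (x - a i))\<^sup>2) = 2 * (pole_field n a x \<bullet> b)"
    by (simp add: pole_field_def inner_sum_left sum_distrib_left)
  ultimately show ?thesis by (simp add: pole_prod_def mult_ac)
qed

text \<open>The diagonal entry of the Jacobian of the field in direction b; its sum over the basis
  is the divergence.\<close>

definition pole_field_deriv :: "nat \<Rightarrow> (nat \<Rightarrow> 'a::euclidean_space) \<Rightarrow> 'a \<Rightarrow> 'a \<Rightarrow> real" where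
  "pole_field_deriv n a b x = (\<Sum>i=1..n. 1 / (norm (x - a i))\<^sup>2 - 2 * ((x - a i) \<bullet> b)\<^sup>2 / ((norm (x - a i))\<^sup>2)\<^sup>2)"

lemma pole_field_line_has_derivative:
  assumes x: "x \<notin> a ` {1..n}" and b: "b \<in> Basis"
  shows "((\<lambda>s. pole_field n a (x + s *\<^sub>R b) \<bullet> b) has_real_derivative pole_field_deriv n a b x) (at 0)"
proof -
  have "((\<lambda>s. ((x + s *\<^sub>R b - a i) \<bullet> b) / (norm (x + s *\<^sub>R b - a i))\<^sup>2) has_real_derivative
     1 / (norm (x - a i))\<^sup>2 - 2 * ((x - a i) \<bullet> b)\<^sup>2 / ((norm (x - a i))\<^sup>2)\<^sup>2) (at 0)" if i: "i \<in> {1..n}" for i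
  proof -
    have r: "(norm (x - a i))\<^sup>2 \<noteq> 0" using x i by auto
    have lin: "((\<lambda>s. (x + s *\<^sub>R b - a i) \<bullet> b) has_real_derivative 1) (at 0)"
      using b by (auto intro!: derivative_eq_intros simp: has_field_derivative_def fun_eq_iff)
    have "((\<lambda>s. ((x + s *\<^sub>R b - a i) \<bullet> b) / (norm (x + s *\<^sub>R b - a i))\<^sup>2) has_real_derivative
      (1 * (norm (x + 0 *\<^sub>R b - a i))\<^sup>2 - ((x + 0 *\<^sub>R b - a i) \<bullet> b) * (2 * ((x - a i) \<bullet> b)))
       / ((norm (x + 0 *\<^sub>R b - a i))\<^sup>2 * (norm (x + 0 *\<^sub>R b - a i))\<^sup>2)) (at 0)"
      by (rule DERIV_divide[OF lin norm_sq_line_has_derivative]) (use r in simp)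
    moreover have "(1 * y - c * (2 * c)) / (y * y) = 1 / y - 2 * c\<^sup>2 / y\<^sup>2" if "y \<noteq> 0" for y c :: real
      using that by (simp add: field_simps power2_eq_square)
    ultimately show ?thesis by (simp only: scaleR_zero_left add_0_right r not_False_eq_True)
  qed
  then have "((\<lambda>s. \<Sum>i=1..n. ((x + s *\<^sub>R b - a i) \<bullet> b) / (norm (x + s *\<^sub>R b - a i))\<^sup>2) has_real_derivative
      pole_field_deriv n a b x) (at 0)"
    unfolding pole_field_deriv_def by (rule DERIV_sum)
  then show ?thesis by (simp add: pole_field_def inner_sum_left)
qed

text \<open>With r = |x - a_i|^2 each pole contributes N/r - 2 r/r^2.\<close>

lemma pole_field_divergence:
  fixes x :: "'a::euclidean_space"
  assumes x: "x \<notin> a ` {1..n}"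
  shows "(\<Sum>b\<in>Basis. pole_field_deriv n a b x) = (real DIM('a) - 2) * inv_sq_sum n a x"
proof -
  have "(\<Sum>b\<in>Basis. pole_field_deriv n a b x)
     = (\<Sum>i=1..n. \<Sum>b\<in>Basis. 1 / (norm (x - a i))\<^sup>2 - 2 * ((x - a i) \<bullet> b)\<^sup>2 / ((norm (x - a i))\<^sup>2)\<^sup>2)"
    unfolding pole_field_deriv_def by (rule sum.swap)
  also have "\<dots> = (\<Sum>i=1..n. (real DIM('a) - 2) * (1 / (norm (x - a i))\<^sup>2))"
  proof (intro sum.cong refl)
    fix i assume i: "i \<in> {1..n}"
    let ?r = "(norm (x - a i))\<^sup>2"
    have r: "?r \<noteq> 0" using x i by auto
    have n: "(\<Sum>b\<in>Basis. ((x - a i) \<bullet> b)\<^sup>2) = ?r"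
      unfolding power2_norm_eq_inner euclidean_inner[of "x - a i" "x - a i"] by (simp add: power2_eq_square)
    have "(\<Sum>b\<in>Basis. 1 / ?r - 2 * ((x - a i) \<bullet> b)\<^sup>2 / ?r\<^sup>2) = real DIM('a) * (1 / ?r) - 2 * (\<Sum>b\<in>Basis. ((x - a i) \<bullet> b)\<^sup>2) / ?r\<^sup>2"
      by (simp add: sum_subtractf sum_distrib_left sum_divide_distrib)
    also have "\<dots> = (real DIM('a) - 2) * (1 / ?r)"
      unfolding n using r by (simp add: field_simps power2_eq_square)
    finally show "(\<Sum>b\<in>Basis. 1 / ?r - 2 * ((x - a i) \<bullet> b)\<^sup>2 / ?r\<^sup>2) = (real DIM('a) - 2) * (1 / ?r)" .
  qed
  finally show ?thesis by (simp add: inv_sq_sum_def sum_distrib_left)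
qed

section \<open>Cutoffs as functions of the pole product\<close>

definition pos_sq :: "real \<Rightarrow> real" where "pos_sq t = (max 0 t)\<^sup>2"

lemma pos_sq_has_derivative: "(pos_sq has_real_derivative 2 * max 0 t) (at t)"
proof -
  consider "t < 0" | "t > 0" | "t = 0" by linarith
  then show ?thesis
  proof cases
    case 1
    have "\<forall>\<^sub>F x in nhds t. pos_sq x = 0"
      using eventually_nhds_in_open[of "{..<0}" t] 1 by (auto simp: pos_sq_def elim!: eventually_mono)
    then show ?thesis
      using 1 by (subst DERIV_cong_ev[OF refl _ refl, of _ "\<lambda>_. 0"]) auto
  next
    case 2
    have "\<forall>\<^sub>F x in nhds t. pos_sq x = x\<^sup>2"
      using eventually_nhds_in_open[of "{0<..}" t] 2 by (auto simp: pos_sq_def elim!: eventually_mono)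
    then show ?thesis
      using 2 by (subst DERIV_cong_ev[OF refl _ refl, of _ "\<lambda>x. x\<^sup>2"]) (auto intro!: derivative_eq_intros)
  next
    case 3
    have "((\<lambda>y. pos_sq y / y) \<longlongrightarrow> 0) (at 0)"
    proof (rule Lim_null_comparison)
      show "\<forall>\<^sub>F y in at 0. norm (pos_sq y / y) \<le> \<bar>y\<bar>"
        by (auto simp: eventually_at_filter pos_sq_def max_def power2_eq_square)
      show "((\<lambda>y. \<bar>y\<bar>) \<longlongrightarrow> 0) (at (0::real))" by (rule tendsto_rabs_zero) (rule tendsto_ident_at)
    qed
    then show ?thesis using 3 by (simp add: has_field_derivative_iff pos_sq_def)
  qed
qed

text \<open>A \<open>C\<^sup>1\<close> step: equal to 1 on \<open>(-\<infinity>, 1]\<close>, decreasing on \<open>[1, 2]\<close>, equal to 0 on \<open>[2, \<infinity>)\<close>.\<close>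

definition step :: "real \<Rightarrow> real" where "step y = pos_sq (1 - pos_sq (y - 1))"

definition step' :: "real \<Rightarrow> real" where
  "step' y = - (2 * max 0 (1 - pos_sq (y - 1)) * (2 * max 0 (y - 1)))"

lemma step_has_derivative: "(step has_real_derivative step' y) (at y)"
proof -
  have "((\<lambda>y. y - 1) has_real_derivative 1) (at y)"
    by (auto intro!: derivative_eq_intros)
  then have "((\<lambda>y. pos_sq (y - 1)) has_real_derivative 2 * max 0 (y - 1) * 1) (at y)"
    by (rule DERIV_chain2[OF pos_sq_has_derivative])
  then have "((\<lambda>y. 1 - pos_sq (y - 1)) has_real_derivative 0 - 2 * max 0 (y - 1) * 1) (at y)"
    by (intro DERIV_diff DERIV_const)
  from DERIV_chain2[OF pos_sq_has_derivative this]
  show ?thesis by (simp add: step_def[abs_def] step'_def)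
qed

lemma step_facts:
  shows "0 \<le> step y" "step y \<le> 1" "y \<le> 1 \<Longrightarrow> step y = 1" "y \<ge> 2 \<Longrightarrow> step y = 0"
    "step' y \<le> 0" "y \<le> 1 \<Longrightarrow> step' y = 0" "y \<ge> 2 \<Longrightarrow> step' y = 0" "0 \<le> y \<Longrightarrow> - 8 \<le> step' y * y"
proof -
  have p: "0 \<le> pos_sq t" for t by (simp add: pos_sq_def)
  have p1: "1 \<le> pos_sq t" if "1 \<le> t" for t using that by (simp add: pos_sq_def)
  show "0 \<le> step y" by (simp add: step_def p)
  show "step y \<le> 1" using p[of "y - 1"] unfolding step_def pos_sq_def[of "1 - _"]
    by (intro power_le_one) auto
  show "y \<le> 1 \<Longrightarrow> step y = 1" by (simp add: step_def pos_sq_def)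
  show "y \<ge> 2 \<Longrightarrow> step y = 0" using p1[of "y - 1"] by (simp add: step_def pos_sq_def[of "1 - _"])
  show "step' y \<le> 0" by (simp add: step'_def)
  show "y \<le> 1 \<Longrightarrow> step' y = 0" by (simp add: step'_def)
  show z: "y \<ge> 2 \<Longrightarrow> step' y = 0" using p1[of "y - 1"] by (simp add: step'_def)
  \<comment> \<open>Up to y = 2 both maxima in \<open>step'\<close> are at most 1, so the product is
    at least -(2 * 2 * 2); beyond 2 it vanishes.\<close>
  show "- 8 \<le> step' y * y" if "0 \<le> y"
  proof (cases "y \<le> 2")
    case True
    have "max 0 (1 - pos_sq (y - 1)) * max 0 (y - 1) * y \<le> 1 * 1 * 2"
      using True that p[of "y - 1"] by (intro mult_mono) auto
    then show ?thesis by (simp add: step'_def mult_ac)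
  qed (simp add: z)
qed

lemma continuous_step': "continuous_on UNIV step'"
proof -
  have "continuous_on UNIV pos_sq" by (rule DERIV_continuous_on[OF pos_sq_has_derivative])
  then have "continuous_on UNIV (\<lambda>y. pos_sq (y - 1))"
    by (rule continuous_on_compose2) (auto intro: continuous_intros)
  then show ?thesis unfolding step'_def[abs_def]
    by (intro continuous_intros)
qed

text \<open>For 2 d <= R this rises on [d, 2 d], equals 1 up to R and falls on [R, 2 R]. Evaluated
  at P it excludes neighbourhoods of the poles and of infinity together.\<close>

definition plateau :: "real \<Rightarrow> real \<Rightarrow> real \<Rightarrow> real" where
  "plateau d R s = (1 - step (s / d)) * step (s / R)"

definition plateau' :: "real \<Rightarrow> real \<Rightarrow> real \<Rightarrow> real" where
  "plateau' d R s = - (step' (s / d) / d) * step (s / R) + (1 - step (s / d)) * (step' (s / R) / R)"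

lemma plateau_has_derivative: "(plateau d R has_real_derivative plateau' d R s) (at s)"
proof -
  have c: "((\<lambda>s. step (s / d)) has_real_derivative step' (s / d) / d) (at s)" for d
  proof -
    have "((\<lambda>s. s / d) has_real_derivative 1 / d) (at s)"
      by (rule DERIV_cdivide[OF DERIV_ident])
    from DERIV_chain2[OF step_has_derivative this] show ?thesis by simp
  qed
  have "((\<lambda>s. 1 - step (s / d)) has_real_derivative 0 - step' (s / d) / d) (at s)"
    by (intro DERIV_diff DERIV_const c)
  from DERIV_mult[OF this c[of R]] show ?thesis
    by (simp add: plateau_def[abs_def] plateau'_def algebra_simps)
qed

lemma continuous_plateau':
  assumes "d > 0" "R > 0" shows "continuous_on UNIV (plateau' d R)"
proof -
  have "continuous_on UNIV step" by (rule DERIV_continuous_on[OF step_has_derivative])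
  then have s: "continuous_on UNIV (\<lambda>s. step (s / c))" if "c > 0" for c
    by (rule continuous_on_compose2) (use that in \<open>auto intro!: continuous_intros\<close>)
  have s': "continuous_on UNIV (\<lambda>s. step' (s / c))" if "c > 0" for c
    by (rule continuous_on_compose2[OF continuous_step']) (use that in \<open>auto intro!: continuous_intros\<close>)
  show ?thesis unfolding plateau'_def[abs_def] using assms
    by (intro continuous_intros s s') auto
qed

text \<open>The bound -8 is independent of d and R: multiplying the derivative by s makes it
  invariant under scaling, the rising factor contributes a nonnegative amount, and the falling
  factor inherits the constant of \<open>step_facts\<close>. Up to R only the rising factor varies,
  hence the sign there.\<close>

lemma plateau_facts:
  assumes "d > 0" "R > 0"
  shows "0 \<le> plateau d R s" "plateau d R s \<le> 1" "s \<le> d \<Longrightarrow> plateau d R s = 0" "s \<le> d \<Longrightarrow> 0 \<le> s \<Longrightarrow> plateau' d R s = 0"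
    "s \<ge> 2 * R \<Longrightarrow> plateau d R s = 0" "s \<ge> 2 * R \<Longrightarrow> plateau' d R s = 0"
    "2 * d \<le> s \<Longrightarrow> s \<le> R \<Longrightarrow> plateau d R s = 1"
    "s \<le> R \<Longrightarrow> 0 \<le> plateau' d R s" "0 \<le> s \<Longrightarrow> - 8 \<le> plateau' d R s * s"
proof -
  note f = step_facts
  show "0 \<le> plateau d R s" "plateau d R s \<le> 1"
    unfolding plateau_def using f(1,2)[of "s / d"] f(1,2)[of "s / R"] by (auto intro: mult_le_one)
  show "s \<le> d \<Longrightarrow> plateau d R s = 0" using assms by (simp add: plateau_def f)
  show "s \<le> d \<Longrightarrow> 0 \<le> s \<Longrightarrow> plateau' d R s = 0" using assms by (simp add: plateau'_def f)
  have R2: "2 \<le> s / R" if "s \<ge> 2 * R" using assms that by (simp add: le_divide_eq)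
  show "s \<ge> 2 * R \<Longrightarrow> plateau d R s = 0" "s \<ge> 2 * R \<Longrightarrow> plateau' d R s = 0"
    using R2 by (simp_all add: plateau_def plateau'_def f)
  show "plateau d R s = 1" if "2 * d \<le> s" "s \<le> R"
  proof -
    have "2 \<le> s / d" "s / R \<le> 1" using assms that by (simp_all add: le_divide_eq)
    then show ?thesis by (simp add: plateau_def f)
  qed
  have pos: "0 \<le> - (step' (s / d) / d) * step (s / R)"
    using f(5)[of "s / d"] f(1)[of "s / R"] assms by (intro mult_nonneg_nonneg) (auto simp: divide_le_0_iff)
  show "0 \<le> plateau' d R s" if "s \<le> R"
  proof -
    have "s / R \<le> 1" using assms that by simp
    then show ?thesis using pos by (simp add: plateau'_def f)
  qed
  show "- 8 \<le> plateau' d R s * s" if s: "0 \<le> s"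
  proof -
    let ?c = "1 - step (s / d)"
    have c: "0 \<le> ?c" "?c \<le> 1" using f(1,2)[of "s / d"] by auto
    have "- 8 \<le> step' (s / R) * (s / R)" by (rule f(8)) (use s assms in simp)
    moreover have "step' (s / R) * (s / R) \<le> 0"
      by (rule mult_nonpos_nonneg[OF f(5)]) (use s assms in simp)
    ultimately have "- 8 \<le> ?c * (step' (s / R) * (s / R))"
      using mult_right_mono_neg[OF c(2), of "step' (s / R) * (s / R)"] by linarith
    moreover have "0 \<le> (- (step' (s / d) / d) * step (s / R)) * s" by (intro mult_nonneg_nonneg pos s)
    moreover have "plateau' d R s * s = (- (step' (s / d) / d) * step (s / R)) * s + ?c * (step' (s / R) * (s / R))"
      by (simp add: plateau'_def algebra_simps)
    ultimately show ?thesis by linarith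
  qed
qed

lemma continuous_pole_prod: "continuous_on S (pole_prod n a)"
  unfolding pole_prod_def[abs_def] by (intro continuous_intros)

lemma pole_prod_nonneg: "0 \<le> pole_prod n a x"
  unfolding pole_prod_def by (intro prod_nonneg) auto

lemma pole_prod_eq_0_iff: "pole_prod n a x = 0 \<longleftrightarrow> x \<in> a ` {1..n}"
  by (auto simp: pole_prod_def)

lemma far_from_poles:
  fixes a :: "nat \<Rightarrow> 'a::euclidean_space"
  assumes "norm x > (\<Sum>i=1..n. norm (a i)) + \<rho>" and i: "i \<in> {1..n}"
  shows "\<rho> < norm (x - a i)"
proof -
  have "norm (a i) \<le> (\<Sum>i=1..n. norm (a i))"
    by (rule member_le_sum[OF i]) auto
  then show ?thesis using assms(1) norm_triangle_sub[of x "a i"] by linarith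
qed

text \<open>A crude consequence of \<rho> <= \<rho>^(2 n), enough to see that P is large far away
  and hence that the cutoffs have bounded support.\<close>

lemma pole_prod_ge:
  assumes n: "n \<ge> 1" and \<rho>: "\<rho> \<ge> 1" and far: "\<And>i. i \<in> {1..n} \<Longrightarrow> \<rho> \<le> norm (x - a i)"
  shows "\<rho> \<le> pole_prod n a x"
proof -
  have "\<rho> \<le> (\<rho>\<^sup>2) ^ n"
  proof -
    have "\<rho> ^ 1 \<le> \<rho> ^ (2 * n)" using n by (intro power_increasing \<rho>) simp
    then show ?thesis by (simp add: power_mult)
  qed
  also have "(\<rho>\<^sup>2) ^ n = (\<Prod>i=1..n. \<rho>\<^sup>2)" by simp
  also have "\<dots> \<le> pole_prod n a x"
    unfolding pole_prod_def using \<rho> far by (intro prod_mono) (auto intro: power_mono)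
  finally show ?thesis .
qed

lemma norm_pole_field_le:
  assumes \<rho>: "\<rho> > 0" and far: "\<And>i. i \<in> {1..n} \<Longrightarrow> \<rho> \<le> norm (x - a i)"
  shows "norm (pole_field n a x) \<le> real n / \<rho>"
proof -
  have "norm (pole_field n a x) \<le> (\<Sum>i=1..n. norm ((1 / (norm (x - a i))\<^sup>2) *\<^sub>R (x - a i)))"
    unfolding pole_field_def by (rule norm_sum)
  also have "\<dots> \<le> (\<Sum>i=1..n. 1 / \<rho>)"
  proof (rule sum_mono)
    fix i assume i: "i \<in> {1..n}"
    have "norm ((1 / (norm (x - a i))\<^sup>2) *\<^sub>R (x - a i)) = 1 / norm (x - a i)"
      by (simp add: power2_eq_square)
    also have "\<dots> \<le> 1 / \<rho>" using far[OF i] \<rho> by (intro frac_le) auto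
    finally show "norm ((1 / (norm (x - a i))\<^sup>2) *\<^sub>R (x - a i)) \<le> 1 / \<rho>" .
  qed
  also have "\<dots> = real n / \<rho>" by simp
  finally show ?thesis .
qed

text \<open>P is bounded on every ball, so a large value forces x to be far from all poles, where E
  decays. The scale-free bound -8 on s h'(s) becomes a small error only through this factor
  |E|^2.\<close>

lemma pole_prod_large_imp_pole_field_small:
  assumes e: "e > 0"
  obtains R0 where "R0 > 0" "\<And>x. pole_prod n a x \<ge> R0 \<Longrightarrow> (norm (pole_field n a x))\<^sup>2 \<le> e"
proof -
  \<comment> \<open>Chosen so that n / \<rho> <= sqrt e; the + 1 keeps \<rho> positive for n =
    0.\<close>
  define \<rho> where "\<rho> = (real n + 1) / sqrt e"
  have \<rho>: "\<rho> > 0" using e by (simp add: \<rho>_def)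
  let ?B = "cball 0 ((\<Sum>i=1..n. norm (a i)) + \<rho>)"
  have "compact (pole_prod n a ` ?B)"
    by (intro compact_continuous_image continuous_pole_prod compact_cball)
  then obtain M where M: "\<forall>x\<in>?B. \<bar>pole_prod n a x\<bar> \<le> M"
    using compact_imp_bounded by (fastforce simp: bounded_iff)
  show thesis
  proof
    show "\<bar>M\<bar> + 1 > 0" by simp
    fix x assume x: "pole_prod n a x \<ge> \<bar>M\<bar> + 1"
    have "x \<notin> ?B"
    proof
      assume "x \<in> ?B"
      then have "\<bar>pole_prod n a x\<bar> \<le> M" using M by blast
      then show False using x by linarith
    qed
    then have far: "norm x > (\<Sum>i=1..n. norm (a i)) + \<rho>" by simp
    have "norm (pole_field n a x) \<le> real n / \<rho>"
      using far_from_poles[OF far] by (intro norm_pole_field_le \<rho>) (auto intro: less_imp_le)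
    also have "\<dots> \<le> sqrt e" using e by (simp add: \<rho>_def divide_simps)
    finally have "(norm (pole_field n a x))\<^sup>2 \<le> (sqrt e)\<^sup>2" by (intro power_mono) auto
    then show "(norm (pole_field n a x))\<^sup>2 \<le> e" using e by simp
  qed
qed

lemma continuous_pole_field:
  "continuous_on (- a ` {1..n}) (pole_field n a)"
  "continuous_on (- a ` {1..n}) (pole_field_deriv n a b)"
  unfolding pole_field_def[abs_def] pole_field_deriv_def[abs_def]
  by (intro continuous_intros; force)+

section \<open>The cut-off field and its divergence identity\<close>

definition cutoff_field :: "nat \<Rightarrow> (nat \<Rightarrow> 'a::euclidean_space) \<Rightarrow> real \<Rightarrow> real \<Rightarrow> 'a \<Rightarrow> 'a" where
  "cutoff_field n a d R x = plateau d R (pole_prod n a x) *\<^sub>R pole_field n a x"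

definition cutoff_field_deriv :: "nat \<Rightarrow> (nat \<Rightarrow> 'a::euclidean_space) \<Rightarrow> real \<Rightarrow> real \<Rightarrow> 'a \<Rightarrow> 'a \<Rightarrow> real" where
  "cutoff_field_deriv n a d R b x =
     plateau' d R (pole_prod n a x) * (2 * pole_prod n a x * (pole_field n a x \<bullet> b)) * (pole_field n a x \<bullet> b)
     + plateau d R (pole_prod n a x) * pole_field_deriv n a b x"

lemma borel_measurable_pole_field [measurable]: "pole_field n a \<in> borel_measurable borel"
  unfolding pole_field_def[abs_def] by measurable

lemma borel_measurable_pole_prod [measurable]: "pole_prod n a \<in> borel_measurable borel"
  by (intro borel_measurable_continuous_onI continuous_pole_prod)

lemma borel_measurable_plateau [measurable]: "plateau d R \<in> borel_measurable borel"
  by (rule borel_measurable_continuous_onI[OF DERIV_continuous_on[OF plateau_has_derivative]])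

lemma cutoff_field_line_test:
  fixes a :: "nat \<Rightarrow> 'a::euclidean_space"
  assumes n: "n \<ge> 1" and d: "d > 0" and R: "R > 0" and b: "b \<in> Basis"
  shows "\<exists>c r. line_test b (\<lambda>x. cutoff_field n a d R x \<bullet> b) (cutoff_field_deriv n a d R b) c r"
proof -
  let ?P = "pole_prod n a" and ?E = "pole_field n a"
  let ?h = "plateau d R" and ?h' = "plateau' d R"
  note pf = plateau_facts[OF d R]
  define r where "r = (\<Sum>i=1..n. norm (a i)) + max 1 (2 * R)"
  have far: "?P x \<ge> 2 * R" if "norm x > r" for x
  proof -
    have "max 1 (2 * R) \<le> ?P x"
      using far_from_poles[where n = n and a = a and \<rho> = "max 1 (2 * R)" and x = x] that unfolding r_def
      by (intro pole_prod_ge n) (auto intro: less_imp_le)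
    then show ?thesis by simp
  qed
  \<comment> \<open>Off \<open>K\<close> the plateau and its derivative vanish at P x, while
    \<open>K\<close> is compact and contains no pole, so continuity on \<open>K\<close> supplies the
    bounds.\<close>
  define K where "K = cball 0 r \<inter> {x. d \<le> ?P x}"
  have "closed {x. d \<le> ?P x}"
    by (intro closed_Collect_le continuous_intros continuous_pole_prod)
  then have K: "compact K" unfolding K_def by (intro compact_Int_closed) auto
  have Kp: "K \<subseteq> - a ` {1..n}"
  proof
    fix x assume "x \<in> K"
    then have "?P x \<noteq> 0" using d by (auto simp: K_def)
    then show "x \<in> - a ` {1..n}" by (simp add: pole_prod_eq_0_iff)
  qed
  have ch: "continuous_on UNIV ?h" by (rule DERIV_continuous_on[OF plateau_has_derivative])
  have chP: "continuous_on S (\<lambda>x. ?h (?P x))" for S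
    by (rule continuous_on_compose2[OF ch continuous_pole_prod]) simp
  have ch'P: "continuous_on S (\<lambda>x. ?h' (?P x))" for S
    by (rule continuous_on_compose2[OF continuous_plateau'[OF d R] continuous_pole_prod]) simp
  note cE = continuous_on_subset[OF continuous_pole_field(1) Kp] continuous_on_subset[OF continuous_pole_field(2) Kp]
  have cK: "continuous_on K (\<lambda>x. cutoff_field n a d R x \<bullet> b)" "continuous_on K (cutoff_field_deriv n a d R b)"
    unfolding cutoff_field_def[abs_def] cutoff_field_deriv_def[abs_def]
    by (intro continuous_intros cE continuous_pole_prod chP ch'P)+
  have "bounded ((\<lambda>x. cutoff_field n a d R x \<bullet> b) ` K)" "bounded (cutoff_field_deriv n a d R b ` K)"
    by (rule compact_imp_bounded[OF compact_continuous_image[OF cK(1) K]],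
        rule compact_imp_bounded[OF compact_continuous_image[OF cK(2) K]])
  then obtain c1 c2 where c: "\<forall>x\<in>K. \<bar>cutoff_field n a d R x \<bullet> b\<bar> \<le> c1" "\<forall>x\<in>K. \<bar>cutoff_field_deriv n a d R b x\<bar> \<le> c2"
    by (auto simp: bounded_iff)
  have out: "cutoff_field n a d R x \<bullet> b = 0 \<and> cutoff_field_deriv n a d R b x = 0" if "x \<notin> K" for x
  proof -
    have "norm x > r \<or> ?P x < d" using that by (auto simp: K_def not_le)
    then have "?h (?P x) = 0 \<and> ?h' (?P x) = 0"
      using far[of x] pf pole_prod_nonneg[of n a x] by auto
    then show ?thesis by (simp add: cutoff_field_def cutoff_field_deriv_def)
  qed
  define c where "c = max 0 (max c1 c2)"
  have bd: "\<bar>cutoff_field n a d R x \<bullet> b\<bar> \<le> c \<and> \<bar>cutoff_field_deriv n a d R b x\<bar> \<le> c" for x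
    using c out[of x] by (cases "x \<in> K") (auto simp: c_def le_max_iff_disj)
  \<comment> \<open>Where P x < d, poles included, the field is zero on a short piece of the line;
    elsewhere x is no pole and the product rule applies.\<close>
  have deriv: "((\<lambda>s. cutoff_field n a d R (x + s *\<^sub>R b) \<bullet> b) has_real_derivative cutoff_field_deriv n a d R b x) (at 0)" for x
  proof (cases "?P x < d")
    case True
    have "((\<lambda>s. ?P (x + s *\<^sub>R b)) \<longlongrightarrow> ?P (x + 0 *\<^sub>R b)) (nhds 0)"
    proof -
      have "isCont ?P (x + 0 *\<^sub>R b)"
        using continuous_pole_prod[of UNIV n a] by (simp add: continuous_on_eq_continuous_at)
      then show ?thesis
        by (rule isCont_tendsto_compose) (intro tendsto_intros filterlim_ident)
    qed
    then have "\<forall>\<^sub>F s in nhds 0. ?P (x + s *\<^sub>R b) < d"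
      using True by (intro order_tendstoD) auto
    then have "\<forall>\<^sub>F s in nhds 0. cutoff_field n a d R (x + s *\<^sub>R b) \<bullet> b = 0"
      by eventually_elim (simp add: cutoff_field_def pf)
    moreover have "cutoff_field_deriv n a d R b x = 0"
      using out[of x] True by (auto simp: K_def)
    ultimately show ?thesis
      by (subst DERIV_cong_ev[OF refl _ refl, of _ "\<lambda>_. 0"]) auto
  next
    case False
    then have "?P x \<noteq> 0" using d by linarith
    then have x: "x \<notin> a ` {1..n}" by (simp only: pole_prod_eq_0_iff not_False_eq_True)
    have "((\<lambda>s. ?h (?P (x + s *\<^sub>R b))) has_real_derivative ?h' (?P (x + 0 *\<^sub>R b)) * (2 * ?P x * (?E x \<bullet> b))) (at 0)"
      by (rule DERIV_chain2[OF plateau_has_derivative pole_prod_line_has_derivative[OF x]])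
    from DERIV_mult[OF this pole_field_line_has_derivative[OF x b]]
    show ?thesis
      by (simp add: cutoff_field_def cutoff_field_deriv_def algebra_simps)
  qed
  have "(\<lambda>x. cutoff_field n a d R x \<bullet> b) \<in> borel_measurable borel"
    unfolding cutoff_field_def[abs_def] by measurable
  moreover have "cutoff_field n a d R x \<bullet> b = 0" if "norm x > r" for x
    using out[of x] that by (auto simp: K_def)
  ultimately have "line_test b (\<lambda>x. cutoff_field n a d R x \<bullet> b) (cutoff_field_deriv n a d R b) c r"
    using bd deriv by (auto simp: line_test_def)
  then show ?thesis by blast
qed

lemma cutoff_field_divergence:
  fixes x :: "'a::euclidean_space"
  assumes x: "x \<notin> a ` {1..n}"
  shows "(\<Sum>b\<in>Basis. cutoff_field_deriv n a d R b x) =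
    2 * (plateau' d R (pole_prod n a x) * pole_prod n a x) * (norm (pole_field n a x))\<^sup>2
    + plateau d R (pole_prod n a x) * ((real DIM('a) - 2) * inv_sq_sum n a x)"
proof -
  let ?E = "pole_field n a x"
  have n: "(\<Sum>b\<in>Basis. (?E \<bullet> b) * (?E \<bullet> b)) = (norm ?E)\<^sup>2"
    by (simp only: power2_norm_eq_inner euclidean_inner[of ?E ?E])
  have "(\<Sum>b\<in>Basis. cutoff_field_deriv n a d R b x) =
     2 * (plateau' d R (pole_prod n a x) * pole_prod n a x) * (\<Sum>b\<in>Basis. (?E \<bullet> b) * (?E \<bullet> b))
     + plateau d R (pole_prod n a x) * (\<Sum>b\<in>Basis. pole_field_deriv n a b x)"
    by (simp add: cutoff_field_deriv_def sum.distrib sum_distrib_left mult_ac)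
  then show ?thesis unfolding n pole_field_divergence[OF x] .
qed

text \<open>J is the weak divergence of the boundedly supported field f(u) w^2 X, written out by the
  product rule, so its integral vanishes. Integrability is obtained component by component.\<close>

theorem vector_field_integration_by_parts:
  fixes u w :: "'a::euclidean_space \<Rightarrow> real" and g \<gamma> X :: "'a \<Rightarrow> 'a"
  assumes u: "\<And>b. b \<in> Basis \<Longrightarrow> has_weak_partial u (\<lambda>x. g x \<bullet> b) b"
    and w: "\<And>b. b \<in> Basis \<Longrightarrow> has_weak_partial w (\<lambda>x. \<gamma> x \<bullet> b) b"
    and f: "\<And>s. (f has_real_derivative f' s) (at s)" "continuous_on UNIV f'" "\<And>s. \<bar>f s\<bar> \<le> L" "\<And>s. \<bar>f' s\<bar> \<le> L"
    and w2: "loc_int (\<lambda>x. (w x)\<^sup>2)" and \<gamma>2: "\<And>b. b \<in> Basis \<Longrightarrow> loc_int (\<lambda>x. (\<gamma> x \<bullet> b)\<^sup>2)"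
    and wg: "\<And>b. b \<in> Basis \<Longrightarrow> loc_int (\<lambda>x. (w x)\<^sup>2 * (f' (u x) * (g x \<bullet> b)))"
    and X: "\<And>b. b \<in> Basis \<Longrightarrow> \<exists>c r. line_test b (\<lambda>x. X x \<bullet> b) (X' b) c r"
  defines "J \<equiv> \<lambda>x. f (u x) * (w x)\<^sup>2 * (\<Sum>b\<in>Basis. X' b x)
      + (w x)\<^sup>2 * f' (u x) * (X x \<bullet> g x) + f (u x) * (2 * w x * (X x \<bullet> \<gamma> x))"
  shows "integrable lborel J" "(LBINT x. J x) = 0"
proof -
  define Jb where "Jb b x = f (u x) * (w x)\<^sup>2 * X' b x
      + (X x \<bullet> b) * ((w x)\<^sup>2 * (f' (u x) * (g x \<bullet> b)) + f (u x) * (2 * w x * (\<gamma> x \<bullet> b)))" for b x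
  have Jb: "integrable lborel (Jb b) \<and> (LBINT x. Jb b x) = 0" if b: "b \<in> Basis" for b
  proof -
    obtain c r where \<psi>: "line_test b (\<lambda>x. X x \<bullet> b) (X' b) c r" using X[OF b] by blast
    have [measurable]: "(\<lambda>x. X x \<bullet> b) \<in> borel_measurable borel" "X' b \<in> borel_measurable borel"
      by (rule line_testD(1)[OF \<psi>], rule line_test_derivative_measurable[OF \<psi>])
    have [measurable]: "u \<in> borel_measurable borel" "w \<in> borel_measurable borel"
      "(\<lambda>x. \<gamma> x \<bullet> b) \<in> borel_measurable borel"
      using u[OF b] w[OF b] by (auto simp: has_weak_partial_def loc_int_def)
    have [measurable]: "f \<in> borel_measurable borel"
      by (rule borel_measurable_continuous_onI[OF DERIV_continuous_on[OF f(1)]])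
    have fw: "loc_int (\<lambda>x. f (u x) * (w x)\<^sup>2)"
      by (rule loc_int_mult_bounded[OF w2 _ f(3)]) measurable
    have w\<gamma>: "loc_int (\<lambda>x. 2 * w x * (\<gamma> x \<bullet> b))" by (rule loc_int_mult_L2[OF w2 \<gamma>2[OF b]]) measurable
    have fwc: "loc_int (\<lambda>x. f (u x) * (2 * w x * (\<gamma> x \<bullet> b)))"
      by (rule loc_int_mult_bounded[OF w\<gamma> _ f(3)]) measurable
    have i1: "integrable lborel (\<lambda>x. f (u x) * (w x)\<^sup>2 * X' b x)"
      by (rule loc_int_mult_integrable[OF fw _ line_testD(5)[OF \<psi>] line_test_derivative_support[OF \<psi>]]) measurable
    have "integrable lborel (\<lambda>x. ((w x)\<^sup>2 * (f' (u x) * (g x \<bullet> b)) + f (u x) * (2 * w x * (\<gamma> x \<bullet> b))) * (X x \<bullet> b))"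
      by (rule loc_int_mult_integrable[OF loc_int_add[OF wg[OF b] fwc] _ line_testD(2,3)[OF \<psi>]]) measurable
    then have i2: "integrable lborel (\<lambda>x. (X x \<bullet> b) * ((w x)\<^sup>2 * (f' (u x) * (g x \<bullet> b)) + f (u x) * (2 * w x * (\<gamma> x \<bullet> b))))"
      by (simp only: mult.commute[of "X _ \<bullet> b"])
    have "(LBINT x. f (u x) * (w x)\<^sup>2 * X' b x) =
      - (LBINT x. (X x \<bullet> b) * ((w x)\<^sup>2 * (f' (u x) * (g x \<bullet> b)) + f (u x) * (2 * w x * (\<gamma> x \<bullet> b))))"
      by (rule weighted_weak_partial_chain[OF u[OF b] w[OF b] b f w2 \<gamma>2[OF b] wg[OF b] \<psi>])
    then show ?thesis
      unfolding Jb_def[abs_def] using Bochner_Integration.integral_add[OF i1 i2] Bochner_Integration.integrable_add[OF i1 i2]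
      by simp
  qed
  have J: "J x = (\<Sum>b\<in>Basis. Jb b x)" for x
    unfolding J_def Jb_def euclidean_inner[of "X x" "g x"] euclidean_inner[of "X x" "\<gamma> x"]
    by (simp add: sum.distrib distrib_left sum_distrib_left sum_distrib_right mult_ac)
  show "integrable lborel J"
    unfolding J[abs_def] using Jb by (intro Bochner_Integration.integrable_sum) blast
  show "(LBINT x. J x) = 0"
    unfolding J using Jb by (subst Bochner_Integration.integral_sum) auto
qed

section \<open>The weighted Hardy inequality\<close>

lemma multipole_V_nonneg: "0 \<le> multipole_V n a x"
  unfolding multipole_V_def by (intro mult_nonneg_nonneg sum_nonneg divide_nonneg_nonneg) auto

lemma borel_measurable_multipole_V [measurable]: "multipole_V n a \<in> borel_measurable borel"
  unfolding multipole_V_def[abs_def] by measurable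

lemma borel_measurable_inv_sq_sum [measurable]: "inv_sq_sum n a \<in> borel_measurable borel"
  unfolding inv_sq_sum_def[abs_def] by measurable

lemma AE_not_pole: "AE x in lborel. x \<notin> a ` {1..n::nat}"
proof -
  have "AE x in lborel. \<forall>i\<in>{1..n}. x \<noteq> a i"
    by (intro AE_finite_allI AE_lborel_singleton) simp
  then show ?thesis by eventually_elim auto
qed

text \<open>The algebra behind the inequality: completing the square in \<open>\<nabla>\<phi> + \<beta> \<theta> E \<phi>\<close>, where
  \<open>E = \<Sum>\<^sub>i (x - a\<^sub>i) / |x - a\<^sub>i|\<^sup>2\<close> satisfies \<open>|E|\<^sup>2 = n S - V\<close>, \<open>h\<close> is \<open>|E|\<^sup>2\<close> times the radial derivative
  of the cutoff \<open>\<theta>\<close>, and \<open>U\<close> is \<open>w\<^sup>2 W\<close>.\<close>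

lemma completed_square:
  fixes E G \<gamma> :: "'a::euclidean_space" and w :: real
  assumes \<theta>: "0 \<le> \<theta>" "\<theta> \<le> 1" and T': "0 \<le> T'" "T' \<le> 1" and q: "T\<^sup>2 \<le> q0"
    and \<beta>: "0 \<le> \<beta>" "\<beta> * real n = N - 2 + K" and e: "0 \<le> e" "- 8 * e \<le> h"
    and E: "(norm E)\<^sup>2 = real n * S - V"
  defines "U \<equiv> w\<^sup>2 * (\<beta> * K * S) - \<beta> * (2 * w * (E \<bullet> \<gamma>))"
  shows "T\<^sup>2 * \<theta> * (\<beta>\<^sup>2 * w\<^sup>2 * V - U) \<le>
    \<beta> * (T\<^sup>2 * w\<^sup>2 * (2 * h + \<theta> * ((N - 2) * S))
      + w\<^sup>2 * (2 * T * T') * ((\<theta> *\<^sub>R E) \<bullet> G) + T\<^sup>2 * (2 * w * ((\<theta> *\<^sub>R E) \<bullet> \<gamma>)))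
    + (16 * \<beta> * e * (w\<^sup>2 * q0) + w\<^sup>2 * (norm G)\<^sup>2)"
proof -
  have "0 \<le> (norm (T' *\<^sub>R G + (T * \<theta> * \<beta>) *\<^sub>R E))\<^sup>2" by simp
  also have "\<dots> = T'\<^sup>2 * (norm G)\<^sup>2 + 2 * (T' * (T * \<theta> * \<beta>)) * (E \<bullet> G) + (T * \<theta> * \<beta>)\<^sup>2 * (norm E)\<^sup>2"
    by (simp only: power2_norm_eq_inner inner_add_left inner_add_right inner_scaleR_left inner_scaleR_right inner_commute[of G E])
       (simp add: algebra_simps power2_eq_square)
  finally have sq: "0 \<le> T'\<^sup>2 * (norm G)\<^sup>2 + 2 * (T' * (T * \<theta> * \<beta>)) * (E \<bullet> G) + (T * \<theta> * \<beta>)\<^sup>2 * (norm E)\<^sup>2" .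
  have "T'\<^sup>2 \<le> 1" using T' by (simp add: power_le_one)
  then have "T'\<^sup>2 * (norm G)\<^sup>2 \<le> (norm G)\<^sup>2" by (simp add: mult_left_le_one_le)
  \<comment> \<open>The square produces \<theta>^2 but the divergence only \<theta>; as 0 <=
    \<theta> <= 1 the larger term may be used.\<close>
  moreover have "(T * \<theta> * \<beta>)\<^sup>2 * (norm E)\<^sup>2 \<le> T\<^sup>2 * \<theta> * \<beta>\<^sup>2 * (norm E)\<^sup>2"
  proof -
    have "\<theta>\<^sup>2 \<le> \<theta>" using \<theta> by (simp add: power2_eq_square mult_left_le)
    then have "\<theta>\<^sup>2 * (T\<^sup>2 * \<beta>\<^sup>2 * (norm E)\<^sup>2) \<le> \<theta> * (T\<^sup>2 * \<beta>\<^sup>2 * (norm E)\<^sup>2)"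
      by (intro mult_right_mono) auto
    then show ?thesis by (simp add: power_mult_distrib mult_ac)
  qed
  ultimately have "0 \<le> (norm G)\<^sup>2 + 2 * (T' * (T * \<theta> * \<beta>)) * (E \<bullet> G) + T\<^sup>2 * \<theta> * \<beta>\<^sup>2 * (norm E)\<^sup>2"
    using sq by linarith
  then have A: "0 \<le> w\<^sup>2 * ((norm G)\<^sup>2 + 2 * (T' * (T * \<theta> * \<beta>)) * (E \<bullet> G) + T\<^sup>2 * \<theta> * \<beta>\<^sup>2 * (norm E)\<^sup>2)"
    by (intro mult_nonneg_nonneg) auto
  \<comment> \<open>The only place where the sign of the cutoff derivative matters: the worst case
    -8 e of h against T^2 <= q0 costs 16 \<beta> e w^2 q0 after multiplication by 2 \<beta>
    w^2.\<close>
  have "- (8 * e * q0) \<le> h * T\<^sup>2"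
  proof -
    have "- (8 * e * q0) \<le> - 8 * e * T\<^sup>2" using mult_left_mono[OF q, of "8 * e"] e by simp
    also have "\<dots> \<le> h * T\<^sup>2" using e by (intro mult_right_mono) auto
    finally show ?thesis .
  qed
  then have "(2 * \<beta> * w\<^sup>2) * (- (8 * e * q0)) \<le> (2 * \<beta> * w\<^sup>2) * (h * T\<^sup>2)"
    using \<beta> by (intro mult_left_mono) auto
  then have B: "0 \<le> 2 * \<beta> * w\<^sup>2 * (h * T\<^sup>2) + 16 * \<beta> * e * (w\<^sup>2 * q0)" by (simp add: algebra_simps)
  \<comment> \<open>Writing n S - |E|^2 for V turns \<beta>^2 n S into \<beta> (N - 2 + K) S, and
    the part with K cancels against \<open>U\<close>.\<close>
  have "T\<^sup>2 * \<theta> * (\<beta>\<^sup>2 * w\<^sup>2 * V - U) =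
      T\<^sup>2 * \<theta> * (w\<^sup>2 * (\<beta> * (\<beta> * real n) * S) - w\<^sup>2 * \<beta>\<^sup>2 * (norm E)\<^sup>2 - U)"
    unfolding E by (simp add: algebra_simps power2_eq_square)
  also have "\<dots> = T\<^sup>2 * \<theta> * (w\<^sup>2 * \<beta> * (N - 2) * S + \<beta> * (2 * w * (E \<bullet> \<gamma>))) - w\<^sup>2 * (T\<^sup>2 * \<theta> * \<beta>\<^sup>2 * (norm E)\<^sup>2)"
    unfolding \<beta>(2) U_def by (simp add: algebra_simps)
  finally show ?thesis using A B by (simp add: algebra_simps)
qed

text \<open>\<open>U\<close> stands for w^2 W. Adding C w^2 makes the integrand nonnegative, as
  Fatou's lemma requires. The second conclusion is needed because \<open>ennreal\<close> sends
  negative numbers to 0, so the first alone could not be read as an inequality between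
  reals.\<close>

lemma weighted_hardy_core:
  fixes \<phi> w :: "'a::euclidean_space \<Rightarrow> real" and G \<Gamma> :: "'a \<Rightarrow> 'a" and a :: "nat \<Rightarrow> 'a"
  assumes n: "n \<ge> 1" and \<beta>: "0 \<le> \<beta>" "\<beta> * real n = real DIM('a) - 2 + K"
    and \<phi>: "\<And>b. b \<in> Basis \<Longrightarrow> has_weak_partial \<phi> (\<lambda>x. G x \<bullet> b) b"
    and w: "\<And>b. b \<in> Basis \<Longrightarrow> has_weak_partial w (\<lambda>x. \<Gamma> x \<bullet> b) b"
    and m: "\<phi> \<in> borel_measurable borel" "w \<in> borel_measurable borel"
      "G \<in> borel_measurable borel" "\<Gamma> \<in> borel_measurable borel"
    and w2: "loc_int (\<lambda>x. (w x)\<^sup>2)" and \<Gamma>2: "\<And>b. b \<in> Basis \<Longrightarrow> loc_int (\<lambda>x. (\<Gamma> x \<bullet> b)\<^sup>2)"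
    and \<phi>2: "integrable lborel (\<lambda>x. (w x)\<^sup>2 * (\<phi> x)\<^sup>2)" and G2: "integrable lborel (\<lambda>x. (w x)\<^sup>2 * (norm (G x))\<^sup>2)"
  defines "U \<equiv> \<lambda>x. (w x)\<^sup>2 * (\<beta> * K * inv_sq_sum n a x) - \<beta> * (2 * w x * (pole_field n a x \<bullet> \<Gamma> x))"
  assumes U: "AE x in lborel. U x \<le> C * (w x)\<^sup>2"
  shows "(\<integral>\<^sup>+x. ennreal ((\<phi> x)\<^sup>2 * (\<beta>\<^sup>2 * (w x)\<^sup>2 * multipole_V n a x - U x + C * (w x)\<^sup>2)) \<partial>lborel)
    \<le> ennreal (C * (LBINT x. (w x)\<^sup>2 * (\<phi> x)\<^sup>2) + (LBINT x. (w x)\<^sup>2 * (norm (G x))\<^sup>2))" (is ?bound)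
    and "0 \<le> C * (LBINT x. (w x)\<^sup>2 * (\<phi> x)\<^sup>2) + (LBINT x. (w x)\<^sup>2 * (norm (G x))\<^sup>2)" (is ?nonneg)
proof -
  note [measurable] = m
  let ?P = "pole_prod n a" and ?E = "pole_field n a" and ?V = "multipole_V n a" and ?S = "inv_sq_sum n a"
  have [measurable]: "U \<in> borel_measurable borel" unfolding U_def by measurable
  define e where "e j = inverse (real (Suc j))" for j
  have e: "0 < e j" for j by (simp add: e_def)
  have elim0: "e \<longlonglongrightarrow> 0" unfolding e_def by (rule LIMSEQ_inverse_real_of_nat)
  have "\<forall>j. \<exists>R0. R0 > 0 \<and> (\<forall>x. ?P x \<ge> R0 \<longrightarrow> (norm (?E x))\<^sup>2 \<le> e j)"
    using pole_prod_large_imp_pole_field_small[OF e] by metis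
  then obtain R0 where R0: "\<And>j. R0 j > 0" "\<And>j x. ?P x \<ge> R0 j \<Longrightarrow> (norm (?E x))\<^sup>2 \<le> e j" by metis
  \<comment> \<open>\<open>R0 j\<close> makes |E|^2 <= e j where the cutoff falls;
    \<open>Suc j\<close> drives R j to infinity, so that the cutoffs tend to 1.\<close>
  define R where "R j = max (R0 j) (real (Suc j))" for j
  have R: "R j > 0" for j using R0(1)[of j] by (simp add: R_def)
  define \<theta> where "\<theta> j x = plateau (e j) (R j) (?P x)" for j x
  define T T' where "T j x = trunc (real (Suc j)) (\<phi> x)" and "T' j x = trunc' (real (Suc j)) (\<phi> x)" for j x
  define q where "q j x = sq_trunc (real (Suc j)) (\<phi> x)" for j x
  have kpos: "real (Suc j) > 0" for j by simp
  have [measurable]: "\<theta> j \<in> borel_measurable borel" for j unfolding \<theta>_def[abs_def] by measurable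
  have [measurable]: "sq_trunc (real (Suc j)) \<in> borel_measurable borel" for j
    by (intro borel_measurable_continuous_onI continuous_on_sq_trunc kpos)
  have [measurable]: "q j \<in> borel_measurable borel" for j unfolding q_def[abs_def] by measurable
  have \<theta>01: "0 \<le> \<theta> j x" "\<theta> j x \<le> 1" for j x
    unfolding \<theta>_def using plateau_facts(1,2)[OF e R] by auto
  have q0: "0 \<le> q j x" "q j x \<le> (\<phi> x)\<^sup>2" for j x
    unfolding q_def using sq_trunc_bounds[OF kpos] by auto
  have \<theta>lim: "(\<lambda>j. \<theta> j x) \<longlonglongrightarrow> 1" if x: "x \<notin> a ` {1..n}" for x
  proof -
    have P: "?P x > 0" using x pole_prod_nonneg[of n a x] pole_prod_eq_0_iff[of n a x] by (simp add: less_le)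
    obtain j0 where j0: "?P x \<le> real j0" using real_arch_simple by blast
    have "(\<lambda>j. 2 * e j) \<longlonglongrightarrow> 0" using tendsto_mult_right_zero[OF elim0] .
    then have "\<forall>\<^sub>F j in sequentially. 2 * e j < ?P x" using P by (intro order_tendstoD) auto
    then have "\<forall>\<^sub>F j in sequentially. \<theta> j x = 1"
      using eventually_ge_at_top[of j0]
    proof eventually_elim
      case (elim j)
      then have "?P x \<le> R j" using j0 by (simp add: R_def)
      then show ?case unfolding \<theta>_def using elim by (intro plateau_facts(7) e R) auto
    qed
    then show ?thesis by (rule tendsto_eventually)
  qed
  \<comment> \<open>The expanded divergence of q \<theta> w^2 E, which integrates to 0.\<close>
  define J where "J j x = q j x * (w x)\<^sup>2 * (\<Sum>b\<in>Basis. cutoff_field_deriv n a (e j) (R j) b x)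
      + (w x)\<^sup>2 * sq_trunc' (real (Suc j)) (\<phi> x) * (cutoff_field n a (e j) (R j) x \<bullet> G x)
      + q j x * (2 * w x * (cutoff_field n a (e j) (R j) x \<bullet> \<Gamma> x))" for j x
  have J: "integrable lborel (J j)" "(LBINT x. J j x) = 0" for j
  proof -
    let ?M = "max (4 * (real (Suc j))\<^sup>2) (4 * real (Suc j))"
    \<comment> \<open>Here 2 |\<phi>| |\<nabla>\<phi>| <= \<phi>^2 + |\<nabla>\<phi>|^2 with weight
      w^2 is integrable since \<phi> has finite weighted norm.\<close>
    have wg: "loc_int (\<lambda>x. (w x)\<^sup>2 * (sq_trunc' (real (Suc j)) (\<phi> x) * (G x \<bullet> b)))" if b: "b \<in> Basis" for b
    proof -
      let ?f = "\<lambda>x. (w x)\<^sup>2 * (sq_trunc' (real (Suc j)) (\<phi> x) * (G x \<bullet> b))"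
      have [measurable]: "sq_trunc' (real (Suc j)) \<in> borel_measurable borel"
        by (intro borel_measurable_continuous_onI continuous_on_sq_trunc kpos)
      have "integrable lborel ?f"
      proof (rule Bochner_Integration.integrable_bound[OF Bochner_Integration.integrable_add[OF \<phi>2 G2]])
        show "?f \<in> borel_measurable lborel" by measurable
        show "AE x in lborel. norm (?f x) \<le> norm ((w x)\<^sup>2 * (\<phi> x)\<^sup>2 + (w x)\<^sup>2 * (norm (G x))\<^sup>2)"
        proof (rule AE_I2)
          fix x
          have "\<bar>sq_trunc' (real (Suc j)) (\<phi> x) * (G x \<bullet> b)\<bar> \<le> (2 * \<bar>\<phi> x\<bar>) * norm (G x)"
            unfolding abs_mult by (intro mult_mono sq_trunc_bounds kpos Basis_le_norm b) auto
          also have "\<dots> \<le> (\<phi> x)\<^sup>2 + (norm (G x))\<^sup>2"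
            using sum_squares_bound[of "\<bar>\<phi> x\<bar>" "norm (G x)"] by simp
          finally have "(w x)\<^sup>2 * \<bar>sq_trunc' (real (Suc j)) (\<phi> x) * (G x \<bullet> b)\<bar> \<le> (w x)\<^sup>2 * ((\<phi> x)\<^sup>2 + (norm (G x))\<^sup>2)"
            by (intro mult_left_mono) auto
          then show "norm (?f x) \<le> norm ((w x)\<^sup>2 * (\<phi> x)\<^sup>2 + (w x)\<^sup>2 * (norm (G x))\<^sup>2)"
            by (simp add: abs_mult distrib_left)
        qed
      qed
      moreover have "?f \<in> borel_measurable borel" by measurable
      ultimately show ?thesis
        unfolding loc_int_def by (auto intro!: integrable_mult_indicator[where 'b = real, simplified] simp: mult.commute[of _ "indicator _ _"])
    qed
    note * = vector_field_integration_by_parts[where u = \<phi> and w = w and g = G and \<gamma> = \<Gamma>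
        and f = "sq_trunc (real (Suc j))" and f' = "sq_trunc' (real (Suc j))" and L = ?M
        and X = "cutoff_field n a (e j) (R j)" and X' = "cutoff_field_deriv n a (e j) (R j)",
        OF \<phi> w sq_trunc_has_derivative[OF kpos] continuous_on_sq_trunc(2)[OF kpos] _ _ w2 \<Gamma>2 wg
          cutoff_field_line_test[OF n e R]]
    have "\<bar>sq_trunc (real (Suc j)) s\<bar> \<le> ?M" "\<bar>sq_trunc' (real (Suc j)) s\<bar> \<le> ?M" for s
      using sq_trunc_bounds[OF kpos, of j s] by (auto simp: le_max_iff_disj)
    note ** = *[OF _ _ this]
    show "integrable lborel (J j)" "(LBINT x. J j x) = 0"
      unfolding J_def[abs_def] q_def by (rule **; assumption)+
  qed
  define Z where "Z j x = q j x * \<theta> j x * (\<beta>\<^sup>2 * (w x)\<^sup>2 * ?V x - U x + C * (w x)\<^sup>2)" for j x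
  have [measurable]: "Z j \<in> borel_measurable borel" for j unfolding Z_def[abs_def] by measurable
  \<comment> \<open>What is left of the upper bound for \<open>Z\<close> once the divergence
    \<open>J\<close> has integrated to 0.\<close>
  define D where "D j x = C * (q j x * \<theta> j x * (w x)\<^sup>2) + (16 * \<beta> * e j * ((w x)\<^sup>2 * (\<phi> x)\<^sup>2) + (w x)\<^sup>2 * (norm (G x))\<^sup>2)" for j x
  have q\<theta>: "0 \<le> q j x * \<theta> j x * (w x)\<^sup>2" "q j x * \<theta> j x * (w x)\<^sup>2 \<le> (w x)\<^sup>2 * (\<phi> x)\<^sup>2" for j x
  proof -
    show "0 \<le> q j x * \<theta> j x * (w x)\<^sup>2" using q0 \<theta>01 by simp
    have "q j x * \<theta> j x \<le> (\<phi> x)\<^sup>2 * 1" using q0[of j x] \<theta>01[of j x] by (intro mult_mono) auto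
    from mult_right_mono[OF this, of "(w x)\<^sup>2"]
    show "q j x * \<theta> j x * (w x)\<^sup>2 \<le> (w x)\<^sup>2 * (\<phi> x)\<^sup>2" by (simp add: mult_ac)
  qed
  have Iq: "integrable lborel (\<lambda>x. q j x * \<theta> j x * (w x)\<^sup>2)" for j
  proof (rule Bochner_Integration.integrable_bound[OF \<phi>2])
    show "AE x in lborel. norm (q j x * \<theta> j x * (w x)\<^sup>2) \<le> norm ((w x)\<^sup>2 * (\<phi> x)\<^sup>2)"
    proof (rule AE_I2)
      fix x
      show "norm (q j x * \<theta> j x * (w x)\<^sup>2) \<le> norm ((w x)\<^sup>2 * (\<phi> x)\<^sup>2)"
        unfolding real_norm_def using q\<theta>[of j x] by linarith
    qed
  qed measurable
  have Dint: "integrable lborel (D j)" for j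
    unfolding D_def[abs_def]
    by (intro Bochner_Integration.integrable_add integrable_mult_right Iq \<phi>2 G2)
  let ?a = "\<integral>x. (w x)\<^sup>2 * (\<phi> x)\<^sup>2 \<partial>lborel" and ?g = "\<integral>x. (w x)\<^sup>2 * (norm (G x))\<^sup>2 \<partial>lborel"
  let ?r = "\<lambda>j. C * (LBINT x. q j x * \<theta> j x * (w x)\<^sup>2) + (16 * \<beta> * e j * ?a + ?g)"
  have Zle: "AE x in lborel. 0 \<le> Z j x \<and> Z j x \<le> \<beta> * J j x + D j x" for j
    using U AE_not_pole[of a n]
  proof eventually_elim
    case (elim x)
    have "0 \<le> \<beta>\<^sup>2 * (w x)\<^sup>2 * ?V x"
      by (intro mult_nonneg_nonneg multipole_V_nonneg) auto
    then have "0 \<le> \<beta>\<^sup>2 * (w x)\<^sup>2 * ?V x - U x + C * (w x)\<^sup>2" using elim(1) by linarith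
    then have 1: "0 \<le> Z j x"
      unfolding Z_def by (intro mult_nonneg_nonneg q0 \<theta>01)
    let ?h = "plateau' (e j) (R j) (?P x) * ?P x * (norm (?E x))\<^sup>2"
    \<comment> \<open>Up to R j the cutoff does not decrease, so the quantity is nonnegative. Beyond
      R j the bound -8 is multiplied by |E|^2 <= e j.\<close>
    have h: "- 8 * e j \<le> ?h"
    proof (cases "?P x \<le> R j")
      case True
      then have "0 \<le> ?h"
        by (intro mult_nonneg_nonneg plateau_facts e R pole_prod_nonneg) auto
      then show ?thesis using e[of j] by linarith
    next
      case False
      then have small: "(norm (?E x))\<^sup>2 \<le> e j" by (intro R0) (auto simp: R_def)
      have "- 8 * e j \<le> - 8 * (norm (?E x))\<^sup>2" using small by simp
      also have "\<dots> \<le> ?h" by (intro mult_right_mono plateau_facts e R pole_prod_nonneg) auto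
      finally show ?thesis .
    qed
    have "(T j x)\<^sup>2 * \<theta> j x * (\<beta>\<^sup>2 * (w x)\<^sup>2 * ?V x - U x) \<le>
     \<beta> * ((T j x)\<^sup>2 * (w x)\<^sup>2 * (2 * ?h + \<theta> j x * ((real DIM('a) - 2) * ?S x))
      + (w x)\<^sup>2 * (2 * T j x * T' j x) * ((\<theta> j x *\<^sub>R ?E x) \<bullet> G x)
      + (T j x)\<^sup>2 * (2 * w x * ((\<theta> j x *\<^sub>R ?E x) \<bullet> \<Gamma> x)))
     + (16 * \<beta> * e j * ((w x)\<^sup>2 * (\<phi> x)\<^sup>2) + (w x)\<^sup>2 * (norm (G x))\<^sup>2)"
      unfolding U_def
    proof (rule completed_square[OF \<theta>01 _ _ _ \<beta> _ h norm_pole_field_sq])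
      show "0 \<le> T' j x" "T' j x \<le> 1"
        using trunc'_bounds[of "real (Suc j)" "\<phi> x"] by (simp_all add: T'_def)
      show "(T j x)\<^sup>2 \<le> (\<phi> x)\<^sup>2"
        using q0(2)[of j x] by (simp add: q_def sq_trunc_def T_def)
      show "x \<notin> a ` {1..n}" by (rule elim(2))
      show "0 \<le> e j" using e[of j] by simp
    qed
    moreover have "J j x = (T j x)\<^sup>2 * (w x)\<^sup>2 * (2 * ?h + \<theta> j x * ((real DIM('a) - 2) * ?S x))
      + (w x)\<^sup>2 * (2 * T j x * T' j x) * ((\<theta> j x *\<^sub>R ?E x) \<bullet> G x)
      + (T j x)\<^sup>2 * (2 * w x * ((\<theta> j x *\<^sub>R ?E x) \<bullet> \<Gamma> x))"
      unfolding J_def cutoff_field_divergence[OF elim(2)]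
      by (simp only: T_def T'_def q_def sq_trunc_def sq_trunc'_def cutoff_field_def \<theta>_def mult.assoc)
    ultimately have "q j x * \<theta> j x * (\<beta>\<^sup>2 * (w x)\<^sup>2 * ?V x - U x) \<le> \<beta> * J j x
      + (16 * \<beta> * e j * ((w x)\<^sup>2 * (\<phi> x)\<^sup>2) + (w x)\<^sup>2 * (norm (G x))\<^sup>2)"
      by (simp only: q_def sq_trunc_def T_def)
    then have 2: "Z j x \<le> \<beta> * J j x + D j x"
      unfolding Z_def D_def by (simp add: algebra_simps)
    from 1 2 show ?case ..
  qed
  have Zint: "(\<integral>\<^sup>+x. ennreal (Z j x) \<partial>lborel) \<le> ennreal (?r j)" and rpos: "0 \<le> ?r j" for j
  proof -
    have JD: "integrable lborel (\<lambda>x. \<beta> * J j x + D j x)"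
      by (intro Bochner_Integration.integrable_add integrable_mult_right J Dint)
    have "(\<integral>\<^sup>+x. ennreal (Z j x) \<partial>lborel) \<le> (\<integral>\<^sup>+x. ennreal (\<beta> * J j x + D j x) \<partial>lborel)"
      by (intro nn_integral_mono_AE eventually_mono[OF Zle[of j]] ennreal_leI) (elim conjE)
    also have "\<dots> = ennreal (LBINT x. \<beta> * J j x + D j x)"
      by (intro nn_integral_eq_integral JD eventually_mono[OF Zle[of j]]) (elim conjE, linarith)
    finally have le: "(\<integral>\<^sup>+x. ennreal (Z j x) \<partial>lborel) \<le> ennreal (LBINT x. \<beta> * J j x + D j x)" .
    have "(LBINT x. \<beta> * J j x + D j x) = \<beta> * (LBINT x. J j x) + (LBINT x. D j x)"
      by (subst Bochner_Integration.integral_add) (intro integrable_mult_right J Dint integral_mult_right_zero | simp)+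
    also have "(LBINT x. D j x) = ?r j"
      unfolding D_def using Iq[of j] \<phi>2 G2 by simp
    finally have eq: "(LBINT x. \<beta> * J j x + D j x) = ?r j" using J(2)[of j] by simp
    show "(\<integral>\<^sup>+x. ennreal (Z j x) \<partial>lborel) \<le> ennreal (?r j)" using le unfolding eq .
    show "0 \<le> ?r j" unfolding eq[symmetric]
      by (intro integral_nonneg_AE eventually_mono[OF Zle[of j]]) (elim conjE, linarith)
  qed
  \<comment> \<open>The C term on the right needs a genuine limit, since C may have either sign;
    \<phi>^2 w^2 dominates.\<close>
  have "(\<lambda>j. LBINT x. q j x * \<theta> j x * (w x)\<^sup>2) \<longlonglongrightarrow> ?a"
  proof (rule integral_dominated_convergence[OF _ _ \<phi>2])
    show "AE x in lborel. (\<lambda>j. q j x * \<theta> j x * (w x)\<^sup>2) \<longlonglongrightarrow> (w x)\<^sup>2 * (\<phi> x)\<^sup>2"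
      using AE_not_pole[of a n]
    proof eventually_elim
      case (elim x)
      have "(\<lambda>j. q j x * \<theta> j x * (w x)\<^sup>2) \<longlonglongrightarrow> (\<phi> x)\<^sup>2 * 1 * (w x)\<^sup>2"
        unfolding q_def by (intro tendsto_mult tendsto_const sq_trunc_tendsto \<theta>lim elim)
      then show ?case by (simp add: mult.commute)
    qed
    show "AE x in lborel. norm (q j x * \<theta> j x * (w x)\<^sup>2) \<le> (w x)\<^sup>2 * (\<phi> x)\<^sup>2" for j
      using q\<theta>[of j] by (intro AE_I2) simp
  qed measurable
  then have rlim0: "(\<lambda>j. ?r j) \<longlonglongrightarrow> C * ?a + (16 * \<beta> * 0 * ?a + ?g)"
    by (intro tendsto_add tendsto_mult tendsto_const elim0)
  then show ?nonneg
    using LIMSEQ_le_const[OF rlim0] rpos by simp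
  from rlim0 have rlim: "(\<lambda>j. ennreal (?r j)) \<longlonglongrightarrow> ennreal (C * ?a + ?g)"
    by (intro tendsto_ennrealI) simp
  have "(\<integral>\<^sup>+x. ennreal ((\<phi> x)\<^sup>2 * (\<beta>\<^sup>2 * (w x)\<^sup>2 * ?V x - U x + C * (w x)\<^sup>2)) \<partial>lborel)
    = (\<integral>\<^sup>+x. liminf (\<lambda>j. ennreal (Z j x)) \<partial>lborel)"
  proof (rule nn_integral_cong_AE)
    show "AE x in lborel. ennreal ((\<phi> x)\<^sup>2 * (\<beta>\<^sup>2 * (w x)\<^sup>2 * ?V x - U x + C * (w x)\<^sup>2)) = liminf (\<lambda>j. ennreal (Z j x))"
      using AE_not_pole[of a n]
    proof eventually_elim
      case (elim x)
      have "(\<lambda>j. Z j x) \<longlonglongrightarrow> (\<phi> x)\<^sup>2 * 1 * (\<beta>\<^sup>2 * (w x)\<^sup>2 * ?V x - U x + C * (w x)\<^sup>2)"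
        unfolding Z_def q_def by (intro tendsto_mult tendsto_const sq_trunc_tendsto \<theta>lim elim)
      then have "(\<lambda>j. ennreal (Z j x)) \<longlonglongrightarrow> ennreal ((\<phi> x)\<^sup>2 * (\<beta>\<^sup>2 * (w x)\<^sup>2 * ?V x - U x + C * (w x)\<^sup>2))"
        by (intro tendsto_ennrealI) simp
      then show ?case by (intro lim_imp_Liminf[symmetric]) simp_all
    qed
  qed
  also have "\<dots> \<le> liminf (\<lambda>j. \<integral>\<^sup>+x. ennreal (Z j x) \<partial>lborel)"
    by (rule nn_integral_liminf) measurable
  also have "\<dots> \<le> liminf (\<lambda>j. ennreal (?r j))"
    by (intro Liminf_mono always_eventually allI Zint)
  also have "\<dots> = ennreal (C * ?a + ?g)"
    by (intro lim_imp_Liminf rlim) simp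
  finally show ?bound .
qed

section \<open>Return to the weighted spaces and the extended integrals\<close>

lemma ext_integral_eq_integral:
  assumes "integrable M f" shows "ext_integral M f = ereal (\<integral>x. f x \<partial>M)"
proof -
  have fin: "(\<integral>\<^sup>+x. ennreal (f x) \<partial>M) \<noteq> \<infinity>" "(\<integral>\<^sup>+x. ennreal (- f x) \<partial>M) \<noteq> \<infinity>"
    using assms unfolding real_integrable_def by blast+
  have *: "\<exists>p\<ge>0. X = ennreal p" if "X \<noteq> \<infinity>" for X
    using that by (cases X rule: ennreal_cases) auto
  from *[OF fin(1)] *[OF fin(2)] obtain p m where "0 \<le> p" "(\<integral>\<^sup>+x. ennreal (f x) \<partial>M) = ennreal p"
    "0 \<le> m" "(\<integral>\<^sup>+x. ennreal (- f x) \<partial>M) = ennreal m"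
    by blast
  then show ?thesis
    unfolding ext_integral_def real_lebesgue_integral_def[OF assms] by simp
qed

lemma has_weak_gradient_weak_grad:
  "weakly_differentiable f \<Longrightarrow> has_weak_gradient f (weak_grad f)"
  unfolding weakly_differentiable_def weak_grad_def by (rule someI_ex[where P = "has_weak_gradient f"])

text \<open>A finite integral over a ball makes the reciprocal finite almost everywhere there, and
  \<open>inverse 0\<close> is infinite in \<open>ennreal\<close>; countably many balls cover the
  space.\<close>

lemma reciprocal_L1_loc_AE_pos:
  assumes "reciprocal_L1_loc \<mu>" "\<And>x. 0 \<le> \<mu> x"
  shows "AE x in lebesgue. \<mu> x > 0"
proof -
  have [measurable]: "\<mu> \<in> borel_measurable lebesgue" using assms by (simp add: reciprocal_L1_loc_def)
  have "AE x in lebesgue. \<forall>k::nat. x \<in> cball 0 (real k) \<longrightarrow> \<mu> x > 0"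
    unfolding AE_all_countable
  proof
    fix k :: nat
    have "(\<integral>\<^sup>+x. inverse (ennreal (\<mu> x)) * indicator (cball 0 (real k)) x \<partial>lebesgue) \<noteq> \<infinity>"
      by (rule less_imp_neq[OF assms(1)[unfolded reciprocal_L1_loc_def, THEN conjunct2, rule_format, OF compact_cball]])
    moreover have [measurable]: "cball 0 (real k) \<in> sets lebesgue" by simp
    ultimately have "AE x in lebesgue. inverse (ennreal (\<mu> x)) * indicator (cball 0 (real k)) x \<noteq> \<infinity>"
      by (intro nn_integral_PInf_AE) measurable
    then show "AE x in lebesgue. x \<in> cball 0 (real k) \<longrightarrow> \<mu> x > 0"
    proof eventually_elim
      case (elim x)
      show ?case
      proof
        assume "x \<in> cball 0 (real k)"
        then have "inverse (ennreal (\<mu> x)) \<noteq> top" using elim by simp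
        then have "\<mu> x \<noteq> 0" by (intro notI) simp
        then show "\<mu> x > 0" using assms(2)[of x] by linarith
      qed
    qed
  qed
  then show ?thesis
  proof eventually_elim
    case (elim x)
    obtain k :: nat where "norm x \<le> real k" using real_arch_simple by blast
    then show ?case using elim by auto
  qed
qed

lemma borel_imp_lebesgue_measurable:
  "f \<in> borel_measurable borel \<Longrightarrow> f \<in> borel_measurable lebesgue"
  by (rule measurable_completion) simp

text \<open>h' represents the product \<mu> h rather than h, so the weight is absorbed into a Borel
  integrand on \<open>lborel\<close>.\<close>

lemma weighted_integral_transfer:
  fixes \<mu> h h' :: "'a::euclidean_space \<Rightarrow> real"
  assumes \<mu>[measurable]: "\<mu> \<in> borel_measurable lebesgue" and nonneg: "\<And>x. 0 \<le> \<mu> x"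
    and h[measurable]: "h \<in> borel_measurable lebesgue" and h': "h' \<in> borel_measurable borel"
    and eq: "AE x in lborel. \<mu> x * h x = h' x"
  shows "integrable (weighted \<mu>) h \<longleftrightarrow> integrable lborel h'"
    and "(\<integral>x. h x \<partial>weighted \<mu>) = (LBINT x. h' x)"
    and "(\<integral>\<^sup>+x. ennreal (h x) \<partial>weighted \<mu>) = (\<integral>\<^sup>+x. ennreal (h' x) \<partial>lborel)"
proof -
  have m: "(\<lambda>x. \<mu> x * h x) \<in> borel_measurable lebesgue" by measurable
  note t = integrable_lebesgue_iff_lborel[OF m h' eq]
  show "integrable (weighted \<mu>) h \<longleftrightarrow> integrable lborel h'"
    unfolding weighted_def t(1)[symmetric] by (subst integrable_density) (auto simp: nonneg)
  show "(\<integral>x. h x \<partial>weighted \<mu>) = (LBINT x. h' x)"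
    unfolding weighted_def t(2)[symmetric] by (subst integral_density) (auto simp: nonneg)
  have "(\<integral>\<^sup>+x. ennreal (h x) \<partial>weighted \<mu>) = (\<integral>\<^sup>+x. ennreal (\<mu> x) * ennreal (h x) \<partial>lebesgue)"
    unfolding weighted_def by (rule nn_integral_density) measurable
  also have "\<dots> = (\<integral>\<^sup>+x. ennreal (h' x) \<partial>lebesgue)"
  proof (rule nn_integral_cong_AE)
    show "AE x in lebesgue. ennreal (\<mu> x) * ennreal (h x) = ennreal (h' x)"
      unfolding AE_completion_iff using eq
      by eventually_elim (simp add: ennreal_mult'[OF nonneg, symmetric])
  qed
  also have "\<dots> = (\<integral>\<^sup>+x. ennreal (h' x) \<partial>lborel)" by (rule nn_integral_completion)
  finally show "(\<integral>\<^sup>+x. ennreal (h x) \<partial>weighted \<mu>) = (\<integral>\<^sup>+x. ennreal (h' x) \<partial>lborel)" .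
qed

text \<open>\<open>weak_grad \<mu>\<close> is an arbitrary choice, so its formula must be proved:
  the square rule shows that 2 w \<Gamma> is a weak gradient of \<mu>, whence \<mu> is weakly
  differentiable, and uniqueness identifies the chosen representative with 2 w \<Gamma> almost
  everywhere.\<close>

lemma weight_representation:
  fixes \<mu> :: "'a::euclidean_space \<Rightarrow> real"
  assumes \<mu>: "\<mu> \<in> borel_measurable lebesgue" and nonneg: "\<And>x. 0 \<le> \<mu> x" and H: "(\<lambda>x. sqrt (\<mu> x)) \<in> H1_loc"
  obtains w \<Gamma> where "w \<in> borel_measurable borel" "\<Gamma> \<in> borel_measurable borel"
    "AE x in lborel. \<mu> x = (w x)\<^sup>2" "AE x in lborel. weak_grad \<mu> x = (2 * w x) *\<^sub>R \<Gamma> x"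
    "weak_grad \<mu> \<in> borel_measurable lebesgue"
    "\<And>b. b \<in> Basis \<Longrightarrow> has_weak_partial w (\<lambda>x. \<Gamma> x \<bullet> b) b"
    "loc_int (\<lambda>x. (w x)\<^sup>2)" "\<And>b. b \<in> Basis \<Longrightarrow> loc_int (\<lambda>x. (\<Gamma> x \<bullet> b)\<^sup>2)"
proof -
  let ?w = "\<lambda>x. sqrt (\<mu> x)"
  let ?\<Gamma> = "weak_grad ?w"
  have L2: "?w \<in> L2_loc" "?\<Gamma> \<in> L2_loc" and wd: "weakly_differentiable ?w"
    using H by (auto simp: H1_loc_def)
  have wm: "?w \<in> borel_measurable lebesgue" "?\<Gamma> \<in> borel_measurable lebesgue"
    using L2 by (auto simp: L2_loc_def)
  obtain w where w: "w \<in> borel_measurable borel" "AE x in lborel. ?w x = w x"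
    using lebesgue_borel_representative[OF wm(1)] by blast
  obtain \<Gamma> where \<Gamma>: "\<Gamma> \<in> borel_measurable borel" "AE x in lborel. ?\<Gamma> x = \<Gamma> x"
    using lebesgue_borel_representative[OF wm(2)] by blast
  note [measurable] = w(1) \<Gamma>(1)
  have partials: "has_weak_partial w (\<lambda>x. \<Gamma> x \<bullet> b) b" if "b \<in> Basis" for b
    by (rule has_weak_gradient_iff_partials[THEN iffD1, rule_format, OF wm(1) w wm(2) \<Gamma> has_weak_gradient_weak_grad[OF wd] that])
  have w2: "loc_int (\<lambda>x. (w x)\<^sup>2)"
  proof (rule locally_integrable_imp_loc_int)
    show "locally_integrable (\<lambda>x. (norm (?w x))\<^sup>2)" using L2(1) by (simp add: L2_loc_def)
    show "AE x in lborel. (norm (?w x))\<^sup>2 = (w x)\<^sup>2" using w(2) by eventually_elim simp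
  qed measurable
  have "loc_int (\<lambda>x. (norm (\<Gamma> x))\<^sup>2)"
  proof (rule locally_integrable_imp_loc_int)
    show "locally_integrable (\<lambda>x. (norm (?\<Gamma> x))\<^sup>2)" using L2(2) by (simp add: L2_loc_def)
    show "AE x in lborel. (norm (?\<Gamma> x))\<^sup>2 = (norm (\<Gamma> x))\<^sup>2" using \<Gamma>(2) by eventually_elim simp
  qed measurable
  then have \<Gamma>2: "loc_int (\<lambda>x. (\<Gamma> x \<bullet> b)\<^sup>2)" if "b \<in> Basis" for b
  proof (rule loc_int_mono)
    show "\<bar>(\<Gamma> x \<bullet> b)\<^sup>2\<bar> \<le> \<bar>(norm (\<Gamma> x))\<^sup>2\<bar>" for x
      using Basis_le_norm[OF that, of "\<Gamma> x"] by (simp add: abs_le_square_iff[symmetric])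
  qed measurable
  have \<mu>w: "AE x in lborel. \<mu> x = (w x)\<^sup>2"
    using w(2)
  proof eventually_elim
    case (elim x)
    have "\<mu> x = (sqrt (\<mu> x))\<^sup>2" using nonneg[of x] by simp
    then show ?case using elim by simp
  qed
  define M where "M x = (2 * w x) *\<^sub>R \<Gamma> x" for x
  have M[measurable]: "M \<in> borel_measurable borel" unfolding M_def[abs_def] by measurable
  have Mp: "has_weak_partial (\<lambda>x. (w x)\<^sup>2) (\<lambda>x. M x \<bullet> b) b" if b: "b \<in> Basis" for b
    using has_weak_partial_square[OF partials[OF b] b w2 \<Gamma>2[OF b]] by (simp add: M_def)
  have w2m: "(\<lambda>x. (w x)\<^sup>2) \<in> borel_measurable borel" by measurable
  have Ml: "M \<in> borel_measurable lebesgue" by (rule borel_imp_lebesgue_measurable[OF M])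
  have "has_weak_gradient \<mu> M"
  proof (rule has_weak_gradient_iff_partials[THEN iffD2, OF \<mu> w2m \<mu>w Ml M])
    show "AE x in lborel. M x = M x" by simp
  qed (rule ballI, rule Mp)
  then have "weakly_differentiable \<mu>" by (auto simp: weakly_differentiable_def)
  then have wg: "has_weak_gradient \<mu> (weak_grad \<mu>)" by (rule has_weak_gradient_weak_grad)
  then have gm: "weak_grad \<mu> \<in> borel_measurable lebesgue"
    by (intro locally_integrable_measurable) (simp add: has_weak_gradient_def)
  obtain g where g: "g \<in> borel_measurable borel" "AE x in lborel. weak_grad \<mu> x = g x"
    using lebesgue_borel_representative[OF gm] by blast
  have gp: "has_weak_partial (\<lambda>x. (w x)\<^sup>2) (\<lambda>x. g x \<bullet> b) b" if "b \<in> Basis" for b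
    by (rule has_weak_gradient_iff_partials[THEN iffD1, rule_format, OF \<mu> w2m \<mu>w gm g wg that])
  have "AE x in lborel. \<forall>b\<in>Basis. g x \<bullet> b = M x \<bullet> b"
    by (intro AE_finite_allI finite_Basis has_weak_partial_unique[OF gp Mp])
  then have "AE x in lborel. weak_grad \<mu> x = (2 * w x) *\<^sub>R \<Gamma> x"
    using g(2)
  proof eventually_elim
    case (elim x)
    have "g x = M x" by (rule euclidean_eqI) (rule bspec[OF elim(1)])
    then show ?case using elim(2) by (simp add: M_def)
  qed
  then show thesis
    by (rule that[OF w(1) \<Gamma>(1) \<mu>w _ gm partials w2 \<Gamma>2])
qed

text \<open>Multiplication by \<mu> clears the quotient \<nabla>\<mu> / \<mu> and leaves E .
  \<nabla>\<mu>; with \<nabla>\<mu> = 2 w \<Gamma> this becomes the \<open>U\<close> of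
  \<open>weighted_hardy_core\<close>.\<close>

lemma multipole_W_weighted:
  fixes K :: real and n :: nat and x :: "'a::euclidean_space"
  assumes "\<mu> x \<noteq> 0"
  defines "\<beta> \<equiv> (real DIM('a) + K - 2) / real n"
  shows "\<mu> x * multipole_W n a \<mu> K x =
    \<mu> x * (\<beta> * K * inv_sq_sum n a x) - \<beta> * (pole_field n a x \<bullet> weak_grad \<mu> x)"
proof -
  have "\<mu> x * multipole_W n a \<mu> K x = (\<Sum>i=1..n. - (\<mu> x * (\<beta> / (norm (x - a i))\<^sup>2 *
       ((x - a i) \<bullet> (weak_grad \<mu> x /\<^sub>R \<mu> x) - K))))"
    unfolding multipole_W_def Let_def \<beta>_def[symmetric] by (simp add: sum_distrib_left sum_negf)
  also have "\<dots> = (\<Sum>i=1..n. \<mu> x * (\<beta> * K * (1 / (norm (x - a i))\<^sup>2))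
      - \<beta> * (((1 / (norm (x - a i))\<^sup>2) *\<^sub>R (x - a i)) \<bullet> weak_grad \<mu> x))"
  proof (rule sum.cong[OF refl])
    fix i
    show "- (\<mu> x * (\<beta> / (norm (x - a i))\<^sup>2 * ((x - a i) \<bullet> (weak_grad \<mu> x /\<^sub>R \<mu> x) - K)))
      = \<mu> x * (\<beta> * K * (1 / (norm (x - a i))\<^sup>2))
      - \<beta> * (((1 / (norm (x - a i))\<^sup>2) *\<^sub>R (x - a i)) \<bullet> weak_grad \<mu> x)"
    proof -
      have "- (m * (\<beta> * s * (inverse m * d - K))) = m * (\<beta> * K * s) - \<beta> * (s * d)" if "m \<noteq> 0" for m s d :: real
        using that by (simp add: field_simps)
      from this[OF assms(1), of "1 / (norm (x - a i))\<^sup>2" "(x - a i) \<bullet> weak_grad \<mu> x"] show ?thesis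
        by simp
    qed
  qed
  finally show ?thesis
    by (simp add: sum_subtractf inv_sq_sum_def pole_field_def inner_sum_left sum_distrib_left)
qed

theorem theorem2p1:
  fixes \<mu> :: "'a::euclidean_space \<Rightarrow> real"
    and a :: "nat \<Rightarrow> 'a" and n :: nat and C K :: real
  assumes "DIM('a) \<ge> 3" and "n \<ge> 2" and "inj_on a {1..n}"
    and "\<And>x. \<mu> x \<ge> 0"
    and "(\<lambda>x. sqrt (\<mu> x)) \<in> H1_loc" and "reciprocal_L1_loc \<mu>"
    and "K > 2 - real DIM('a)"
    and "AE x in lebesgue. multipole_W n a \<mu> K x \<le> C"
  shows "\<forall>\<phi>\<in>H1 \<mu>.
      ereal (hardy_const TYPE('a) n K) *
          ext_integral (weighted \<mu>) (\<lambda>x. multipole_V n a x * (\<phi> x)\<^sup>2)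
        \<le> ext_integral (weighted \<mu>) (\<lambda>x. (norm (weak_grad \<phi> x))\<^sup>2)
          + ext_integral (weighted \<mu>) (\<lambda>x. multipole_W n a \<mu> K x * (\<phi> x)\<^sup>2)
    \<and> ereal (hardy_const TYPE('a) n K) *
          ext_integral (weighted \<mu>) (\<lambda>x. multipole_V n a x * (\<phi> x)\<^sup>2)
        \<le> ext_integral (weighted \<mu>) (\<lambda>x. (norm (weak_grad \<phi> x))\<^sup>2)
          + ereal C * ext_integral (weighted \<mu>) (\<lambda>x. (\<phi> x)\<^sup>2)"
proof
  fix \<phi> assume \<phi>H: "\<phi> \<in> H1 \<mu>"
  note nonneg = assms(4)
  let ?V = "multipole_V n a" and ?W = "multipole_W n a \<mu> K" and ?G = "weak_grad \<phi>"
  define \<beta> where "\<beta> = (real DIM('a) + K - 2) / real n"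
  have n: "n \<ge> 1" "real n > 0" using assms(2) by auto
  have \<beta>: "0 < \<beta>" "\<beta> * real n = real DIM('a) - 2 + K"
    using n assms(7) by (auto simp: \<beta>_def)
  have c: "hardy_const TYPE('a) n K = \<beta>\<^sup>2" by (simp add: hardy_const_def \<beta>_def power_divide)
  have \<mu>[measurable]: "\<mu> \<in> borel_measurable lebesgue" using assms(6) by (simp add: reciprocal_L1_loc_def)
  have pos: "AE x in lborel. \<mu> x > 0"
    using reciprocal_L1_loc_AE_pos[OF assms(6,4)] by (simp add: AE_completion_iff)
  obtain w \<Gamma> where wm: "w \<in> borel_measurable borel" "\<Gamma> \<in> borel_measurable borel"
    and \<mu>w: "AE x in lborel. \<mu> x = (w x)\<^sup>2" and M: "AE x in lborel. weak_grad \<mu> x = (2 * w x) *\<^sub>R \<Gamma> x"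
    and gm: "weak_grad \<mu> \<in> borel_measurable lebesgue"
    and wp: "\<And>b. b \<in> Basis \<Longrightarrow> has_weak_partial w (\<lambda>x. \<Gamma> x \<bullet> b) b"
    and w2: "loc_int (\<lambda>x. (w x)\<^sup>2)" and \<Gamma>2: "\<And>b. b \<in> Basis \<Longrightarrow> loc_int (\<lambda>x. (\<Gamma> x \<bullet> b)\<^sup>2)"
    using weight_representation[OF \<mu> nonneg assms(5)] by blast
  have wd: "weakly_differentiable \<phi>" and \<phi>L: "\<phi> \<in> L2 (weighted \<mu>)" "?G \<in> L2 (weighted \<mu>)"
    using \<phi>H by (auto simp: H1_def)
  have \<phi>m: "\<phi> \<in> borel_measurable lebesgue" "?G \<in> borel_measurable lebesgue"
    using \<phi>L by (auto simp: L2_def weighted_def)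
  obtain f where f: "f \<in> borel_measurable borel" "AE x in lborel. \<phi> x = f x"
    using lebesgue_borel_representative[OF \<phi>m(1)] by blast
  obtain G where G: "G \<in> borel_measurable borel" "AE x in lborel. ?G x = G x"
    using lebesgue_borel_representative[OF \<phi>m(2)] by blast
  note [measurable] = wm f(1) G(1) gm \<phi>m
  have fp: "has_weak_partial f (\<lambda>x. G x \<bullet> b) b" if "b \<in> Basis" for b
    by (rule has_weak_gradient_iff_partials[THEN iffD1, rule_format, OF \<phi>m(1) f \<phi>m(2) G has_weak_gradient_weak_grad[OF wd] that])
  have m1: "(\<lambda>x. (\<phi> x)\<^sup>2) \<in> borel_measurable lebesgue" "(\<lambda>x. (norm (?G x))\<^sup>2) \<in> borel_measurable lebesgue"
    by measurable
  have m2: "(\<lambda>x. (w x)\<^sup>2 * (f x)\<^sup>2) \<in> borel_measurable borel" "(\<lambda>x. (w x)\<^sup>2 * (norm (G x))\<^sup>2) \<in> borel_measurable borel"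
    by measurable
  have e1: "AE x in lborel. \<mu> x * (\<phi> x)\<^sup>2 = (w x)\<^sup>2 * (f x)\<^sup>2"
    using \<mu>w f(2) by eventually_elim simp
  have e2: "AE x in lborel. \<mu> x * (norm (?G x))\<^sup>2 = (w x)\<^sup>2 * (norm (G x))\<^sup>2"
    using \<mu>w G(2) by eventually_elim simp
  note t1 = weighted_integral_transfer[OF \<mu> nonneg m1(1) m2(1) e1]
  note t2 = weighted_integral_transfer[OF \<mu> nonneg m1(2) m2(2) e2]
  have i1: "integrable (weighted \<mu>) (\<lambda>x. (\<phi> x)\<^sup>2)" and i2: "integrable (weighted \<mu>) (\<lambda>x. (norm (?G x))\<^sup>2)"
    using \<phi>L by (auto simp: L2_def)
  let ?a = "\<integral>x. (\<phi> x)\<^sup>2 \<partial>weighted \<mu>" and ?g = "\<integral>x. (norm (?G x))\<^sup>2 \<partial>weighted \<mu>"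
  define U where "U x = (w x)\<^sup>2 * (\<beta> * K * inv_sq_sum n a x) - \<beta> * (2 * w x * (pole_field n a x \<bullet> \<Gamma> x))" for x
  have WU: "AE x in lborel. \<mu> x * ?W x = U x"
    using pos \<mu>w M
  proof eventually_elim
    case (elim x)
    then have "\<mu> x * ?W x = \<mu> x * (\<beta> * K * inv_sq_sum n a x) - \<beta> * (pole_field n a x \<bullet> weak_grad \<mu> x)"
      unfolding \<beta>_def by (intro multipole_W_weighted) simp
    then show ?case using elim by (simp add: U_def mult_ac)
  qed
  have WC: "AE x in lborel. ?W x \<le> C" using assms(8) by (simp add: AE_completion_iff)
  have UC: "AE x in lborel. U x \<le> C * (w x)\<^sup>2"
    using WU WC \<mu>w
  proof eventually_elim
    case (elim x)
    have "\<mu> x * ?W x \<le> \<mu> x * C" using elim(2) nonneg by (rule mult_left_mono)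
    then show ?case using elim by (simp add: mult.commute)
  qed
  note core = weighted_hardy_core[OF n(1) less_imp_le[OF \<beta>(1)] \<beta>(2) fp wp f(1) wm(1) G(1) wm(2) w2 \<Gamma>2
      i1[unfolded t1(1)] i2[unfolded t2(1)] UC[unfolded U_def],
      folded U_def t1(2) t2(2)]
  \<comment> \<open>The combination with a sign: V >= 0 and W <= C almost everywhere.\<close>
  define H where "H x = (\<beta>\<^sup>2 * ?V x + (C - ?W x)) * (\<phi> x)\<^sup>2" for x
  have Vm[measurable]: "?V \<in> borel_measurable lebesgue"
    by (rule borel_imp_lebesgue_measurable[OF borel_measurable_multipole_V])
  have Wm[measurable]: "?W \<in> borel_measurable lebesgue"
  proof -
    have [measurable]: "(\<lambda>x. x) \<in> lebesgue \<rightarrow>\<^sub>M (borel :: 'a measure)"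
      by (rule borel_imp_lebesgue_measurable) simp
    show ?thesis unfolding multipole_W_def[abs_def] Let_def by measurable
  qed
  have Hm[measurable]: "H \<in> borel_measurable lebesgue" unfolding H_def[abs_def] by measurable
  have "(\<integral>\<^sup>+x. ennreal (H x) \<partial>weighted \<mu>) = (\<integral>\<^sup>+x. ennreal ((f x)\<^sup>2 * (\<beta>\<^sup>2 * (w x)\<^sup>2 * ?V x - U x + C * (w x)\<^sup>2)) \<partial>lborel)"
  proof (rule weighted_integral_transfer(3)[OF \<mu> nonneg Hm])
    show "AE x in lborel. \<mu> x * H x = (f x)\<^sup>2 * (\<beta>\<^sup>2 * (w x)\<^sup>2 * ?V x - U x + C * (w x)\<^sup>2)"
      using WU \<mu>w f(2)
    proof eventually_elim
      case (elim x)
      have "\<mu> x * H x = (\<phi> x)\<^sup>2 * (\<beta>\<^sup>2 * \<mu> x * ?V x - \<mu> x * ?W x + C * \<mu> x)"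
        by (simp add: H_def algebra_simps)
      then show ?case unfolding elim(1) unfolding elim(2,3) .
    qed
  qed (unfold U_def, measurable)
  with core(1) have Hle: "(\<integral>\<^sup>+x. ennreal (H x) \<partial>weighted \<mu>) \<le> ennreal (C * ?a + ?g)" by simp
  have WCw: "AE x in weighted \<mu>. ?W x \<le> C"
    unfolding weighted_def using WC by (subst AE_density) (auto simp: AE_completion_iff)
  then have H0: "AE x in weighted \<mu>. 0 \<le> H x"
    by eventually_elim (simp add: H_def multipole_V_nonneg)
  have Vmw: "?V \<in> borel_measurable (weighted \<mu>)" "?W \<in> borel_measurable (weighted \<mu>)"
    "H \<in> borel_measurable (weighted \<mu>)" "\<phi> \<in> borel_measurable (weighted \<mu>)"
    using Vm Wm Hm \<phi>m by (auto simp: weighted_def)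
  note [measurable] = Vmw
  have iH: "integrable (weighted \<mu>) H"
  proof (rule integrableI_nonneg[OF Vmw(3) H0])
    show "(\<integral>\<^sup>+x. ennreal (H x) \<partial>weighted \<mu>) < \<infinity>"
      using Hle by (rule le_less_trans) simp
  qed
  \<comment> \<open>As C - W >= 0, the function H dominates \<beta>^2 V \<phi>^2, and \<beta> > 0
    because K > 2 - N.\<close>
  have iV: "integrable (weighted \<mu>) (\<lambda>x. ?V x * (\<phi> x)\<^sup>2)"
  proof (rule Bochner_Integration.integrable_bound[OF integrable_mult_right[OF iH, of "1 / \<beta>\<^sup>2"]])
    show "AE x in weighted \<mu>. norm (?V x * (\<phi> x)\<^sup>2) \<le> norm (1 / \<beta>\<^sup>2 * H x)"
      using WCw H0
    proof eventually_elim
      case (elim x)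
      have "\<beta>\<^sup>2 * (?V x * (\<phi> x)\<^sup>2) \<le> H x"
        using elim mult_right_mono[of "\<beta>\<^sup>2 * ?V x" "\<beta>\<^sup>2 * ?V x + (C - ?W x)" "(\<phi> x)\<^sup>2"] by (simp add: H_def mult.assoc)
      then have "?V x * (\<phi> x)\<^sup>2 \<le> 1 / \<beta>\<^sup>2 * H x"
        using \<beta>(1) by (simp add: pos_le_divide_eq mult.commute)
      then show ?case using elim multipole_V_nonneg[of n a x] by simp
    qed
  qed measurable
  \<comment> \<open>W \<phi>^2 is a combination of functions already known to be integrable, so its
    negative part is integrable too.\<close>
  have iW: "integrable (weighted \<mu>) (\<lambda>x. ?W x * (\<phi> x)\<^sup>2)"
  proof -
    have "integrable (weighted \<mu>) (\<lambda>x. \<beta>\<^sup>2 * (?V x * (\<phi> x)\<^sup>2) + C * (\<phi> x)\<^sup>2 - H x)"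
      by (intro Bochner_Integration.integrable_diff Bochner_Integration.integrable_add integrable_mult_right iV i1 iH)
    then show ?thesis by (simp add: H_def algebra_simps)
  qed
  let ?v = "\<integral>x. ?V x * (\<phi> x)\<^sup>2 \<partial>weighted \<mu>" and ?o = "\<integral>x. ?W x * (\<phi> x)\<^sup>2 \<partial>weighted \<mu>"
  have oC: "?o \<le> C * ?a"
  proof -
    have "?o \<le> (\<integral>x. C * (\<phi> x)\<^sup>2 \<partial>weighted \<mu>)"
    proof (rule integral_mono_AE[OF iW integrable_mult_right[OF i1]])
      show "AE x in weighted \<mu>. ?W x * (\<phi> x)\<^sup>2 \<le> C * (\<phi> x)\<^sup>2"
        using WCw by eventually_elim (simp add: mult_right_mono)
    qed
    then show ?thesis by simp
  qed
  have "ennreal (\<integral>x. H x \<partial>weighted \<mu>) \<le> ennreal (C * ?a + ?g)"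
    using Hle by (subst nn_integral_eq_integral[symmetric, OF iH H0])
  moreover have "(\<integral>x. H x \<partial>weighted \<mu>) = \<beta>\<^sup>2 * ?v + C * ?a - ?o"
  proof -
    have "(\<integral>x. H x \<partial>weighted \<mu>) = (\<integral>x. \<beta>\<^sup>2 * (?V x * (\<phi> x)\<^sup>2) + C * (\<phi> x)\<^sup>2 - ?W x * (\<phi> x)\<^sup>2 \<partial>weighted \<mu>)"
      by (simp add: H_def algebra_simps)
    also have "\<dots> = \<beta>\<^sup>2 * ?v + C * ?a - ?o"
      using iV i1 iW by simp
    finally show ?thesis .
  qed
  \<comment> \<open>The C terms cancel; \<open>core(2)\<close> is what allows \<open>ennreal\<close>
    to be stripped.\<close>
  ultimately have main: "\<beta>\<^sup>2 * ?v \<le> ?g + ?o"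
    using core(2) by (simp add: ennreal_le_iff)
  \<comment> \<open>All four extended integrals are finite, so both claims are inequalities between
    reals; the second uses \<open>oC\<close>.\<close>
  show "ereal (hardy_const TYPE('a) n K) * ext_integral (weighted \<mu>) (\<lambda>x. ?V x * (\<phi> x)\<^sup>2)
        \<le> ext_integral (weighted \<mu>) (\<lambda>x. (norm (?G x))\<^sup>2) + ext_integral (weighted \<mu>) (\<lambda>x. ?W x * (\<phi> x)\<^sup>2)
    \<and> ereal (hardy_const TYPE('a) n K) * ext_integral (weighted \<mu>) (\<lambda>x. ?V x * (\<phi> x)\<^sup>2)
        \<le> ext_integral (weighted \<mu>) (\<lambda>x. (norm (?G x))\<^sup>2) + ereal C * ext_integral (weighted \<mu>) (\<lambda>x. (\<phi> x)\<^sup>2)"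
    unfolding c ext_integral_eq_integral[OF iV] ext_integral_eq_integral[OF i2]
      ext_integral_eq_integral[OF iW] ext_integral_eq_integral[OF i1]
    using main oC by simp
qed

end
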